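(* Suppose that $I,J$ are homogeneous Artinian ideals of $R=k[x_1,x_2,x_3]$ having the same graded Betti numbers. If $R/I$ and $R/J$ have the weak Lefschetz property, then $$\{T\in\mathcal{G}(\mathrm{gin}(I)) \mid \max(T)\le 2\}=\{T\in\mathcal{G}(\mathrm{gin}(J)) \mid \max(T)\le 2\}.$$ In particular, $\mathrm{gin}(I)_d=\mathrm{gin}(J)_d$ for any $d\le r_1(A)$, where $A=R/I$.
   Context: $k$ is a field of characteristic $0$, $R=k[x_1,x_2,x_3]$ with the standard grading. A homogeneous ideal $I\subsetneq R$ is called Artinian if $R/I$ is Artinian. $\mathrm{gin}(I)$ denotes the generic initial ideal of $I$ with respect to the reverse lexicographic order (with $x_1>x_2>x_3$): $\mathrm{gin}(I)=\mathrm{in}(gI)$ for $g$ in a nonempty Zariski open subset of $GL_3(k)$. For a monomial ideal $K$, $\mathcal{G}(K)$ is its minimal system of monomial generators. For a monomial $T$, $\max(T)=\max\{i \mid x_i\text{ divides }T\}$. The graded Betti numbers of a homogeneous ideal $K$ are $\beta_{q,i}(K)=\dim_k\mathrm{Tor}^R_q(K,k)_i$. The subscript $d$ denotes the degree-$d$ component. Weak Lefschetz property of $A=R/I$: there is a linear form $L\in R$ such that $\times L:A_d\to A_{d+1}$ has maximal rank (is injective or surjective) for each $d\ge 0$. First reduction number: $r_1(A)=\min\{t \mid (R/(I+(L)))_{t+1}=0\}$, where $L$ is a general linear form of $R$. *)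

theory Defs
  imports "HOL-Analysis.Determinants" "HOL-Library.Poly_Mapping"
begin

(* The variables are indexed by the elements 1, 2, 3 of the three-element type 3 (in which 3 = 0).
   A monomial is its exponent vector, so monomials multiply by adding exponent vectors. *)

type_synonym mon = "3 \<Rightarrow>\<^sub>0 nat"
type_synonym 'a poly3 = "mon \<Rightarrow>\<^sub>0 'a"

definition monom :: "mon \<Rightarrow> 'a::comm_ring_1 poly3" where
  "monom T = Poly_Mapping.single T 1"

definition pconst :: "'a::zero \<Rightarrow> 'a poly3" where
  "pconst c = Poly_Mapping.single 0 c"

definition xvar :: "3 \<Rightarrow> 'a::comm_ring_1 poly3" where
  "xvar i = monom (Poly_Mapping.single i 1)"

definition mdeg :: "mon \<Rightarrow> nat" where
  "mdeg T = (\<Sum>i\<in>UNIV. Poly_Mapping.lookup T i)"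

(* max(1) = 0 by convention. *)
definition max_var :: "mon \<Rightarrow> nat" where
  "max_var T = Max (insert 0 {i \<in> {1..3}. Poly_Mapping.lookup T (of_nat i) \<noteq> 0})"

definition homogeneous :: "nat \<Rightarrow> 'a::zero poly3 \<Rightarrow> bool" where
  "homogeneous d p \<longleftrightarrow> (\<forall>T\<in>Poly_Mapping.keys p. mdeg T = d)"

definition degree_part :: "'a::zero poly3 set \<Rightarrow> nat \<Rightarrow> 'a poly3 set" where
  "degree_part K d = {p \<in> K. homogeneous d p}"

(* Evaluation of a polynomial at a point x, its coefficients being mapped by h. *)
definition peval :: "('a::zero \<Rightarrow> 'b::comm_ring_1) \<Rightarrow> ('i \<Rightarrow> 'b) \<Rightarrow> (('i \<Rightarrow>\<^sub>0 nat) \<Rightarrow>\<^sub>0 'a) \<Rightarrow> 'b" where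
  "peval h x p = (\<Sum>T\<in>Poly_Mapping.keys p. h (Poly_Mapping.lookup p T) *
                    (\<Prod>i\<in>Poly_Mapping.keys T. x i ^ Poly_Mapping.lookup T i))"

(* Ideals of a commutative ring are its submodules: ideal.subspace I says that I is an ideal,
   ideal.span S is the ideal generated by S. *)
interpretation ideal: module "(*) :: 'a::comm_ring_1 \<Rightarrow> 'a \<Rightarrow> 'a"
  by standard (simp_all add: algebra_simps)

(* As a rewrite rule on ring products this would loop with mult.assoc. *)
declare ideal.scale_scale [simp del]

definition homogeneous_ideal :: "'a::comm_ring_1 poly3 set \<Rightarrow> bool" where
  "homogeneous_ideal I \<longleftrightarrow> (\<exists>S. (\<forall>p\<in>S. \<exists>d. homogeneous d p) \<and> I = ideal.span S)"

(* Descending chain condition for the ideals of R/I, i.e. for the ideals of R containing I. *)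
definition artinian_quotient :: "'a::comm_ring_1 poly3 set \<Rightarrow> bool" where
  "artinian_quotient I \<longleftrightarrow>
     (\<forall>F :: nat \<Rightarrow> 'a poly3 set.
        (\<forall>n. ideal.subspace (F n) \<and> I \<subseteq> F n \<and> F (Suc n) \<subseteq> F n) \<longrightarrow>
        (\<exists>n. \<forall>m\<ge>n. F m = F n))"

definition homogeneous_artinian_ideal :: "'a::comm_ring_1 poly3 set \<Rightarrow> bool" where
  "homogeneous_artinian_ideal I \<longleftrightarrow> homogeneous_ideal I \<and> I \<noteq> UNIV \<and> artinian_quotient I"


section \<open>Generic initial ideals\<close>

definition zariski_open :: "('i \<Rightarrow> 'a::comm_ring_1) set \<Rightarrow> bool" where
  "zariski_open U \<longleftrightarrow>
     (\<exists>S :: (('i \<Rightarrow>\<^sub>0 nat) \<Rightarrow>\<^sub>0 'a) set. U = {x. \<exists>p\<in>S. peval id x p \<noteq> 0})"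

definition zariski_open_GL3 :: "('a::field ^ 3 ^ 3) set \<Rightarrow> bool" where
  "zariski_open_GL3 U \<longleftrightarrow>
     (\<exists>V. zariski_open V \<and> U = {g. invertible g \<and> (\<lambda>(i, j). g $ i $ j) \<in> V})"

definition linear_form :: "(3 \<Rightarrow> 'a::comm_ring_1) \<Rightarrow> 'a poly3" where
  "linear_form c = (\<Sum>i\<in>UNIV. pconst (c i) * xvar i)"

(* The coordinate change g replaces xvar j by the linear form with coefficients the j-th column of g. *)
definition act :: "'a::field ^ 3 ^ 3 \<Rightarrow> 'a poly3 \<Rightarrow> 'a poly3" where
  "act g p = peval pconst (\<lambda>j. linear_form (\<lambda>i. g $ i $ j)) p"

definition revlex_less :: "mon \<Rightarrow> mon \<Rightarrow> bool" where
  "revlex_less S T \<longleftrightarrow> mdeg S < mdeg T \<or> mdeg S = mdeg T \<and>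
     (\<exists>i\<in>{1..3::nat}. Poly_Mapping.lookup T (of_nat i) < Poly_Mapping.lookup S (of_nat i) \<and>
        (\<forall>j\<in>{i<..3}. Poly_Mapping.lookup T (of_nat j) = Poly_Mapping.lookup S (of_nat j)))"

definition initial_monomial :: "'a::zero poly3 \<Rightarrow> mon" where
  "initial_monomial p = (THE T. T \<in> Poly_Mapping.keys p \<and>
     (\<forall>S\<in>Poly_Mapping.keys p. S \<noteq> T \<longrightarrow> revlex_less S T))"

definition initial_ideal :: "'a::comm_ring_1 poly3 set \<Rightarrow> 'a poly3 set" where
  "initial_ideal I = ideal.span {monom (initial_monomial p) | p. p \<in> I \<and> p \<noteq> 0}"

definition gin :: "'a::field poly3 set \<Rightarrow> 'a poly3 set" where
  "gin I = (THE K. \<exists>U. zariski_open_GL3 U \<and> U \<noteq> {} \<and> (\<forall>g\<in>U. initial_ideal (act g ` I) = K))"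

definition minimal_monomial_generators :: "'a::comm_ring_1 poly3 set \<Rightarrow> mon set" where
  "minimal_monomial_generators K =
     (THE G. ideal.span (monom ` G) = K \<and> (\<forall>H. H \<subset> G \<longrightarrow> ideal.span (monom ` H) \<noteq> K))"


section \<open>Weak Lefschetz property and first reduction number\<close>

(* Multiplication by L from (R/I)_d to (R/I)_{d+1}, written on representatives. *)
definition mult_inj :: "'a::comm_ring_1 poly3 set \<Rightarrow> 'a poly3 \<Rightarrow> nat \<Rightarrow> bool" where
  "mult_inj I L d \<longleftrightarrow> (\<forall>p\<in>degree_part UNIV d. L * p \<in> I \<longrightarrow> p \<in> I)"

definition mult_surj :: "'a::comm_ring_1 poly3 set \<Rightarrow> 'a poly3 \<Rightarrow> nat \<Rightarrow> bool" where
  "mult_surj I L d \<longleftrightarrow>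
     (\<forall>q\<in>degree_part UNIV (Suc d). \<exists>p\<in>degree_part UNIV d. q - L * p \<in> I)"

definition weak_Lefschetz :: "'a::comm_ring_1 poly3 set \<Rightarrow> bool" where
  "weak_Lefschetz I \<longleftrightarrow>
     (\<exists>L\<in>degree_part UNIV 1. \<forall>d. mult_inj I L d \<or> mult_surj I L d)"

(* A general linear form has its coefficient vector in a nonempty Zariski open subset of k^3 on
   which the minimum is constant. *)
definition reduction_number1 :: "'a::field poly3 set \<Rightarrow> nat" where
  "reduction_number1 I = (THE r. \<exists>U. zariski_open U \<and> U \<noteq> {} \<and>
     (\<forall>c\<in>U. (LEAST t. degree_part UNIV (Suc t) \<subseteq> ideal.span (insert (linear_form c) I)) = r))"


section \<open>Graded Betti numbers\<close>

(* A complex of graded free R-modules of finite free_rank with an augmentation to k. The module in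
   homological degree q has basis elements e_a for a < free_rank P q, of internal degree gdeg P q a;
   its elements are finitely supported coefficient families. The map from homological degree
   q + 1 to q sends e_b to the sum of bdry P q a b * e_a over a < free_rank P q. The augmentation
   sends e_a to aug P a in k = R/(x_1,x_2,x_3), placed in degree 0. *)
record (overloaded) 'a free_complex =
  free_rank :: "nat \<Rightarrow> nat"
  gdeg :: "nat \<Rightarrow> nat \<Rightarrow> nat"
  bdry :: "nat \<Rightarrow> nat \<Rightarrow> nat \<Rightarrow> 'a poly3"
  aug :: "nat \<Rightarrow> 'a"

definition free_mod :: "'a::comm_ring_1 free_complex \<Rightarrow> nat \<Rightarrow> (nat \<Rightarrow>\<^sub>0 'a poly3) set" where
  "free_mod P q = {f. Poly_Mapping.keys f \<subseteq> {..<free_rank P q}}"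

definition bdry_map ::
  "'a::comm_ring_1 free_complex \<Rightarrow> nat \<Rightarrow> (nat \<Rightarrow>\<^sub>0 'a poly3) \<Rightarrow> (nat \<Rightarrow>\<^sub>0 'a poly3)" where
  "bdry_map P q f = (\<Sum>a<free_rank P q. \<Sum>b<free_rank P (Suc q).
     Poly_Mapping.single a (bdry P q a b * Poly_Mapping.lookup f b))"

definition aug_map :: "'a::comm_ring_1 free_complex \<Rightarrow> (nat \<Rightarrow>\<^sub>0 'a poly3) \<Rightarrow> 'a" where
  "aug_map P f = (\<Sum>a<free_rank P 0. aug P a * Poly_Mapping.lookup (Poly_Mapping.lookup f a) 0)"

(* P is a graded free resolution of k, of finite length. *)
definition resolves_k :: "'a::comm_ring_1 free_complex \<Rightarrow> bool" where
  "resolves_k P \<longleftrightarrow>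
     (\<forall>q. \<forall>a<free_rank P q. \<forall>b<free_rank P (Suc q). \<forall>T\<in>Poly_Mapping.keys (bdry P q a b).
        mdeg T + gdeg P q a = gdeg P (Suc q) b) \<and>
     (\<forall>a<free_rank P 0. aug P a \<noteq> 0 \<longrightarrow> gdeg P 0 a = 0) \<and>
     aug_map P ` free_mod P 0 = UNIV \<and>
     {f \<in> free_mod P 0. aug_map P f = 0} = bdry_map P 0 ` free_mod P 1 \<and>
     (\<forall>q. {f \<in> free_mod P (Suc q). bdry_map P q f = 0}
            = bdry_map P (Suc q) ` free_mod P (Suc (Suc q))) \<and>
     (\<exists>n. \<forall>q\<ge>n. free_rank P q = 0)"

(* The degree i part of the tensor product of K with the q-th module of P, which is the direct sum
   of one copy of K, shifted by gdeg P q a, for each a < free_rank P q. *)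
definition tensor_part ::
  "'a::comm_ring_1 poly3 set \<Rightarrow> 'a free_complex \<Rightarrow> nat \<Rightarrow> nat \<Rightarrow> (nat \<Rightarrow>\<^sub>0 'a poly3) set" where
  "tensor_part K P q i = {f \<in> free_mod P q. \<forall>a<free_rank P q. Poly_Mapping.lookup f a \<in> K \<and>
     (\<forall>T\<in>Poly_Mapping.keys (Poly_Mapping.lookup f a). mdeg T + gdeg P q a = i)}"

definition cycles ::
  "'a::comm_ring_1 poly3 set \<Rightarrow> 'a free_complex \<Rightarrow> nat \<Rightarrow> nat \<Rightarrow> (nat \<Rightarrow>\<^sub>0 'a poly3) set" where
  "cycles K P q i =
     {f \<in> tensor_part K P q i. case q of 0 \<Rightarrow> True | Suc q' \<Rightarrow> bdry_map P q' f = 0}"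

definition boundaries ::
  "'a::comm_ring_1 poly3 set \<Rightarrow> 'a free_complex \<Rightarrow> nat \<Rightarrow> nat \<Rightarrow> (nat \<Rightarrow>\<^sub>0 'a poly3) set" where
  "boundaries K P q i = bdry_map P q ` tensor_part K P (Suc q) i"

definition kscale :: "'a::field \<Rightarrow> (nat \<Rightarrow>\<^sub>0 'a poly3) \<Rightarrow> (nat \<Rightarrow>\<^sub>0 'a poly3)" where
  "kscale c f = Poly_Mapping.map ((*) (pconst c)) f"

interpretation kspace: vector_space "kscale :: 'a::field \<Rightarrow> _"
proof
  fix a b :: 'a and f g :: "nat \<Rightarrow>\<^sub>0 'a poly3"
  have l: "Poly_Mapping.lookup (kscale c h) j = pconst c * Poly_Mapping.lookup h j"
    for c :: 'a and h j
    unfolding kscale_def by (simp add: Poly_Mapping.map.rep_eq when_def)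
  have c: "pconst (a + b) = pconst a + pconst b" "pconst (a * b) = pconst a * pconst b"
    "pconst 1 = (1 :: 'a poly3)"
    unfolding pconst_def by (simp_all only: single_add mult_single single_one add_0_left)
  show "kscale a (f + g) = kscale a f + kscale a g"
    by (rule poly_mapping_eqI) (simp only: l lookup_add distrib_left)
  show "kscale (a + b) f = kscale a f + kscale b f"
    by (rule poly_mapping_eqI) (simp only: l c lookup_add distrib_right)
  show "kscale a (kscale b f) = kscale (a * b) f"
    by (rule poly_mapping_eqI) (simp only: l c mult.assoc)
  show "kscale 1 f = f"
    by (rule poly_mapping_eqI) (simp only: l c mult_1_left)
qed

(* dim_k Tor_q(K,k)_i, with Tor_q(K,k) the homology of the tensor product of K with a free
   resolution of k (by the comparison theorem any two give isomorphic homology). Cycles and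
   boundaries in a fixed degree are finite-dimensional, so the dimension of the quotient is the
   difference. *)
definition graded_betti :: "'a::field poly3 set \<Rightarrow> nat \<Rightarrow> nat \<Rightarrow> nat" where
  "graded_betti K q i = (let P = (SOME P. resolves_k P) in
     kspace.dim (cycles K P q i) - kspace.dim (boundaries K P q i))"

end

theory Submission
  imports Defs "HOL-Computational_Algebra.Polynomial" "HOL-Computational_Algebra.Formal_Power_Series"
begin

text \<open>
  In the reverse lexicographic order the monomials of degree $d$ that are not divisible by $x_3$ are
  the largest ones of their degree, and a form whose initial monomial is divisible by $x_3$ is itself
  divisible by $x_3$. So the initial ideal of $gI$ is governed by two things: the image of $gI$ in
  $k[x_1,x_2] = R/(x_3)$, and multiplication by $x_3$ on $R/gI$, which is multiplication by a general
  linear form $L$ on $R/I$.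

  \<^bold>\<open>The two-variable part.\<close> Let $m_d$ be the dimension of the image of $(gI)_d$ in $k[x_1,x_2]_d$
  for generic $g$. In characteristic 0 the initial monomials of a generic coordinate change of an
  $m$-dimensional space of binary forms are the $m$ largest monomials. Therefore $x_1^{d-j} x_2^j$ lies
  in $\mathrm{gin}(I)$ iff $j < m_d$ (\<open>plane_mon_in_gin_iff\<close>), and the numbers $m_d$ determine the
  generators with $\max \le 2$.

  \<^bold>\<open>The numbers $m_d$.\<close> The kernel of $I_d \to k[x_1,x_2]_d$ is $L (I:L)_{d-1}$, so
  $m_d = \dim I_d - \dim (I:L)_{d-1}$ (\<open>hilb_Suc_eq\<close>). If $L$ acts injectively into degree $d$, this is
  $\dim I_d - \dim I_{d-1}$; if it acts surjectively, it is $d+1$. Under the weak Lefschetz property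
  $m_d$ is the minimum of the two (\<open>plane_rank_Suc\<close>), hence depends on the Hilbert function only. The
  Hilbert function is determined by the Betti numbers through Euler characteristics
  (\<open>graded_betti_determines_hilb\<close>).

  \<^bold>\<open>Degrees up to $r_1(A)$.\<close> In these degrees multiplication by a linear form is never surjective onto
  $A_d$, so by the weak Lefschetz property it is injective for some form. This forces
  $\dim I_d - \dim I_{d-1} \le d+1$, an inequality that passes to $J$. Consequently a general form acts
  injectively for both ideals, a factor $x_3$ can be cancelled in the generic initial ideals
  (\<open>gin_x3_cancel\<close>), and membership reduces to the two-variable part.

  \<^bold>\<open>Genericity.\<close> A monomial is initial for $(gI)_d$ iff the rank of $(gI)_d$ on the coordinates above
  it jumps (\<open>leads_iff_rank\<close>). Such ranks are lower semicontinuous in $g$, by division-free Gaussian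
  elimination (\<open>indep_family_zariski_open\<close>), so each of them takes its maximal value on a nonempty open
  set. Since $I$ contains all forms of high degree, finitely many ranks matter, and $\mathrm{gin}(I)$
  exists (\<open>gin_generic\<close>).
\<close>

abbreviation lookup :: "('k \<Rightarrow>\<^sub>0 'a::zero) \<Rightarrow> 'k \<Rightarrow> 'a" where
  "lookup \<equiv> Poly_Mapping.lookup"

abbreviation keys :: "('k \<Rightarrow>\<^sub>0 'a::zero) \<Rightarrow> 'k set" where
  "keys \<equiv> Poly_Mapping.keys"

abbreviation single :: "'k \<Rightarrow> 'a::zero \<Rightarrow> 'k \<Rightarrow>\<^sub>0 'a" where
  "single \<equiv> Poly_Mapping.single"

section \<open>Linear algebra of finite-dimensional subspaces\<close>

text \<open>The qualifier \<open>vs\<close> keeps the notions of a vector space over a field apart from their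
  homonyms for real vector spaces.\<close>

locale vspace = vs: vector_space scale
  for scale :: "'a::field \<Rightarrow> 'b::ab_group_add \<Rightarrow> 'b"
begin

definition findim :: "'b set \<Rightarrow> bool" where
  "findim V \<longleftrightarrow> (\<exists>B. finite B \<and> V \<subseteq> vs.span B)"

text \<open>The vectors are indexed because they will vary with parameters, and a collision has to count as
  a dependency.\<close>

definition indep_family :: "nat \<Rightarrow> (nat \<Rightarrow> 'b) \<Rightarrow> bool" where
  "indep_family n v \<longleftrightarrow> (\<forall>c. (\<Sum>i<n. scale (c i) (v i)) = 0 \<longrightarrow> (\<forall>i<n. c i = 0))"

lemma findim_subset: "findim W \<Longrightarrow> V \<subseteq> W \<Longrightarrow> findim V"
  unfolding findim_def by blast

lemma findim_basis:
  assumes "findim V"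
  obtains B where "finite B" "B \<subseteq> V" "vs.independent B" "V \<subseteq> vs.span B" "card B = vs.dim V"
proof -
  obtain B where B: "B \<subseteq> V" "vs.independent B" "V \<subseteq> vs.span B" "card B = vs.dim V"
    by (rule vs.basis_exists)
  obtain C where "finite C" "V \<subseteq> vs.span C" using assms unfolding findim_def by blast
  then have "finite B" using vs.independent_span_bound[of C B] B by blast
  then show ?thesis using that B by blast
qed

lemma independent_findim_card_le:
  assumes "findim V" "vs.independent A" "A \<subseteq> V"
  shows "finite A" "card A \<le> vs.dim V"
proof -
  obtain B where B: "finite B" "B \<subseteq> V" "vs.independent B" "V \<subseteq> vs.span B" "card B = vs.dim V"
    using findim_basis[OF assms(1)] by blast
  have "finite A \<and> card A \<le> card B"
    using vs.independent_span_bound[of B A] B assms by blast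
  then show "finite A" "card A \<le> vs.dim V" using B by auto
qed

lemma dim_mono_findim:
  assumes "findim W" "V \<subseteq> W"
  shows "vs.dim V \<le> vs.dim W"
proof -
  obtain B where B: "B \<subseteq> V" "vs.independent B" "V \<subseteq> vs.span B" "card B = vs.dim V"
    by (rule vs.basis_exists)
  then show ?thesis using independent_findim_card_le[OF assms(1), of B] assms by auto
qed

lemma subspace_eq_of_dim_le:
  assumes "findim W" "vs.subspace V" "V \<subseteq> W" "vs.dim W \<le> vs.dim V"
  shows "V = W"
proof -
  obtain B where B: "finite B" "B \<subseteq> V" "vs.independent B" "V \<subseteq> vs.span B" "card B = vs.dim V"
    using findim_basis[OF findim_subset[OF assms(1,3)]] by blast
  have "W \<subseteq> vs.span B"
  proof
    fix w assume w: "w \<in> W"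
    show "w \<in> vs.span B"
    proof (rule ccontr)
      assume n: "w \<notin> vs.span B"
      then have i: "vs.independent (insert w B)" using B(3) by (rule vs.independent_insertI)
      have "w \<notin> B" using n vs.span_base by blast
      then have "card (insert w B) = Suc (vs.dim V)" using B by simp
      moreover have "card (insert w B) \<le> vs.dim W"
        using independent_findim_card_le(2)[OF assms(1) i] B w assms by auto
      ultimately show False using assms by simp
    qed
  qed
  also have "vs.span B \<subseteq> V" using B assms by (simp add: vs.span_minimal)
  finally show ?thesis using assms by auto
qed

lemma dim_eq_0_iff_findim:
  assumes "findim V" "vs.subspace V"
  shows "vs.dim V = 0 \<longleftrightarrow> V = {0}"
proof
  assume d: "vs.dim V = 0"
  have "vs.subspace {0}" by (simp add: vs.subspace_single_0)
  moreover have "{0} \<subseteq> V" using vs.subspace_0[OF assms(2)] by simp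
  ultimately show "V = {0}" using subspace_eq_of_dim_le[OF assms(1), of "{0}"] d by auto
next
  assume "V = {0}"
  then have "V \<subseteq> vs.span {}" by simp
  then have "vs.dim V \<le> card ({} :: 'b set)" by (rule vs.dim_le_card) simp
  then show "vs.dim V = 0" by simp
qed

lemma indep_family_card_le_dim:
  assumes "indep_family n v" "\<And>i. i < n \<Longrightarrow> v i \<in> W" "findim W"
  shows "n \<le> vs.dim W"
proof -
  have inj: "inj_on v {..<n}"
  proof (rule inj_onI, rule ccontr)
    fix i j assume ij: "i \<in> {..<n}" "j \<in> {..<n}" "v i = v j" "i \<noteq> j"
    define c :: "nat \<Rightarrow> 'a" where "c = (\<lambda>k. if k = i then 1 else if k = j then -1 else 0)"
    have "(\<Sum>k<n. scale (c k) (v k)) = (\<Sum>k\<in>{i,j}. scale (c k) (v k))"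
      by (rule sum.mono_neutral_right) (use ij in \<open>auto simp: c_def\<close>)
    also have "\<dots> = 0" using ij by (simp add: c_def)
    finally have "c i = 0" using assms(1) ij unfolding indep_family_def by blast
    then show False by (simp add: c_def)
  qed
  have "vs.independent (v ` {..<n})"
  proof (rule vs.independent_if_scalars_zero)
    fix f x assume s: "(\<Sum>x\<in>v ` {..<n}. scale (f x) x) = 0" and x: "x \<in> v ` {..<n}"
    have "(\<Sum>i<n. scale (f (v i)) (v i)) = 0"
      using s by (simp add: sum.reindex[OF inj])
    then have "\<forall>i<n. f (v i) = 0"
      using assms(1) unfolding indep_family_def by (elim allE[of _ "\<lambda>i. f (v i)"]) simp
    then show "f x = 0" using x by auto
  qed simp
  then have "card (v ` {..<n}) \<le> vs.dim W"
    using independent_findim_card_le(2)[OF assms(3)] assms(2) by blast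
  then show ?thesis by (simp add: card_image[OF inj])
qed

lemma indep_family_exists:
  assumes "findim W" "n \<le> vs.dim W"
  obtains v where "indep_family n v" "\<And>i. i < n \<Longrightarrow> v i \<in> W"
proof -
  obtain B where B: "finite B" "B \<subseteq> W" "vs.independent B" "W \<subseteq> vs.span B" "card B = vs.dim W"
    using findim_basis[OF assms(1)] by blast
  obtain A where A: "A \<subseteq> B" "card A = n" "finite A"
    using assms(2) B obtain_subset_with_card_n by metis
  obtain v where v: "bij_betw v {..<n} A"
    using A by (metis ex_bij_betw_nat_finite atLeast0LessThan)
  have ind: "vs.independent A" using B A vs.independent_mono by blast
  have "indep_family n v" unfolding indep_family_def
  proof (intro allI impI)
    fix c i assume s: "(\<Sum>i<n. scale (c i) (v i)) = 0" and i: "i < n"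
    define d where "d = (\<lambda>x. c (the_inv_into {..<n} v x))"
    have inj: "inj_on v {..<n}" using v by (simp add: bij_betw_def)
    have dv: "d (v i) = c i" if "i < n" for i
      using that inj by (simp add: d_def the_inv_into_f_f)
    have "(\<Sum>x\<in>A. scale (d x) x) = (\<Sum>i<n. scale (d (v i)) (v i))"
      by (rule sum.reindex_bij_betw[OF v, symmetric])
    also have "\<dots> = 0" using s dv by simp
    finally have "(\<Sum>x\<in>A. scale (d x) x) = 0" .
    moreover have "v i \<in> A" using v i by (auto simp: bij_betw_def)
    ultimately have "d (v i) = 0"
      using ind vs.dependent_finite[OF A(3)] by blast
    then show "c i = 0" using dv i by simp
  qed
  moreover have "v i \<in> W" if "i < n" for i
    using bij_betw_apply[OF v, of i] that A(1) B(2) by blast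
  ultimately show ?thesis by (rule that)
qed

end


locale vspace_pair = v1: vspace s1 + v2: vspace s2
  for s1 :: "'a::field \<Rightarrow> 'b::ab_group_add \<Rightarrow> 'b"
  and s2 :: "'a::field \<Rightarrow> 'c::ab_group_add \<Rightarrow> 'c"

text \<open>A basis of the kernel extends to a basis of \<open>V\<close>, and \<open>f\<close> maps the added vectors to a basis of the
  image.\<close>

lemma (in vspace_pair) rank_nullity:
  assumes f: "Vector_Spaces.linear s1 s2 f" and V: "v1.vs.subspace V" and fd: "v1.findim V"
  shows "v1.vs.dim V = v1.vs.dim {x \<in> V. f x = 0} + v2.vs.dim (f ` V)"
proof -
  interpret f: Vector_Spaces.linear s1 s2 f by fact
  let ?N = "{x \<in> V. f x = 0}"
  have fdN: "v1.findim ?N" by (rule v1.findim_subset[OF fd]) auto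
  obtain C where C: "finite C" "C \<subseteq> ?N" "v1.vs.independent C" "?N \<subseteq> v1.vs.span C" "card C = v1.vs.dim ?N"
    using v1.findim_basis[OF fdN] by blast
  obtain D where D: "C \<subseteq> D" "D \<subseteq> V" "v1.vs.independent D" "V \<subseteq> v1.vs.span D"
    using v1.vs.maximal_independent_subset_extend[of C V] C by blast
  have finD: "finite D" using v1.independent_findim_card_le(1)[OF fd D(3,2)] .
  have cD: "card D = v1.vs.dim V" using v1.vs.basis_card_eq_dim[OF D(2,4,3)] .
  define E where "E = D - C"
  have E: "finite E" "E \<subseteq> D" "C \<inter> E = {}" "D = C \<union> E" using finD D E_def by auto
  have key: "\<forall>e\<in>E. u e = 0" if u: "f (\<Sum>e\<in>E. s1 (u e) e) = 0" for u
  proof -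
    have "(\<Sum>e\<in>E. s1 (u e) e) \<in> V"
      using V E D by (intro v1.vs.subspace_sum v1.vs.subspace_scale) auto
    then have "(\<Sum>e\<in>E. s1 (u e) e) \<in> v1.vs.span C" using u C by auto
    then obtain w where w: "(\<Sum>e\<in>E. s1 (u e) e) = (\<Sum>e\<in>C. s1 (w e) e)"
      using v1.vs.span_finite[OF C(1)] by auto
    define z where "z = (\<lambda>e. if e \<in> C then - w e else u e)"
    have "(\<Sum>e\<in>D. s1 (z e) e) = (\<Sum>e\<in>C. s1 (z e) e) + (\<Sum>e\<in>E. s1 (z e) e)"
      using E C by (simp add: sum.union_disjoint)
    also have "(\<Sum>e\<in>C. s1 (z e) e) = - (\<Sum>e\<in>C. s1 (w e) e)"
      by (simp add: z_def sum_negf)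
    also have "(\<Sum>e\<in>E. s1 (z e) e) = (\<Sum>e\<in>E. s1 (u e) e)"
      by (rule sum.cong) (use E in \<open>auto simp: z_def\<close>)
    finally have "(\<Sum>e\<in>D. s1 (z e) e) = 0" using w by simp
    then have "\<forall>e\<in>D. z e = 0" using D(3) v1.vs.dependent_finite[OF finD] by blast
    then show ?thesis using E by (auto simp: z_def split: if_splits)
  qed
  have fsum: "f (\<Sum>e\<in>E. s1 (u e) e) = (\<Sum>e\<in>E. s2 (u e) (f e))" for u
    by (simp add: f.sum f.scale)
  have inj: "inj_on f E"
  proof (rule inj_onI, rule ccontr)
    fix x y assume xy: "x \<in> E" "y \<in> E" "f x = f y" "x \<noteq> y"
    define u :: "'b \<Rightarrow> 'a" where "u = (\<lambda>e. if e = x then 1 else if e = y then -1 else 0)"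
    have "(\<Sum>e\<in>E. s2 (u e) (f e)) = (\<Sum>e\<in>{x,y}. s2 (u e) (f e))"
      by (rule sum.mono_neutral_right) (use xy E in \<open>auto simp: u_def\<close>)
    also have "\<dots> = 0" using xy by (simp add: u_def)
    finally have "u x = 0" using key[of u] fsum[of u] xy by simp
    then show False by (simp add: u_def)
  qed
  have ind: "v2.vs.independent (f ` E)"
  proof (rule v2.vs.independent_if_scalars_zero)
    fix g x assume s: "(\<Sum>x\<in>f ` E. s2 (g x) x) = 0" and x: "x \<in> f ` E"
    have "(\<Sum>e\<in>E. s2 (g (f e)) (f e)) = 0" using s by (simp add: sum.reindex[OF inj])
    then show "g x = 0" using key[of "\<lambda>e. g (f e)"] fsum x by auto
  qed (use E in simp)
  have "f ` V \<subseteq> v2.vs.span (f ` E)"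
  proof
    fix y assume "y \<in> f ` V"
    then obtain x where x: "x \<in> V" "y = f x" by blast
    then have "x \<in> v1.vs.span D" using D by blast
    then have "f x \<in> v2.vs.span (f ` D)" using f.span_image by blast
    also have "v2.vs.span (f ` D) \<subseteq> v2.vs.span (f ` E)"
    proof (rule v2.vs.span_minimal)
      show "f ` D \<subseteq> v2.vs.span (f ` E)"
        using C(2) by (auto simp: E(4) v2.vs.span_base v2.vs.span_zero)
    qed simp
    finally show "y \<in> v2.vs.span (f ` E)" using x by simp
  qed
  then have "card (f ` E) = v2.vs.dim (f ` V)"
    using v2.vs.basis_card_eq_dim ind E D by (metis image_mono order_trans)
  moreover have "card D = card C + card E" using E C by (simp add: card_Un_disjoint)
  ultimately show ?thesis using cD C card_image[OF inj] by simp
qed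

lemma (in vspace_pair) dim_image_injective:
  assumes f: "Vector_Spaces.linear s1 s2 f" and V: "v1.vs.subspace V" and fd: "v1.findim V"
    and inj: "\<And>x. x \<in> V \<Longrightarrow> f x = 0 \<Longrightarrow> x = 0"
  shows "v2.vs.dim (f ` V) = v1.vs.dim V"
proof -
  interpret f: Vector_Spaces.linear s1 s2 f by fact
  have "{x \<in> V. f x = 0} = {0}" using inj v1.vs.subspace_0[OF V] by auto
  moreover have "v1.vs.dim {0} = 0"
    using v1.dim_eq_0_iff_findim[of "{0}"] v1.findim_subset[OF fd, of "{0}"] v1.vs.subspace_0[OF V]
    by (simp add: v1.vs.subspace_single_0)
  ultimately show ?thesis using rank_nullity[OF f V fd] by simp
qed

hide_const (open) Polynomial.monom

section \<open>Evaluation homomorphisms and polynomial functions\<close>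

lemma poly_mapping_sum_singles:
  fixes p :: "'k \<Rightarrow>\<^sub>0 'a::comm_monoid_add"
  shows "(\<Sum>T\<in>keys p. single T (lookup p T)) = p"
proof (rule poly_mapping_eqI)
  fix S
  have "lookup (\<Sum>T\<in>keys p. single T (lookup p T)) S
    = (\<Sum>T\<in>keys p. if T = S then lookup p T else 0)"
    by (simp add: lookup_sum lookup_single when_def)
  also have "\<dots> = lookup p S" by (simp add: in_keys_iff)
  finally show "lookup (\<Sum>T\<in>keys p. single T (lookup p T)) S
    = lookup p S" .
qed

lemma poly_mapping_additive_induct [case_names zero single add]:
  fixes p :: "'k \<Rightarrow>\<^sub>0 'a::comm_monoid_add"
  assumes "P 0" "\<And>T c. P (single T c)" "\<And>p q. P p \<Longrightarrow> P q \<Longrightarrow> P (p + q)"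
  shows "P p"
proof -
  have "P (\<Sum>T\<in>K. single T (lookup p T))" if "finite K" for K
    using that by (induction K) (use assms in auto)
  from this[of "keys p"] show ?thesis by (simp add: poly_mapping_sum_singles)
qed

lemma lookup_single_times_add:
  fixes p :: "('i \<Rightarrow>\<^sub>0 nat) \<Rightarrow>\<^sub>0 'a::comm_ring_1"
  shows "lookup (single S c * p) (S + T) = c * lookup p T"
proof (induction p rule: poly_mapping_additive_induct)
  case (single U d)
  then show ?case by (simp add: mult_single lookup_single when_def)
qed (simp_all add: distrib_left lookup_add)

lemma lookup_single_times_eq_0:
  fixes p :: "('i \<Rightarrow>\<^sub>0 nat) \<Rightarrow>\<^sub>0 'a::comm_ring_1"
  assumes "\<And>T. U \<noteq> S + T"
  shows "lookup (single S c * p) U = 0"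
proof (induction p rule: poly_mapping_additive_induct)
  case (single U d)
  then show ?case using assms by (auto simp add: mult_single lookup_single when_def)
qed (simp_all add: distrib_left lookup_add)

definition monom_eval :: "('i \<Rightarrow> 'b::comm_ring_1) \<Rightarrow> ('i \<Rightarrow>\<^sub>0 nat) \<Rightarrow> 'b" where
  "monom_eval x T = (\<Prod>i\<in>keys T. x i ^ lookup T i)"

lemma monom_eval_superset:
  assumes "finite K" "keys T \<subseteq> K"
  shows "monom_eval x T = (\<Prod>i\<in>K. x i ^ lookup T i)"
  unfolding monom_eval_def
  by (rule prod.mono_neutral_left) (use assms in \<open>auto simp: in_keys_iff\<close>)

lemma monom_eval_add: "monom_eval x (S + T) = monom_eval x S * monom_eval x T"
proof -
  let ?K = "keys S \<union> keys T"
  have "keys (S + T) \<subseteq> ?K" by (rule keys_add)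
  then show ?thesis
    using monom_eval_superset[of ?K S x] monom_eval_superset[of ?K T x] monom_eval_superset[of ?K "S + T" x]
    by (simp add: lookup_add power_add prod.distrib)
qed

lemma monom_eval_0 [simp]: "monom_eval x 0 = 1"
  by (simp add: monom_eval_def)

lemma monom_eval_single [simp]: "monom_eval x (single i n) = x i ^ n"
  by (simp add: monom_eval_def)

locale ring_hom_map =
  fixes h :: "'a::comm_ring_1 \<Rightarrow> 'b::comm_ring_1"
  assumes hom_add: "h (a + b) = h a + h b"
    and hom_mult: "h (a * b) = h a * h b"
begin

lemma hom_0: "h 0 = 0"
  using hom_add[of 0 0] by simp

lemma peval_superset:
  assumes "finite K" "keys p \<subseteq> K"
  shows "peval h x p = (\<Sum>T\<in>K. h (lookup p T) * monom_eval x T)"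
  unfolding peval_def monom_eval_def
  by (rule sum.mono_neutral_left) (use assms in \<open>auto simp: in_keys_iff hom_0\<close>)

lemma peval_add: "peval h x (p + q) = peval h x p + peval h x q"
proof -
  let ?K = "keys p \<union> keys q"
  have "keys (p + q) \<subseteq> ?K" by (rule keys_add)
  then show ?thesis
    using peval_superset[of ?K p x] peval_superset[of ?K q x] peval_superset[of ?K "p + q" x]
    by (simp add: lookup_add hom_add distrib_right sum.distrib)
qed

lemma peval_0 [simp]: "peval h x 0 = 0"
  by (simp add: peval_def)

lemma peval_single: "peval h x (single T c) = h c * monom_eval x T"
  using peval_superset[of "{T}" "single T c" x] by simp

lemma peval_mult: "peval h x (p * q) = peval h x p * peval h x q"
proof (induction p rule: poly_mapping_additive_induct)
  case (single S c)
  show ?case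
  proof (induction q rule: poly_mapping_additive_induct)
    case (single T d)
    show ?case by (simp add: mult_single peval_single monom_eval_add hom_mult mult_ac)
  qed (simp_all add: distrib_left peval_add)
qed (simp_all add: distrib_right peval_add)

end

global_interpretation id_hom: ring_hom_map "id :: 'a::comm_ring_1 \<Rightarrow> 'a"
  by standard simp_all

lemma peval_id_single: "peval id x (single T c) = c * monom_eval x T"
  using id_hom.peval_single[of x T c] by (simp only: id_apply)

lemma pconst_add: "pconst (a + b) = pconst a + pconst (b :: 'a::comm_ring_1)"
  by (simp add: pconst_def single_add)

lemma pconst_mult: "pconst (a * b) = pconst a * pconst (b :: 'a::comm_ring_1)"
  by (simp add: pconst_def mult_single)

lemma pconst_1 [simp]: "pconst (1 :: 'a::comm_ring_1) = 1"
  by (simp add: pconst_def)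

lemma pconst_0 [simp]: "pconst (0 :: 'a::zero) = 0"
  by (simp add: pconst_def)

global_interpretation pconst_hom: ring_hom_map "pconst :: 'a::comm_ring_1 \<Rightarrow> 'a poly3"
  by standard (simp_all add: pconst_add pconst_mult)

text \<open>Polynomial functions are described by their closure properties, which is how they arise below;
  \<open>polyfun_peval\<close> and \<open>polyfun_is_peval\<close> identify them with evaluations of polynomials.\<close>

inductive polyfun :: "(('i \<Rightarrow> 'a::comm_ring_1) \<Rightarrow> 'a) \<Rightarrow> bool" where
  polyfun_const: "polyfun (\<lambda>x. c)"
| polyfun_coord: "polyfun (\<lambda>x. x i)"
| polyfun_add: "polyfun F \<Longrightarrow> polyfun G \<Longrightarrow> polyfun (\<lambda>x. F x + G x)"
| polyfun_mult: "polyfun F \<Longrightarrow> polyfun G \<Longrightarrow> polyfun (\<lambda>x. F x * G x)"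

lemma polyfun_diff: "polyfun F \<Longrightarrow> polyfun G \<Longrightarrow> polyfun (\<lambda>x. F x - G x)"
  using polyfun_add[of F "\<lambda>x. (-1) * G x"] polyfun_mult[OF polyfun_const[of "-1"], of G] by simp

lemma polyfun_sum: "(\<And>k. k \<in> K \<Longrightarrow> polyfun (F k)) \<Longrightarrow> polyfun (\<lambda>x. \<Sum>k\<in>K. F k x)"
  by (induction K rule: infinite_finite_induct) (auto intro: polyfun.intros)

lemma polyfun_prod: "(\<And>k. k \<in> K \<Longrightarrow> polyfun (F k)) \<Longrightarrow> polyfun (\<lambda>x. \<Prod>k\<in>K. F k x)"
  by (induction K rule: infinite_finite_induct) (auto intro: polyfun.intros)

lemma polyfun_power: "polyfun F \<Longrightarrow> polyfun (\<lambda>x. F x ^ n)"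
  by (induction n) (auto intro: polyfun.intros)

lemma polyfun_peval: "polyfun (\<lambda>x. peval id x p)"
  unfolding peval_def
  by (intro polyfun_sum polyfun_mult polyfun_prod polyfun_power polyfun_const polyfun_coord)

lemma polyfun_is_peval:
  assumes "polyfun F"
  shows "\<exists>p. \<forall>x. F x = peval id x p"
  using assms
proof induction
  case (polyfun_const c)
  show ?case by (rule exI[of _ "single 0 c"]) (simp only: peval_id_single monom_eval_0 mult_1_right simp_thms)
next
  case (polyfun_coord i)
  show ?case
    by (rule exI[of _ "single (single i 1) 1"]) (simp only: peval_id_single monom_eval_single mult_1_left power_one_right simp_thms)
next
  case (polyfun_add F G)
  then show ?case by (metis id_hom.peval_add)
next
  case (polyfun_mult F G)
  then show ?case by (metis id_hom.peval_mult)
qed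

lemma zariski_open_polyfun:
  assumes "polyfun F"
  shows "zariski_open {x. F x \<noteq> 0}"
proof -
  obtain p where "\<forall>x. F x = peval id x p" using polyfun_is_peval[OF assms] by blast
  then show ?thesis unfolding zariski_open_def by (intro exI[of _ "{p}"]) auto
qed

lemma zariski_open_basic:
  assumes "zariski_open U" "x \<in> U"
  obtains F where "polyfun F" "F x \<noteq> 0" "{y. F y \<noteq> 0} \<subseteq> U"
proof -
  obtain S where S: "U = {x. \<exists>p\<in>S. peval id x p \<noteq> 0}" using assms unfolding zariski_open_def by blast
  then obtain p where "p \<in> S" "peval id x p \<noteq> 0" using assms by blast
  then show ?thesis using S polyfun_peval by (intro that[of "\<lambda>x. peval id x p"]) auto
qed

lemma polyfun_on_line:
  assumes "polyfun F"
  shows "\<exists>q. \<forall>t. F (\<lambda>i. a i + t * b i) = poly q t"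
  using assms
proof induction
  case (polyfun_const c)
  show ?case by (rule exI[of _ "[:c:]"]) simp
next
  case (polyfun_coord i)
  show ?case by (rule exI[of _ "[:a i, b i:]"]) simp
next
  case (polyfun_add F G)
  then show ?case by (metis poly_add)
next
  case (polyfun_mult F G)
  then show ?case by (metis poly_mult)
qed

text \<open>Affine space over an infinite field is irreducible: on the line through a point where \<open>F\<close> does not
  vanish and one where \<open>G\<close> does not, both restrict to nonzero univariate polynomials, which have
  finitely many roots.\<close>

lemma polyfun_common_nonzero:
  fixes F G :: "('i \<Rightarrow> 'a::field_char_0) \<Rightarrow> 'a"
  assumes "polyfun F" "polyfun G" "F a \<noteq> 0" "G b \<noteq> 0"
  obtains x where "F x \<noteq> 0" "G x \<noteq> 0"
proof -
  obtain p where p: "\<And>t. F (\<lambda>i. a i + t * (b i - a i)) = poly p t"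
    using polyfun_on_line[OF assms(1), of a "\<lambda>i. b i - a i"] by blast
  obtain q where q: "\<And>t. G (\<lambda>i. a i + t * (b i - a i)) = poly q t"
    using polyfun_on_line[OF assms(2), of a "\<lambda>i. b i - a i"] by blast
  have "p \<noteq> 0" using p[of 0] assms by auto
  moreover have "q \<noteq> 0" using q[of 1] assms by auto
  ultimately have "finite {t. poly (p * q) t = 0}" by (intro poly_roots_finite) simp
  then obtain t where "poly (p * q) t \<noteq> 0"
    using infinite_UNIV_char_0[where 'a='a] by (metis (mono_tags, lifting) UNIV_eq_I mem_Collect_eq)
  then show ?thesis using that p q by (metis mult_eq_0_iff poly_mult)
qed

lemma polyfun_prod_nonzero:
  fixes F :: "'k \<Rightarrow> ('i \<Rightarrow> 'a::field_char_0) \<Rightarrow> 'a"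
  assumes "finite K" "\<And>k. k \<in> K \<Longrightarrow> polyfun (F k)" "\<And>k. k \<in> K \<Longrightarrow> \<exists>x. F k x \<noteq> 0"
  obtains x where "(\<Prod>k\<in>K. F k x) \<noteq> 0"
proof -
  have "\<exists>x. (\<Prod>k\<in>K. F k x) \<noteq> 0"
    using assms
  proof (induction K)
    case (insert k K)
    then obtain a b where "F k a \<noteq> 0" "(\<Prod>k\<in>K. F k b) \<noteq> 0" by blast
    then obtain x where "F k x \<noteq> 0" "(\<Prod>k\<in>K. F k x) \<noteq> 0"
      using polyfun_common_nonzero[of "F k" "\<lambda>x. \<Prod>k\<in>K. F k x"] insert
      by (metis insert_iff polyfun_prod)
    then show ?case using insert by auto
  qed auto
  then show ?thesis using that by blast
qed

lemma zariski_open_Int_nonempty: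
  fixes U V :: "('i \<Rightarrow> 'a::field_char_0) set"
  assumes "zariski_open U" "zariski_open V" "U \<noteq> {}" "V \<noteq> {}"
  shows "U \<inter> V \<noteq> {}"
proof -
  obtain a b where "a \<in> U" "b \<in> V" using assms by blast
  then obtain F G where "polyfun F" "F a \<noteq> 0" "{y. F y \<noteq> 0} \<subseteq> U" "polyfun G" "G b \<noteq> 0" "{y. G y \<noteq> 0} \<subseteq> V"
    using zariski_open_basic assms by metis
  moreover from this obtain x where "F x \<noteq> 0" "G x \<noteq> 0" using polyfun_common_nonzero by blast
  ultimately show ?thesis by blast
qed

section \<open>The coordinate space of matrices\<close>

definition mat_of :: "(3 \<times> 3 \<Rightarrow> 'a) \<Rightarrow> 'a ^ 3 ^ 3" where
  "mat_of x = (\<chi> i j. x (i, j))"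

definition entries_of :: "'a ^ 3 ^ 3 \<Rightarrow> 3 \<times> 3 \<Rightarrow> 'a" where
  "entries_of g = (\<lambda>(i, j). g $ i $ j)"

lemma mat_of_entries [simp]: "mat_of (entries_of g) = g"
  by (simp add: mat_of_def entries_of_def vec_eq_iff)

lemma entries_of_mat [simp]: "entries_of (mat_of x) = x"
  by (auto simp: mat_of_def entries_of_def)

lemma polyfun_det: "polyfun (\<lambda>x. det (mat_of x :: 'a::comm_ring_1 ^ 3 ^ 3))"
  unfolding det_3 mat_of_def
  by (simp, intro polyfun_add polyfun_diff polyfun_mult polyfun_coord)

lemma polyfun_invertible:
  fixes F :: "(3 \<times> 3 \<Rightarrow> 'a::field_char_0) \<Rightarrow> 'a"
  assumes "polyfun F" "F x \<noteq> 0"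
  obtains g :: "'a ^ 3 ^ 3" where "invertible g" "F (entries_of g) \<noteq> 0"
proof -
  have "det (mat_of (entries_of (mat 1 :: 'a ^ 3 ^ 3))) \<noteq> 0" by simp
  then obtain y where "F y \<noteq> 0" "det (mat_of y) \<noteq> 0"
    using polyfun_common_nonzero[OF assms(1) polyfun_det assms(2)] by blast
  then show ?thesis using that[of "mat_of y"] by (simp add: invertible_det_nz)
qed

lemma zariski_open_GL3_polyfun:
  assumes "polyfun F"
  shows "zariski_open_GL3 {g. invertible g \<and> F (entries_of g) \<noteq> 0}"
  unfolding zariski_open_GL3_def entries_of_def
  using zariski_open_polyfun[OF assms] by (intro exI[of _ "{x. F x \<noteq> 0}"]) simp

lemma zariski_open_GL3_basic:
  assumes "zariski_open_GL3 U" "g \<in> U"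
  obtains F where "polyfun F" "F (entries_of g) \<noteq> 0" "\<And>h. invertible h \<Longrightarrow> F (entries_of h) \<noteq> 0 \<Longrightarrow> h \<in> U"
proof -
  obtain V where V: "zariski_open V" "U = {g. invertible g \<and> entries_of g \<in> V}"
    using assms unfolding zariski_open_GL3_def entries_of_def by blast
  then obtain F where "polyfun F" "F (entries_of g) \<noteq> 0" "{y. F y \<noteq> 0} \<subseteq> V"
    using zariski_open_basic[of V "entries_of g"] assms by blast
  then show ?thesis using that V by blast
qed

section \<open>Monomials in three variables\<close>

lemma mdeg_alt: "mdeg T = lookup T 1 + lookup T 2 + lookup T 3"
  by (simp add: mdeg_def sum_3)

lemma mdeg_add: "mdeg (S + T) = mdeg S + mdeg T"
  by (simp add: mdeg_alt lookup_add)

lemma mdeg_0 [simp]: "mdeg 0 = 0"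
  by (simp add: mdeg_alt)

lemma mdeg_single [simp]: "mdeg (single i n) = n"
  using exhaust_3[of i] by (auto simp add: mdeg_alt lookup_single when_def)

lemma mon_eqI:
  fixes S T :: mon
  assumes "lookup S 1 = lookup T 1" "lookup S 2 = lookup T 2"
    "lookup S 3 = lookup T 3"
  shows "S = T"
proof (rule poly_mapping_eqI)
  fix i :: 3
  show "lookup S i = lookup T i" using exhaust_3[of i] assms by auto
qed

lemma finite_mons_of_degree [simp]: "finite {T. mdeg T = d}"
proof (rule finite_imageD)
  let ?f = "\<lambda>T::mon. (lookup T 1, lookup T 2, lookup T 3)"
  show "finite (?f ` {T. mdeg T = d})"
    by (rule finite_subset[of _ "{..d} \<times> {..d} \<times> {..d}"]) (auto simp: mdeg_alt)
  show "inj_on ?f {T. mdeg T = d}" by (auto intro!: inj_onI mon_eqI)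
qed

text \<open>Monomials of equal degree that agree in the exponents of $x_2$ and $x_3$ are equal, so two
  comparisons decide.\<close>

lemma revlex_less_iff:
  "revlex_less S T \<longleftrightarrow> mdeg S < mdeg T \<or> mdeg S = mdeg T \<and>
     (lookup T 3 < lookup S 3 \<or>
      lookup T 3 = lookup S 3 \<and> lookup T 2 < lookup S 2)"
proof -
  have i: "{1..3::nat} = {1,2,3}" "{Suc 0<..3::nat} = {2,3}" "{2<..3::nat} = {3}" "{3<..3::nat} = {}" by auto
  show ?thesis unfolding revlex_less_def i by (auto simp: i mdeg_alt)
qed

lemma revlex_less_trans: "revlex_less S T \<Longrightarrow> revlex_less T U \<Longrightarrow> revlex_less S U"
  by (auto simp: revlex_less_iff)

lemma revlex_less_irrefl [simp]: "\<not> revlex_less T T"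
  by (auto simp: revlex_less_iff)

lemma revlex_less_total: "S \<noteq> T \<Longrightarrow> revlex_less S T \<or> revlex_less T S"
proof -
  assume "S \<noteq> T"
  then have "\<not> (lookup S 1 = lookup T 1 \<and> lookup S 2 = lookup T 2 \<and>
    lookup S 3 = lookup T 3)" using mon_eqI by blast
  then show ?thesis by (auto simp: revlex_less_iff mdeg_alt)
qed

lemma revlex_less_add: "revlex_less (U + S) (U + T) \<longleftrightarrow> revlex_less S T"
  by (auto simp: revlex_less_iff mdeg_add lookup_add)

lemma revlex_max_exists:
  assumes "finite K" "K \<noteq> {}"
  shows "\<exists>T\<in>K. \<forall>S\<in>K. S \<noteq> T \<longrightarrow> revlex_less S T"
  using assms
proof (induction K rule: finite_ne_induct)
  case (insert T K)
  then obtain U where U: "U \<in> K" "\<forall>S\<in>K. S \<noteq> U \<longrightarrow> revlex_less S U" by blast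
  show ?case
  proof (cases "revlex_less T U")
    case True
    then show ?thesis using U by (intro bexI[of _ U]) auto
  next
    case False
    then have "revlex_less U T" using revlex_less_total[of T U] insert U by auto
    then have "revlex_less S T" if "S \<in> K" for S
      using U revlex_less_trans[of S U T] that by (cases "S = U") auto
    then show ?thesis by (intro bexI[of _ T]) auto
  qed
qed simp

section \<open>Homogeneous polynomials\<close>

definition restr :: "mon set \<Rightarrow> 'a::zero poly3 \<Rightarrow> 'a poly3" where
  "restr B p = Poly_Mapping.mapp (\<lambda>T c. if T \<in> B then c else 0) p"

lemma lookup_restr: "lookup (restr B p) T = (if T \<in> B then lookup p T else 0)"
  by (simp add: restr_def lookup_mapp when_def in_keys_iff)

lemma restr_add: "restr B (p + q) = restr B p + restr B (q :: 'a::comm_ring_1 poly3)"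
  by (rule poly_mapping_eqI) (simp add: lookup_restr lookup_add)

lemma restr_0 [simp]: "restr B 0 = 0"
  by (rule poly_mapping_eqI) (simp add: lookup_restr)

lemma restr_restr: "restr B (restr C p) = restr (B \<inter> C) p"
  by (rule poly_mapping_eqI) (simp add: lookup_restr)

definition pscale :: "'a::comm_ring_1 \<Rightarrow> 'a poly3 \<Rightarrow> 'a poly3" where
  "pscale c p = pconst c * p"

lemma lookup_pscale [simp]: "lookup (pscale c p) T = c * lookup p T"
  using lookup_single_times_add[of 0 c p T] by (simp add: pscale_def pconst_def)

interpretation pv: vspace "pscale :: 'a::field \<Rightarrow> 'a poly3 \<Rightarrow> 'a poly3"
  by standard (rule poly_mapping_eqI; simp add: lookup_add distrib_left distrib_right mult.assoc)+

interpretation pvp: vspace_pair "pscale :: 'a::field \<Rightarrow> 'a poly3 \<Rightarrow> 'a poly3" "pscale :: 'a::field \<Rightarrow> 'a poly3 \<Rightarrow> 'a poly3" ..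

lemma pscale_mult_left: "pscale c (p * q) = p * pscale c q"
  by (simp add: pscale_def mult_ac)

lemma linear_pscaleI:
  fixes f :: "'a::field poly3 \<Rightarrow> 'a poly3"
  assumes "\<And>p q. f (p + q) = f p + f q" "\<And>c p. f (pscale c p) = pscale c (f p)"
  shows "Vector_Spaces.linear pscale pscale f"
  using assms by unfold_locales

lemma linear_restr: "Vector_Spaces.linear pscale pscale (restr B :: 'a::field poly3 \<Rightarrow> _)"
  by (rule linear_pscaleI) (simp add: restr_add, rule poly_mapping_eqI, simp add: lookup_restr)

lemma linear_times: "Vector_Spaces.linear pscale pscale ((*) (L :: 'a::field poly3))"
  by (rule linear_pscaleI) (simp_all add: distrib_left pscale_mult_left)

lemma homogeneous_iff: "homogeneous d p \<longleftrightarrow> (\<forall>T. lookup p T \<noteq> 0 \<longrightarrow> mdeg T = d)"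
  by (auto simp: homogeneous_def in_keys_iff)

lemma homogeneous_0 [simp]: "homogeneous d 0"
  by (simp add: homogeneous_iff)

lemma homogeneous_add: "homogeneous d p \<Longrightarrow> homogeneous d q \<Longrightarrow> homogeneous d (p + q :: 'a::comm_ring_1 poly3)"
  by (auto simp: homogeneous_iff lookup_add) (metis add.right_neutral)

lemma homogeneous_single: "mdeg T = d \<Longrightarrow> homogeneous d (single T c)"
  by (auto simp: homogeneous_iff lookup_single when_def)

lemma homogeneous_sum: "(\<And>k. k \<in> K \<Longrightarrow> homogeneous d (f k)) \<Longrightarrow> homogeneous d (sum f K :: 'a::comm_ring_1 poly3)"
  by (induction K rule: infinite_finite_induct) (auto intro: homogeneous_add)

lemma homogeneous_mult:
  assumes "homogeneous d p" "homogeneous e (q :: 'a::comm_ring_1 poly3)"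
  shows "homogeneous (d + e) (p * q)"
  using assms keys_mult[of p q] by (fastforce simp: homogeneous_def mdeg_add)

lemma homogeneous_pconst: "homogeneous 0 (pconst c)"
  by (simp add: pconst_def homogeneous_single)

lemma homogeneous_1: "homogeneous 0 (1 :: 'a::comm_ring_1 poly3)"
  using homogeneous_pconst[of "1::'a"] by simp

lemma homogeneous_power: "homogeneous d (p :: 'a::comm_ring_1 poly3) \<Longrightarrow> homogeneous (n * d) (p ^ n)"
  by (induction n) (auto simp: homogeneous_1 intro: homogeneous_mult)

definition hcomp :: "nat \<Rightarrow> 'a::zero poly3 \<Rightarrow> 'a poly3" where
  "hcomp d = restr {T. mdeg T = d}"

lemma lookup_hcomp: "lookup (hcomp d p) T = (if mdeg T = d then lookup p T else 0)"
  by (simp add: hcomp_def lookup_restr)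

lemma hcomp_add: "hcomp d (p + q) = hcomp d p + hcomp d (q :: 'a::comm_ring_1 poly3)"
  by (simp add: hcomp_def restr_add)

lemma hcomp_0 [simp]: "hcomp d 0 = 0"
  by (simp add: hcomp_def)

lemma hcomp_sum: "hcomp d (sum f K) = (\<Sum>k\<in>K. hcomp d (f k :: 'a::comm_ring_1 poly3))"
  by (induction K rule: infinite_finite_induct) (auto simp: hcomp_add)

lemma homogeneous_hcomp [simp]: "homogeneous d (hcomp d p)"
  by (auto simp: homogeneous_iff lookup_hcomp)

lemma hcomp_homogeneous: "homogeneous e p \<Longrightarrow> hcomp d p = (if d = e then p else 0)"
  by (rule poly_mapping_eqI) (auto simp: lookup_hcomp homogeneous_iff)

lemma hcomp_single_mult:
  fixes p :: "'a::comm_ring_1 poly3"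
  shows "hcomp d (single S c * p) =
    (if mdeg S \<le> d then single S c * hcomp (d - mdeg S) p else 0)"
proof (induction p rule: poly_mapping_additive_induct)
  case (single T e)
  have "hcomp d (single U b) = (if mdeg U = d then single U b else 0)" for U d and b :: 'a
    using hcomp_homogeneous[of "mdeg U" "single U b" d] by (auto simp: homogeneous_single)
  then show ?case by (auto simp: mult_single mdeg_add)
qed (auto simp: distrib_left hcomp_add)

lemma hcomp_homogeneous_mult:
  fixes p q :: "'a::comm_ring_1 poly3"
  assumes "homogeneous e p" "e \<le> d"
  shows "hcomp d (p * q) = p * hcomp (d - e) q"
proof -
  have "hcomp d (p * q) = (\<Sum>T\<in>keys p. hcomp d (single T (lookup p T) * q))"
    by (subst poly_mapping_sum_singles[of p, symmetric]) (simp only: sum_distrib_right hcomp_sum)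
  also have "\<dots> = (\<Sum>T\<in>keys p. single T (lookup p T) * hcomp (d - e) q)"
    by (rule sum.cong) (use assms in \<open>auto simp: hcomp_single_mult homogeneous_def\<close>)
  also have "\<dots> = p * hcomp (d - e) q"
    by (simp only: sum_distrib_right[symmetric] poly_mapping_sum_singles)
  finally show ?thesis .
qed

lemma sum_hcomp:
  fixes p :: "'a::comm_ring_1 poly3"
  obtains n where "p = (\<Sum>d<n. hcomp d p)"
proof -
  define n where "n = Suc (Max (insert 0 (mdeg ` keys p)))"
  have n: "mdeg T < n" if "T \<in> keys p" for T
    unfolding n_def using that by (simp add: less_Suc_eq_le)
  have "p = (\<Sum>d<n. hcomp d p)"
  proof (rule poly_mapping_eqI)
    fix T
    show "lookup p T = lookup (\<Sum>d<n. hcomp d p) T"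
      using n[of T] by (auto simp: lookup_sum lookup_hcomp in_keys_iff)
  qed
  then show ?thesis using that by blast
qed

text \<open>For a homogeneous generator \<open>x\<close> the components of \<open>r * x\<close> are multiples of \<open>x\<close> by components of
  \<open>r\<close>; both sides are additive in \<open>r\<close>.\<close>

lemma hcomp_mem_homogeneous_ideal:
  fixes I :: "'a::comm_ring_1 poly3 set"
  assumes "homogeneous_ideal I" "p \<in> I"
  shows "hcomp d p \<in> I"
proof -
  obtain S where S: "\<forall>p\<in>S. \<exists>d. homogeneous d p" "I = ideal.span S"
    using assms unfolding homogeneous_ideal_def by blast
  have "p \<in> ideal.span S" using assms S by simp
  then have "\<forall>d. hcomp d p \<in> I"
  proof (induction rule: ideal.span_induct_alt)
    case base
    then show ?case using S by (simp add: ideal.span_zero)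
  next
    case (step r x y)
    have "hcomp d (r * x) \<in> I" for d
    proof (induction r rule: poly_mapping_additive_induct)
      case (single T c)
      obtain e where "homogeneous e x" using S step by blast
      then show ?case using S step
        by (auto simp: hcomp_single_mult hcomp_homogeneous intro: ideal.span_zero ideal.span_scale ideal.span_base)
    qed (use S in \<open>auto simp: distrib_right hcomp_add intro: ideal.span_add ideal.span_zero\<close>)
    then show ?case using step S by (auto simp: hcomp_add intro: ideal.span_add)
  qed
  then show ?thesis by blast
qed

lemma homogeneous_ideal_subspace: "homogeneous_ideal I \<Longrightarrow> ideal.subspace I"
  by (auto simp: homogeneous_ideal_def)

lemma subspace_degree_part:
  assumes "ideal.subspace (I :: 'a::field poly3 set)"
  shows "pv.vs.subspace (degree_part I d)"
proof (rule pv.vs.subspaceI)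
  show "0 \<in> degree_part I d" using ideal.subspace_0[OF assms] by (simp add: degree_part_def)
  show "x + y \<in> degree_part I d" if "x \<in> degree_part I d" "y \<in> degree_part I d" for x y
    using that ideal.subspace_add[OF assms] homogeneous_add by (auto simp: degree_part_def)
  show "pscale c x \<in> degree_part I d" if "x \<in> degree_part I d" for c x
    using that ideal.subspace_scale[OF assms, of x "pconst c"] homogeneous_mult[OF homogeneous_pconst[of c], of d x]
    by (auto simp: degree_part_def pscale_def)
qed

lemma span_of_support:
  assumes "finite B" "\<And>T. lookup p T \<noteq> 0 \<Longrightarrow> T \<in> B"
  shows "p \<in> pv.vs.span (monom ` B)"
proof -
  have "p = (\<Sum>T\<in>keys p. pscale (lookup p T) (monom T))"
    by (subst poly_mapping_sum_singles[of p, symmetric], rule sum.cong)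
       (simp_all add: pscale_def pconst_def Defs.monom_def mult_single)
  moreover have "\<dots> \<in> pv.vs.span (monom ` B)"
    using assms by (intro pv.vs.span_sum pv.vs.span_scale pv.vs.span_base) (auto simp: in_keys_iff)
  ultimately show ?thesis by simp
qed

lemma findim_supported:
  assumes "finite B" "\<And>p T. p \<in> V \<Longrightarrow> lookup p T \<noteq> 0 \<Longrightarrow> T \<in> B"
  shows "pv.findim V" "pv.vs.dim V \<le> card B"
proof -
  have s: "V \<subseteq> pv.vs.span ((monom :: mon \<Rightarrow> 'a poly3) ` B)" using span_of_support[OF assms(1)] assms(2) by blast
  then show "pv.findim V" unfolding pv.findim_def using assms(1) by blast
  have "pv.vs.dim V \<le> card ((monom :: mon \<Rightarrow> 'a poly3) ` B)" using pv.vs.dim_le_card[OF s] assms(1) by simp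
  also have "\<dots> \<le> card B" using assms(1) by (rule card_image_le)
  finally show "pv.vs.dim V \<le> card B" .
qed

lemma findim_degree_part: "pv.findim (degree_part K d :: 'a::field poly3 set)"
  by (rule findim_supported(1)[of "{T. mdeg T = d}"]) (auto simp: degree_part_def homogeneous_iff)

section \<open>Linear changes of coordinates\<close>

lemma xvar_power: "xvar i ^ n = monom (single i n)"
proof (induction n)
  case (Suc n)
  have "single i (Suc n) = single i 1 + single i n"
    using single_add[of i 1 n] by simp
  then show ?case using Suc by (simp add: xvar_def Defs.monom_def mult_single)
qed (simp add: Defs.monom_def)

lemma monom_add: "monom (S + T) = monom S * monom T"
  by (simp add: Defs.monom_def mult_single)

lemma monom_eval_3: "monom_eval x (T :: mon) = x 1 ^ lookup T 1 * x 2 ^ lookup T 2 * x 3 ^ lookup T 3"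
proof -
  have "monom_eval x T = (\<Prod>i\<in>UNIV. x i ^ lookup T i)"
    by (rule monom_eval_superset) auto
  also have "\<dots> = (\<Prod>i\<in>{1, 2, 3}. x i ^ lookup T i)" by (simp only: UNIV_3)
  finally show ?thesis by (simp add: mult.assoc)
qed

lemma mon_decomp: "(T :: mon) = single 1 (lookup T 1) + single 2 (lookup T 2) +
   single (3::3) (lookup T 3)"
  by (rule mon_eqI) (simp_all add: lookup_add lookup_single when_def)

lemma monom_eval_xvar: "monom_eval xvar T = monom T"
  by (subst (2) mon_decomp) (simp add: monom_eval_3 xvar_power monom_add)

lemma act_add: "act g (p + q) = act g p + act g q"
  by (simp add: act_def pconst_hom.peval_add)

lemma act_mult: "act g (p * q) = act g p * act g q"
  by (simp add: act_def pconst_hom.peval_mult)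

lemma act_0 [simp]: "act g 0 = 0"
  by (simp add: act_def)

lemma act_single: "act g (single T c) = pconst c * monom_eval (\<lambda>j. linear_form (\<lambda>i. g $ i $ j)) T"
  by (simp add: act_def pconst_hom.peval_single)

lemma act_pconst [simp]: "act g (pconst c) = pconst c"
  unfolding pconst_def by (subst act_single) (simp add: pconst_def)

lemma act_1 [simp]: "act g 1 = 1"
  using act_pconst[of g 1] by simp

lemma act_pscale: "act g (pscale c p) = pscale c (act g p)"
  by (simp add: pscale_def act_mult)

lemma linear_act: "Vector_Spaces.linear pscale pscale (act g)"
  by (rule linear_pscaleI) (simp_all add: act_add act_pscale)

lemma act_xvar: "act g (xvar j) = linear_form (\<lambda>i. g $ i $ j)"
  by (simp add: xvar_def Defs.monom_def act_single)

lemma act_sum: "act g (sum f K) = (\<Sum>k\<in>K. act g (f k))"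
  by (induction K rule: infinite_finite_induct) (auto simp: act_add)

lemma act_power: "act g (p ^ n) = act g p ^ n"
  by (induction n) (auto simp: act_mult)

lemma act_monom_eval: "act g (monom_eval y (T :: mon)) = monom_eval (\<lambda>j. act g (y j)) T"
  by (simp add: monom_eval_3 act_mult act_power)

lemma act_compose: "act g (act h p) = act (g ** h) p"
proof (induction p rule: poly_mapping_additive_induct)
  case (single T c)
  have "act g (linear_form (\<lambda>i. h $ i $ j)) = linear_form (\<lambda>i. (g ** h) $ i $ j)" for j
    by (simp add: linear_form_def act_add act_mult act_xvar matrix_matrix_mult_def sum_3 pconst_add pconst_mult algebra_simps)
  then show ?case by (simp add: act_single act_mult act_monom_eval)
qed (auto simp: act_add)

lemma act_mat_1 [simp]: "act (mat 1) p = p"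
proof (induction p rule: poly_mapping_additive_induct)
  case (single T c)
  have "linear_form (\<lambda>i. (mat 1 :: 'a ^ 3 ^ 3) $ i $ j) = xvar j" for j
    using exhaust_3[of j] by (auto simp add: linear_form_def sum_3 mat_def)
  then show ?case by (simp add: act_single monom_eval_xvar) (simp add: Defs.monom_def pconst_def mult_single)
qed (auto simp: act_add)

lemma homogeneous_linear_form: "homogeneous 1 (linear_form c)"
  unfolding linear_form_def
proof (rule homogeneous_sum)
  fix i show "homogeneous 1 (pconst (c i) * xvar i)"
    using homogeneous_mult[OF homogeneous_pconst[of "c i"], of 1 "xvar i"] by (simp add: xvar_def Defs.monom_def homogeneous_single)
qed

lemma homogeneous_monom_eval:
  assumes "\<And>j. homogeneous 1 (y j :: 'a::comm_ring_1 poly3)"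
  shows "homogeneous (mdeg T) (monom_eval y T)"
  unfolding monom_eval_3 mdeg_alt
  using homogeneous_power[OF assms] by (intro homogeneous_mult) fastforce+

lemma homogeneous_act: "homogeneous d p \<Longrightarrow> homogeneous d (act g p)"
proof -
  assume h: "homogeneous d p"
  have "act g p = (\<Sum>T\<in>keys p. act g (single T (lookup p T)))"
    by (subst poly_mapping_sum_singles[of p, symmetric]) (rule act_sum)
  moreover have "homogeneous d (act g (single T (lookup p T)))" if "T \<in> keys p" for T
    using that h homogeneous_mult[OF homogeneous_pconst[of "lookup p T"]
      homogeneous_monom_eval[OF homogeneous_linear_form, of T "\<lambda>j i. g $ i $ j"]]
    by (auto simp: act_single homogeneous_def[of d p])
  ultimately show ?thesis by (simp add: homogeneous_sum)
qed

lemma invertible_act_inverse: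
  assumes "invertible (g :: 'a::field ^ 3 ^ 3)"
  obtains h where "invertible h" "\<And>p. act g (act h p) = p" "\<And>p. act h (act g p) = p"
proof -
  obtain h where "g ** h = mat 1" "h ** g = mat 1" using assms unfolding invertible_def by blast
  then show ?thesis by (intro that[of h]) (auto simp: act_compose invertible_def)
qed

section \<open>Polynomial families of polynomials\<close>

text \<open>Finite sums of fixed polynomials with polynomial functions as coefficients. Closure under products is
  immediate in this form, and it avoids a formula for the coefficients of a product.\<close>

inductive polyfam :: "(('i \<Rightarrow> 'a::comm_ring_1) \<Rightarrow> 'a poly3) \<Rightarrow> bool" where
  polyfam_base: "polyfun F \<Longrightarrow> polyfam (\<lambda>x. pconst (F x) * q)"
| polyfam_add: "polyfam f \<Longrightarrow> polyfam g \<Longrightarrow> polyfam (\<lambda>x. f x + g x)"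

lemma polyfam_const: "polyfam (\<lambda>x. q)"
  using polyfam_base[OF polyfun_const[of 1], of q] by simp

lemma polyfam_mult:
  assumes "polyfam f" "polyfam g"
  shows "polyfam (\<lambda>x. f x * g x)"
  using assms
proof (induction f)
  case (polyfam_base F p)
  from polyfam_base(2) show ?case
  proof (induction g)
    case (polyfam_base G q)
    have e: "pconst (F x) * p * (pconst (G x) * q) = pconst (F x * G x) * (p * q)" for x
      by (simp add: pconst_mult mult_ac)
    show ?case unfolding e
      by (intro polyfam.polyfam_base polyfun_mult) fact+
  next
    case (polyfam_add f g)
    then show ?case unfolding distrib_left by (intro polyfam.polyfam_add)
  qed
next
  case (polyfam_add f h)
  then show ?case unfolding distrib_right by (intro polyfam.polyfam_add) blast+
qed

lemma polyfam_power: "polyfam f \<Longrightarrow> polyfam (\<lambda>x. f x ^ n)"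
  by (induction n) (auto intro: polyfam_const polyfam_mult)

lemma polyfam_sum: "(\<And>k. k \<in> K \<Longrightarrow> polyfam (f k)) \<Longrightarrow> polyfam (\<lambda>x. \<Sum>k\<in>K. f k x)"
  by (induction K rule: infinite_finite_induct) (auto intro: polyfam_const polyfam_add)

lemma polyfun_lookup_polyfam: "polyfam f \<Longrightarrow> polyfun (\<lambda>x. lookup (f x) T)"
proof (induction f rule: polyfam.induct)
  case (polyfam_base F q)
  then show ?case using lookup_pscale[of _ q T, unfolded pscale_def] by (simp add: polyfun_mult polyfun_const)
qed (simp add: lookup_add polyfun_add)

lemma polyfam_linear_form: "polyfam (\<lambda>c. linear_form c)"
  unfolding linear_form_def by (intro polyfam_sum polyfam_base polyfun_coord)

lemma polyfam_act: "polyfam (\<lambda>x. act (mat_of x) p)"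
proof (induction p rule: poly_mapping_additive_induct)
  case (single T c)
  show ?case unfolding act_single monom_eval_3 linear_form_def
    by (intro polyfam_mult polyfam_const polyfam_power polyfam_sum polyfam_base) (simp_all add: mat_of_def polyfun_coord)
qed (auto simp: act_add polyfam_const intro: polyfam_add)

text \<open>Gaussian elimination with one pivot per step: a coordinate of the last vector that does not vanish at
  \<open>x0\<close> clears that coordinate in the other vectors. Cross-multiplying instead of dividing keeps all
  coordinates polynomial, and the product of the pivots is the required function.\<close>

lemma indep_family_zariski_open:
  fixes v :: "nat \<Rightarrow> ('i \<Rightarrow> 'a::field_char_0) \<Rightarrow> 'a poly3"
  assumes "\<And>i T. i < n \<Longrightarrow> polyfun (\<lambda>x. lookup (v i x) T)"
    and "pv.indep_family n (\<lambda>i. v i x0)"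
  shows "\<exists>F. polyfun F \<and> F x0 \<noteq> 0 \<and> (\<forall>x. F x \<noteq> 0 \<longrightarrow> pv.indep_family n (\<lambda>i. v i x))"
  using assms
proof (induction n arbitrary: v)
  case 0
  show ?case by (rule exI[of _ "\<lambda>x. 1"]) (auto simp: pv.indep_family_def intro: polyfun_const)
next
  case (Suc n)
  have "v n x0 \<noteq> 0"
  proof
    assume z: "v n x0 = 0"
    define c :: "nat \<Rightarrow> 'a" where "c = (\<lambda>i. if i = n then 1 else 0)"
    have "(\<Sum>i<Suc n. pscale (c i) (v i x0)) = 0" using z by (simp add: c_def)
    then have "c n = 0" using Suc.prems(2) unfolding pv.indep_family_def by blast
    then show False by (simp add: c_def)
  qed
  then obtain T where T: "lookup (v n x0) T \<noteq> 0"
    by (metis lookup_zero poly_mapping_eqI)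
  define a where "a = (\<lambda>i x. lookup (v i x) T)"
  have a: "polyfun (a i)" if "i < Suc n" for i unfolding a_def using that Suc.prems by blast
  define w where "w = (\<lambda>i x. pscale (a n x) (v i x) - pscale (a i x) (v n x))"
  have comb: "(\<Sum>i<n. pscale (c i) (w i x)) =
     pscale (a n x) (\<Sum>i<n. pscale (c i) (v i x)) - pscale (\<Sum>i<n. c i * a i x) (v n x)" for c x
    by (rule poly_mapping_eqI)
       (simp add: w_def lookup_sum lookup_minus sum_distrib_left sum_distrib_right algebra_simps sum_subtractf)
  have iff: "pv.indep_family n (\<lambda>i. w i x) \<longleftrightarrow> pv.indep_family (Suc n) (\<lambda>i. v i x)" if nz: "a n x \<noteq> 0" for x
  proof
    assume w: "pv.indep_family n (\<lambda>i. w i x)"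
    show "pv.indep_family (Suc n) (\<lambda>i. v i x)" unfolding pv.indep_family_def
    proof (intro allI impI)
      fix c i assume s: "(\<Sum>i<Suc n. pscale (c i) (v i x)) = 0" and i: "i < Suc n"
      have "lookup (\<Sum>i<Suc n. pscale (c i) (v i x)) T = 0" using s by simp
      then have cn: "(\<Sum>i<n. c i * a i x) = - c n * a n x"
        by (simp add: lookup_sum lookup_add a_def eq_neg_iff_add_eq_0)
      have sn: "(\<Sum>i<n. pscale (c i) (v i x)) = - pscale (c n) (v n x)"
        using s by (simp add: eq_neg_iff_add_eq_0)
      have "(\<Sum>i<n. pscale (c i) (w i x)) = 0"
        unfolding comb cn sn by (rule poly_mapping_eqI) (simp add: lookup_minus)
      then have c0: "\<forall>i<n. c i = 0" using w unfolding pv.indep_family_def by blast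
      then have "c n * a n x = 0" using cn by simp
      then have "c n = 0" using nz by simp
      then show "c i = 0" using c0 i less_Suc_eq by auto
    qed
  next
    assume v: "pv.indep_family (Suc n) (\<lambda>i. v i x)"
    show "pv.indep_family n (\<lambda>i. w i x)" unfolding pv.indep_family_def
    proof (intro allI impI)
      fix c i assume s: "(\<Sum>i<n. pscale (c i) (w i x)) = 0" and i: "i < n"
      \<comment> \<open>The same relation, expressed in the vectors before elimination.\<close>
      define e where "e = (\<lambda>i. if i < n then a n x * c i else - (\<Sum>i<n. c i * a i x))"
      have "(\<Sum>i<Suc n. pscale (e i) (v i x)) = (\<Sum>i<n. pscale (c i) (w i x))"
        unfolding comb
        by (rule poly_mapping_eqI)
           (simp add: e_def lookup_sum lookup_add lookup_minus sum_distrib_left mult.assoc)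
      then have "\<forall>i<Suc n. e i = 0" using v s unfolding pv.indep_family_def by metis
      then have "e i = 0" using i by simp
      then show "c i = 0" using i nz by (simp add: e_def)
    qed
  qed
  have "\<exists>F. polyfun F \<and> F x0 \<noteq> 0 \<and> (\<forall>x. F x \<noteq> 0 \<longrightarrow> pv.indep_family n (\<lambda>i. w i x))"
  proof (rule Suc.IH)
    show "polyfun (\<lambda>x. lookup (w i x) T')" if "i < n" for i T'
      unfolding w_def lookup_minus lookup_pscale using that
      by (intro polyfun_diff polyfun_mult a Suc.prems) auto
    show "pv.indep_family n (\<lambda>i. w i x0)" using iff Suc.prems(2) T by (simp add: a_def)
  qed
  then obtain F where F: "polyfun F" "F x0 \<noteq> 0" "\<forall>x. F x \<noteq> 0 \<longrightarrow> pv.indep_family n (\<lambda>i. w i x)" by blast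
  show ?case
  proof (intro exI[of _ "\<lambda>x. F x * a n x"] conjI allI impI)
    show "polyfun (\<lambda>x. F x * a n x)" using F a by (simp add: polyfun_mult)
    show "F x0 * a n x0 \<noteq> 0" using F T by (simp add: a_def)
    show "pv.indep_family (Suc n) (\<lambda>i. v i x)" if "F x * a n x \<noteq> 0" for x
      using that F iff by auto
  qed
qed

section \<open>Initial ideals and ranks of coordinate projections\<close>

text \<open>The initial monomials of the nonzero elements of \<open>V\<close>, without reference to a choice of the initial
  monomial (\<open>leads_eq\<close>).\<close>

definition leads :: "'a::zero poly3 set \<Rightarrow> mon set" where
  "leads V = {T. \<exists>f\<in>V. lookup f T \<noteq> 0 \<and> (\<forall>S. revlex_less T S \<longrightarrow> lookup f S = 0)}"

lemma initial_monomial_eqI: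
  assumes "lookup f T \<noteq> 0" "\<And>S. revlex_less T S \<Longrightarrow> lookup f S = 0"
  shows "initial_monomial f = T"
proof -
  have less: "revlex_less S T" if "S \<in> keys f" "S \<noteq> T" for S
    using that assms(2)[of S] revlex_less_total[of S T] by (auto simp: in_keys_iff)
  show ?thesis unfolding initial_monomial_def
  proof (rule the_equality)
    show "T \<in> keys f \<and> (\<forall>S\<in>keys f. S \<noteq> T \<longrightarrow> revlex_less S T)"
      using less assms(1) by (auto simp: in_keys_iff)
    fix U assume "U \<in> keys f \<and> (\<forall>S\<in>keys f. S \<noteq> U \<longrightarrow> revlex_less S U)"
    then show "U = T" using less[of U] assms(1) revlex_less_trans[of T U T] by (cases "U = T") (auto simp: in_keys_iff)
  qed
qed

lemma leads_eq: "{initial_monomial p | p. p \<in> I \<and> p \<noteq> 0} = leads I"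
proof (intro equalityI subsetI)
  fix T assume "T \<in> {initial_monomial p | p. p \<in> I \<and> p \<noteq> 0}"
  then obtain p where p: "p \<in> I" "p \<noteq> 0" "T = initial_monomial p" by blast
  then obtain U where U: "U \<in> keys p" "\<forall>S\<in>keys p. S \<noteq> U \<longrightarrow> revlex_less S U"
    using revlex_max_exists[of "keys p"] by auto
  have z: "lookup p S = 0" if "revlex_less U S" for S
    using U that revlex_less_trans[of U S U] by (cases "S = U"; cases "S \<in> keys p") (auto simp: in_keys_iff)
  then have "T = U" using initial_monomial_eqI[of p U] U p by (simp add: in_keys_iff)
  then show "T \<in> leads I" using p U z by (auto simp: leads_def in_keys_iff)
next
  fix T assume "T \<in> leads I"
  then obtain f where f: "f \<in> I" "lookup f T \<noteq> 0" "\<forall>S. revlex_less T S \<longrightarrow> lookup f S = 0"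
    unfolding leads_def by blast
  then have "initial_monomial f = T" by (intro initial_monomial_eqI) auto
  then show "T \<in> {initial_monomial p | p. p \<in> I \<and> p \<noteq> 0}" using f by auto
qed

text \<open>The order is compatible with multiplication, so multiplying by a monomial shifts initial monomials.\<close>

lemma leads_add:
  fixes I :: "'a::comm_ring_1 poly3 set"
  assumes "ideal.subspace I" "T \<in> leads I"
  shows "U + T \<in> leads I"
proof -
  obtain f where f: "f \<in> I" "lookup f T \<noteq> 0" "\<forall>S. revlex_less T S \<longrightarrow> lookup f S = 0"
    using assms unfolding leads_def by blast
  have "lookup (monom U * f) (U + T) \<noteq> 0"
    using f by (simp add: Defs.monom_def lookup_single_times_add)
  moreover have "lookup (monom U * f) S = 0" if "revlex_less (U + T) S" for S
  proof (cases "\<exists>S'. S = U + S'")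
    case True
    then show ?thesis using that f by (auto simp: Defs.monom_def lookup_single_times_add revlex_less_add)
  next
    case False
    then show ?thesis by (auto simp: Defs.monom_def intro: lookup_single_times_eq_0)
  qed
  moreover have "monom U * f \<in> I" using assms f by (intro ideal.subspace_scale)
  ultimately show ?thesis unfolding leads_def by blast
qed

lemma subspace_supported:
  fixes M :: "mon set"
  assumes "\<And>S T. T \<in> M \<Longrightarrow> S + T \<in> M"
  shows "ideal.subspace {p :: 'a::comm_ring_1 poly3. keys p \<subseteq> M}"
proof (rule ideal.subspaceI)
  fix p q c :: "'a poly3"
  show "(0 :: 'a poly3) \<in> {p. keys p \<subseteq> M}" by simp
  show "p + q \<in> {p. keys p \<subseteq> M}"
    if "p \<in> {p. keys p \<subseteq> M}" "q \<in> {p. keys p \<subseteq> M}"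
    using that keys_add[of p q] by blast
  show "c * p \<in> {p. keys p \<subseteq> M}" if "p \<in> {p. keys p \<subseteq> M}"
    using that keys_mult[of c p] assms by blast
qed

lemma ideal_mem_of_monomials:
  assumes "ideal.subspace (I :: 'a::comm_ring_1 poly3 set)" "\<And>T. T \<in> keys p \<Longrightarrow> monom T \<in> I"
  shows "p \<in> I"
proof -
  have "p = (\<Sum>T\<in>keys p. pconst (lookup p T) * monom T)"
    by (subst poly_mapping_sum_singles[of p, symmetric], rule sum.cong)
       (simp_all add: pconst_def Defs.monom_def mult_single)
  also have "\<dots> \<in> I" using assms by (intro ideal.subspace_sum ideal.subspace_scale)
  finally show ?thesis .
qed

lemma initial_ideal_eq:
  fixes I :: "'a::comm_ring_1 poly3 set"
  assumes "ideal.subspace I"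
  shows "initial_ideal I = {p. keys p \<subseteq> leads I}"
proof -
  have e: "{monom (initial_monomial p) | p. p \<in> I \<and> p \<noteq> 0} = (monom ` leads I :: 'a poly3 set)"
    unfolding leads_eq[symmetric] by blast
  show ?thesis unfolding initial_ideal_def e
  proof
    show "ideal.span (monom ` leads I) \<subseteq> {p :: 'a poly3. keys p \<subseteq> leads I}"
      by (rule ideal.span_minimal) (auto simp: Defs.monom_def intro!: subspace_supported leads_add[OF assms])
    show "{p :: 'a poly3. keys p \<subseteq> leads I} \<subseteq> ideal.span (monom ` leads I)"
    proof
      fix p :: "'a poly3" assume p: "p \<in> {p. keys p \<subseteq> leads I}"
      show "p \<in> ideal.span (monom ` leads I)"
        by (rule ideal_mem_of_monomials[OF ideal.subspace_span]) (use p in \<open>blast intro: ideal.span_base\<close>)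
    qed
  qed
qed

definition above :: "mon \<Rightarrow> mon set" where
  "above T = {S. mdeg S = mdeg T \<and> revlex_less T S}"

text \<open>The kernel of the projection from the coordinates that are at least \<open>T\<close> to those above \<open>T\<close> consists
  of multiples of \<open>T\<close>; it is nonzero exactly when some element of \<open>V\<close> starts at \<open>T\<close>.\<close>

lemma leads_iff_rank:
  fixes V :: "'a::field poly3 set"
  assumes V: "pv.vs.subspace V" and d: "\<And>f. f \<in> V \<Longrightarrow> homogeneous (mdeg T) f"
  shows "T \<in> leads V \<longleftrightarrow> pv.vs.dim (restr (insert T (above T)) ` V) \<noteq> pv.vs.dim (restr (above T) ` V)"
proof -
  let ?W = "restr (insert T (above T)) ` V"
  let ?N = "{x \<in> ?W. restr (above T) x = 0}"
  interpret r: Vector_Spaces.linear pscale pscale "restr B :: 'a poly3 \<Rightarrow> _" for B by (rule linear_restr)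
  have W: "pv.vs.subspace ?W" using V by (rule r.subspace_image)
  have fd: "pv.findim ?W"
    by (rule findim_supported(1)[of "{S. mdeg S = mdeg T}"])
       (auto simp: lookup_restr above_def split: if_splits)
  have "restr (above T) ` ?W = restr (above T) ` V"
    by (simp add: image_image restr_restr Int_absorb2 subset_insertI)
  then have rn: "pv.vs.dim ?W = pv.vs.dim ?N + pv.vs.dim (restr (above T) ` V)"
    using pvp.rank_nullity[OF linear_restr[of "above T"] W fd] by simp
  have N: "pv.vs.subspace ?N"
    using W r.subspace_kernel[of "above T"] pv.vs.subspace_Int[of "{W, {x. restr (above T) x = 0}}" for W]
    by (auto simp: pv.vs.subspace_def r.add r.scale)
  have "pv.vs.dim ?N = 0 \<longleftrightarrow> ?N = {0}"
    using pv.dim_eq_0_iff_findim[OF _ N] pv.findim_subset[OF fd, of ?N] by blast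
  moreover have "?N \<noteq> {0} \<longleftrightarrow> T \<in> leads V"
  proof
    assume "T \<in> leads V"
    then obtain f where f: "f \<in> V" "lookup f T \<noteq> 0" "\<forall>S. revlex_less T S \<longrightarrow> lookup f S = 0"
      unfolding leads_def by blast
    have "restr (above T) (restr (insert T (above T)) f) = 0"
      by (rule poly_mapping_eqI) (use f in \<open>auto simp: lookup_restr above_def\<close>)
    then have "restr (insert T (above T)) f \<in> ?N" using f by auto
    moreover have "restr (insert T (above T)) f \<noteq> 0"
      using f(2) by (metis insertI1 lookup_restr lookup_zero)
    ultimately show "?N \<noteq> {0}" by blast
  next
    assume "?N \<noteq> {0}"
    then obtain x where x: "x \<in> ?N" "x \<noteq> 0" using pv.vs.subspace_0[OF N] by blast
    then obtain f where f: "f \<in> V" "x = restr (insert T (above T)) f" by blast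
    have z: "lookup f S = 0" if "revlex_less T S" for S
    proof (cases "mdeg S = mdeg T")
      case True
      then have S: "S \<in> above T" using that by (simp add: above_def)
      have "lookup (restr (above T) x) S = 0" using x by simp
      then show ?thesis using f S by (simp add: lookup_restr)
    next
      case False
      then show ?thesis using d[OF f(1)] by (auto simp: homogeneous_iff)
    qed
    obtain S where "lookup x S \<noteq> 0" using x by (metis lookup_zero poly_mapping_eqI)
    then have "lookup f T \<noteq> 0"
      using z f by (auto simp: lookup_restr above_def split: if_splits)
    then show "T \<in> leads V" using z f unfolding leads_def by blast
  qed
  ultimately show ?thesis using rn by auto
qed

section \<open>Existence of generic initial ideals\<close>

definition rk :: "'a::field poly3 set \<Rightarrow> 'a ^ 3 ^ 3 \<Rightarrow> nat \<Rightarrow> mon set \<Rightarrow> nat" where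
  "rk I g d B = pv.vs.dim (restr B ` act g ` degree_part I d)"

text \<open>The maximum is taken over all matrices, including singular ones. Semicontinuity shows that it is
  attained on a nonempty open set, hence also by invertible matrices, while maximising over all matrices
  frees the degenerations below from checking invertibility.\<close>

definition generic_rk :: "'a::field poly3 set \<Rightarrow> nat \<Rightarrow> mon set \<Rightarrow> nat" where
  "generic_rk I d B = Max (range (\<lambda>g. rk I g d B))"

lemma coordinate_image_degree:
  assumes "x \<in> restr B ` act g ` degree_part I d" "lookup x T \<noteq> 0"
  shows "mdeg T = d \<and> T \<in> B"
proof -
  obtain f where f: "f \<in> degree_part I d" "x = restr B (act g f)" using assms by blast
  have "homogeneous d (act g f)" using f by (intro homogeneous_act) (simp add: degree_part_def)
  then show ?thesis using assms(2) f(2) by (auto simp: lookup_restr homogeneous_iff split: if_splits)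
qed

lemma findim_coordinate_image: "pv.findim (restr B ` act g ` degree_part I d)"
  by (rule findim_supported(1)[of "{T. mdeg T = d}"]) (use coordinate_image_degree in \<open>auto, blast\<close>)

lemma rk_le_card: "finite B \<Longrightarrow> rk I g d B \<le> card B"
  unfolding rk_def by (rule findim_supported(2)) (use coordinate_image_degree in \<open>auto, blast\<close>)

lemma rk_le_card_degree: "rk I g d B \<le> card {T. mdeg T = d}"
  unfolding rk_def by (rule findim_supported(2)) (use coordinate_image_degree in \<open>auto, blast\<close>)

lemma finite_range_rk: "finite (range (\<lambda>g. rk I g d B))"
  by (rule finite_subset[of _ "{..card {T. mdeg T = d}}"]) (use rk_le_card_degree in auto)

lemma rk_le_generic: "rk I g d B \<le> generic_rk I d B"
  unfolding generic_rk_def using finite_range_rk by (rule Max_ge) simp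

lemma generic_rk_attained: "\<exists>g. rk I g d B = generic_rk I d B"
proof -
  have "generic_rk I d B \<in> range (\<lambda>g. rk I g d B)"
    unfolding generic_rk_def using finite_range_rk by (rule Max_in) simp
  then show ?thesis by (metis rangeE)
qed

text \<open>Preimages of a basis at \<open>g\<close> give vectors that vary polynomially with the matrix and remain
  independent nearby.\<close>

lemma rk_semicontinuous:
  fixes I :: "'a::field_char_0 poly3 set"
  shows "\<exists>F. polyfun F \<and> F (entries_of g) \<noteq> 0 \<and> (\<forall>x. F x \<noteq> 0 \<longrightarrow> rk I g d B \<le> rk I (mat_of x) d B)"
proof -
  obtain w where w: "pv.indep_family (rk I g d B) w" "\<And>i. i < rk I g d B \<Longrightarrow> w i \<in> restr B ` act g ` degree_part I d"
    using pv.indep_family_exists[OF findim_coordinate_image, of "rk I g d B" B g I d] unfolding rk_def by blast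
  then have "\<forall>i<rk I g d B. \<exists>f. f \<in> degree_part I d \<and> w i = restr B (act g f)" by blast
  then obtain f where f: "\<And>i. i < rk I g d B \<Longrightarrow> f i \<in> degree_part I d \<and> w i = restr B (act g (f i))"
    by metis
  define v where "v = (\<lambda>i x. restr B (act (mat_of x) (f i)))"
  have "polyfun (\<lambda>x. lookup (v i x) T)" for i T
    using polyfun_lookup_polyfam[OF polyfam_act, of "f i" T]
    by (cases "T \<in> B") (simp_all add: v_def lookup_restr polyfun_const)
  moreover have "pv.indep_family (rk I g d B) (\<lambda>i. v i (entries_of g))"
    using w(1) f by (auto simp: v_def pv.indep_family_def)
  ultimately obtain F where F: "polyfun F" "F (entries_of g) \<noteq> 0"
    "\<And>x. F x \<noteq> 0 \<Longrightarrow> pv.indep_family (rk I g d B) (\<lambda>i. v i x)"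
    using indep_family_zariski_open[of "rk I g d B" v "entries_of g"] by blast
  have "rk I g d B \<le> rk I (mat_of x) d B" if "F x \<noteq> 0" for x
    unfolding rk_def[of I "mat_of x"]
    by (rule pv.indep_family_card_le_dim[OF F(3)[OF that] _ findim_coordinate_image])
       (use f in \<open>auto simp: v_def\<close>)
  then show ?thesis using F by blast
qed

lemma generic_rk_open:
  fixes I :: "'a::field_char_0 poly3 set"
  shows "\<exists>F. polyfun F \<and> (\<exists>x. F x \<noteq> 0) \<and> (\<forall>x. F x \<noteq> 0 \<longrightarrow> rk I (mat_of x) d B = generic_rk I d B)"
proof -
  obtain g where g: "rk I g d B = generic_rk I d B" using generic_rk_attained by blast
  obtain F where "polyfun F" "F (entries_of g) \<noteq> 0" "\<And>x. F x \<noteq> 0 \<Longrightarrow> rk I g d B \<le> rk I (mat_of x) d B"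
    using rk_semicontinuous[of g I d B] by blast
  then show ?thesis using g rk_le_generic[of I _ d B] by (metis le_antisym)
qed

definition rk_generic :: "'a::field poly3 set \<Rightarrow> nat \<Rightarrow> 'a ^ 3 ^ 3 \<Rightarrow> bool" where
  "rk_generic I N g \<longleftrightarrow> (\<forall>d<N. \<forall>B\<subseteq>{T. mdeg T = d}. rk I g d B = generic_rk I d B)"

lemma rk_generic_open:
  fixes I :: "'a::field_char_0 poly3 set"
  obtains F where "polyfun F" "\<exists>x. F x \<noteq> 0" "\<And>x. F x \<noteq> 0 \<Longrightarrow> rk_generic I N (mat_of x)"
proof -
  have "\<forall>d B. \<exists>F. polyfun F \<and> (\<exists>x. F x \<noteq> 0) \<and> (\<forall>x. F x \<noteq> 0 \<longrightarrow> rk I (mat_of x) d B = generic_rk I d B)"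
    using generic_rk_open by blast
  then obtain F where F: "\<And>d B. polyfun (F d B)" "\<And>d B. \<exists>x. F d B x \<noteq> 0"
    "\<And>d B x. F d B x \<noteq> 0 \<Longrightarrow> rk I (mat_of x) d B = generic_rk I d B" by metis
  let ?K = "SIGMA d:{..<N}. Pow {T::mon. mdeg T = d}"
  define G where "G = (\<lambda>x. \<Prod>k\<in>?K. F (fst k) (snd k) x)"
  have fin: "finite ?K" by (intro finite_SigmaI) auto
  have "polyfun G" unfolding G_def by (intro polyfun_prod F(1))
  moreover have "\<exists>x. G x \<noteq> 0"
    using polyfun_prod_nonzero[OF fin, of "\<lambda>k. F (fst k) (snd k)"] F(1,2) unfolding G_def by metis
  moreover have "rk_generic I N (mat_of x)" if "G x \<noteq> 0" for x
  proof -
    have "\<forall>k\<in>?K. F (fst k) (snd k) x \<noteq> 0" using that fin by (simp add: G_def)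
    then show ?thesis unfolding rk_generic_def using F(3) by fastforce
  qed
  ultimately show ?thesis using that by blast
qed

text \<open>The chain of the ideals $I + \mathfrak m^n$ becomes stationary. Once
  $I + \mathfrak m^d = I + \mathfrak m^{d+1}$, comparing components of degree $d$ shows that $I$ contains
  all forms of degree $d$.\<close>

lemma artinian_contains_high_degrees:
  fixes I :: "'a::field poly3 set"
  assumes "homogeneous_artinian_ideal I"
  obtains N where "\<And>d. N \<le> d \<Longrightarrow> degree_part UNIV d \<subseteq> I"
proof -
  have hI: "homogeneous_ideal I" and a: "artinian_quotient I"
    using assms by (auto simp: homogeneous_artinian_ideal_def)
  have sI: "ideal.subspace I" using hI by (rule homogeneous_ideal_subspace)
  define M where "M = (\<lambda>n. {b :: 'a poly3. keys b \<subseteq> {T. n \<le> mdeg T}})"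
  have sum_subspace: "ideal.subspace {a + b | a b. a \<in> A \<and> b \<in> B}"
    if sub: "ideal.subspace A" "ideal.subspace B" for A B :: "'a poly3 set"
  proof (rule ideal.subspaceI)
    show "0 \<in> {a + b | a b. a \<in> A \<and> b \<in> B}" using sub[THEN ideal.subspace_0] by force
    show "x + y \<in> {a + b | a b. a \<in> A \<and> b \<in> B}"
      if xy: "x \<in> {a + b | a b. a \<in> A \<and> b \<in> B}" "y \<in> {a + b | a b. a \<in> A \<and> b \<in> B}" for x y
    proof -
      obtain a b a' b' where "x = a + b" "y = a' + b'" "a \<in> A" "a' \<in> A" "b \<in> B" "b' \<in> B" using xy by blast
      then have "x + y = (a + a') + (b + b')" "a + a' \<in> A" "b + b' \<in> B"
        using sub[THEN ideal.subspace_add] by (auto simp: algebra_simps)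
      then show ?thesis by blast
    qed
    show "c * x \<in> {a + b | a b. a \<in> A \<and> b \<in> B}" if cx: "x \<in> {a + b | a b. a \<in> A \<and> b \<in> B}" for c x
    proof -
      obtain a b where "x = a + b" "a \<in> A" "b \<in> B" using cx by blast
      then have "c * x = c * a + c * b" "c * a \<in> A" "c * b \<in> B"
        using sub[THEN ideal.subspace_scale] by (auto simp: distrib_left)
      then show ?thesis by blast
    qed
  qed
  have sM: "ideal.subspace (M n)" for n
    unfolding M_def by (rule subspace_supported) (simp add: mdeg_add)
  define F where "F = (\<lambda>n. {a + b | a b. a \<in> I \<and> b \<in> M n})"
  have "ideal.subspace (F n) \<and> I \<subseteq> F n \<and> F (Suc n) \<subseteq> F n" for n
  proof (intro conjI)
    show "ideal.subspace (F n)" unfolding F_def using sI sM by (rule sum_subspace)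
    show "I \<subseteq> F n" using ideal.subspace_0[OF sM[of n]] unfolding F_def by force
    have "M (Suc n) \<subseteq> M n" unfolding M_def by auto
    then show "F (Suc n) \<subseteq> F n" unfolding F_def by blast
  qed
  then obtain n where n: "\<forall>m\<ge>n. F m = F n" using a unfolding artinian_quotient_def by blast
  have "p \<in> I" if d: "n \<le> d" and p: "p \<in> degree_part UNIV d" for d p
  proof -
    have hp: "homogeneous d p" using p by (simp add: degree_part_def)
    then have "p \<in> M d" by (auto simp: M_def homogeneous_def)
    then have "p \<in> F d" using ideal.subspace_0[OF sI] unfolding F_def by force
    also have "F d = F (Suc d)" using n d by (metis le_SucI)
    finally obtain a b where ab: "a \<in> I" "b \<in> M (Suc d)" "p = a + b" unfolding F_def by blast
    have "hcomp d b = 0"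
      by (rule poly_mapping_eqI) (use ab(2) in \<open>force simp: lookup_hcomp M_def in_keys_iff subset_iff\<close>)
    then have "p = hcomp d a" using hp ab(3) hcomp_homogeneous[OF hp, of d] by (simp add: hcomp_add)
    then show ?thesis using hcomp_mem_homogeneous_ideal[OF hI ab(1)] by simp
  qed
  then show ?thesis using that by blast
qed

lemma act_hcomp: "hcomp d (act g p) = act g (hcomp d p)"
proof -
  obtain n where n: "p = (\<Sum>e<n. hcomp e p)" by (rule sum_hcomp)
  have c: "hcomp d (act g (hcomp e p)) = act g (hcomp d (hcomp e p))" for e
    using hcomp_homogeneous[of e "act g (hcomp e p)" d] hcomp_homogeneous[of e "hcomp e p" d]
    by (simp add: homogeneous_act)
  have "hcomp d (act g p) = (\<Sum>e<n. hcomp d (act g (hcomp e p)))"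
    by (subst n) (simp only: act_sum hcomp_sum)
  also have "\<dots> = act g (\<Sum>e<n. hcomp d (hcomp e p))" by (simp only: c act_sum)
  also have "(\<Sum>e<n. hcomp d (hcomp e p)) = hcomp d p"
    by (subst (2) n) (simp only: hcomp_sum)
  finally show ?thesis .
qed

lemma subspace_act:
  assumes "invertible (g :: 'a::field ^ 3 ^ 3)" "ideal.subspace I"
  shows "ideal.subspace (act g ` I)"
proof -
  obtain h where h: "\<And>p. act g (act h p) = p" using invertible_act_inverse[OF assms(1)] by metis
  show ?thesis
  proof (rule ideal.subspaceI)
    show "0 \<in> act g ` I" using ideal.subspace_0[OF assms(2)] by (metis act_0 imageI)
    show "x + y \<in> act g ` I" if "x \<in> act g ` I" "y \<in> act g ` I" for x y
      using that ideal.subspace_add[OF assms(2)] by (auto simp: act_add[symmetric])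
    show "c * x \<in> act g ` I" if x: "x \<in> act g ` I" for c x
    proof -
      obtain f where f: "f \<in> I" "x = act g f" using x by blast
      then have "c * x = act g (act h c * f)" by (simp add: act_mult h)
      then show ?thesis using ideal.subspace_scale[OF assms(2) f(1)] by blast
    qed
  qed
qed

text \<open>Initial monomials of a homogeneous ideal are attained by homogeneous elements, so the rank criterion
  can be applied in a single degree.\<close>

lemma leads_act_iff_rank:
  fixes I :: "'a::field poly3 set"
  assumes g: "invertible g" and I: "homogeneous_ideal I"
  shows "T \<in> leads (act g ` I) \<longleftrightarrow> rk I g (mdeg T) (insert T (above T)) \<noteq> rk I g (mdeg T) (above T)"
proof -
  let ?V = "act g ` degree_part I (mdeg T)"
  interpret a: Vector_Spaces.linear pscale pscale "act g" by (rule linear_act)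
  have "pv.vs.subspace ?V"
    by (rule a.subspace_image) (rule subspace_degree_part[OF homogeneous_ideal_subspace[OF I]])
  then have "T \<in> leads ?V \<longleftrightarrow> rk I g (mdeg T) (insert T (above T)) \<noteq> rk I g (mdeg T) (above T)"
    unfolding rk_def by (rule leads_iff_rank) (auto simp: degree_part_def homogeneous_act)
  moreover have "T \<in> leads ?V \<longleftrightarrow> T \<in> leads (act g ` I)"
  proof
    show "T \<in> leads (act g ` I)" if "T \<in> leads ?V"
      using that unfolding leads_def degree_part_def by blast
  next
    assume "T \<in> leads (act g ` I)"
    then obtain f where f: "f \<in> I" "lookup (act g f) T \<noteq> 0"
      "\<forall>S. revlex_less T S \<longrightarrow> lookup (act g f) S = 0"
      unfolding leads_def by blast
    let ?h = "hcomp (mdeg T) (act g f)"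
    have "?h \<in> ?V" using hcomp_mem_homogeneous_ideal[OF I f(1)] by (auto simp: act_hcomp degree_part_def)
    then show "T \<in> leads ?V" unfolding leads_def using f(2,3)
      by (intro CollectI bexI[of _ ?h]) (auto simp: lookup_hcomp)
  qed
  ultimately show ?thesis by simp
qed

lemma supported_eq_iff:
  "{p :: 'a::comm_ring_1 poly3. keys p \<subseteq> M} = {p. keys p \<subseteq> M'} \<longleftrightarrow> M = M'"
proof
  assume e: "{p :: 'a::comm_ring_1 poly3. keys p \<subseteq> M} = {p. keys p \<subseteq> M'}"
  have "keys (monom T :: 'a poly3) \<subseteq> M \<longleftrightarrow> keys (monom T :: 'a poly3) \<subseteq> M'" for T
    using e by blast
  then show "M = M'" by (auto simp: Defs.monom_def)
qed simp

text \<open>By \<open>leads_act_iff_rank\<close> the initial monomials of degree less than \<open>N\<close> depend only on ranks that are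
  constant on the open set where \<open>F\<close> does not vanish, and in degrees at least \<open>N\<close> every monomial is
  initial. Uniqueness holds because two nonempty open sets of invertible matrices meet.\<close>

lemma gin_generic:
  fixes I :: "'a::field_char_0 poly3 set"
  assumes I: "homogeneous_artinian_ideal I"
  shows "\<exists>F. polyfun F \<and> (\<exists>x. F x \<noteq> 0) \<and> (\<forall>g. invertible g \<longrightarrow> F (entries_of g) \<noteq> 0 \<longrightarrow>
     rk_generic I N0 g \<and> gin I = {p. keys p \<subseteq> leads (act g ` I)})"
proof -
  have hI: "homogeneous_ideal I" using I by (simp add: homogeneous_artinian_ideal_def)
  have sI: "ideal.subspace I" using hI by (rule homogeneous_ideal_subspace)
  obtain N1 where N1: "\<And>d. N1 \<le> d \<Longrightarrow> degree_part UNIV d \<subseteq> I"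
    using artinian_contains_high_degrees[OF I] by blast
  define N where "N = max N0 N1"
  obtain F where F: "polyfun F" "\<exists>x. F x \<noteq> 0" "\<And>x. F x \<noteq> 0 \<Longrightarrow> rk_generic I N (mat_of x)"
    using rk_generic_open[of I N] by blast
  \<comment> \<open>From degree \<open>N\<close> on every monomial is initial, so only finitely many ranks enter.\<close>
  define L where "L = {T. mdeg T < N \<longrightarrow> generic_rk I (mdeg T) (insert T (above T)) \<noteq> generic_rk I (mdeg T) (above T)}"
  have leads: "leads (act g ` I) = L" if g: "invertible g" "F (entries_of g) \<noteq> 0" for g
  proof (intro set_eqI)
    fix T
    show "T \<in> leads (act g ` I) \<longleftrightarrow> T \<in> L"
    proof (cases "mdeg T < N")
      case True
      have "rk_generic I N g" using F(3)[OF g(2)] by simp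
      moreover have "insert T (above T) \<subseteq> {S. mdeg S = mdeg T}" "above T \<subseteq> {S. mdeg S = mdeg T}"
        by (auto simp: above_def)
      ultimately show ?thesis using True leads_act_iff_rank[OF g(1) hI, of T]
        unfolding rk_generic_def L_def by auto
    next
      case False
      obtain h where h: "\<And>p. act g (act h p) = p" using invertible_act_inverse[OF g(1)] by metis
      have "act h (monom T) \<in> degree_part UNIV (mdeg T)"
        by (simp add: degree_part_def Defs.monom_def homogeneous_single homogeneous_act)
      moreover have "N1 \<le> mdeg T" using False by (simp add: N_def)
      ultimately have "act h (monom T) \<in> I" using N1 by blast
      then have "monom T \<in> act g ` I" using h by (metis imageI)
      then have "T \<in> leads (act g ` I)" unfolding leads_def
        by (intro CollectI bexI[of _ "monom T"]) (auto simp: Defs.monom_def lookup_single when_def)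
      then show ?thesis using False by (simp add: L_def)
    qed
  qed
  have init: "initial_ideal (act g ` I) = {p. keys p \<subseteq> L}" if "invertible g" "F (entries_of g) \<noteq> 0" for g
    using leads[OF that] initial_ideal_eq[OF subspace_act[OF that(1) sI]] by simp
  have "gin I = {p. keys p \<subseteq> L}"
    unfolding gin_def
  proof (rule the_equality)
    let ?U = "{g. invertible g \<and> F (entries_of g) \<noteq> 0}"
    have "?U \<noteq> {}" using F(2) polyfun_invertible[OF F(1)] by (metis (mono_tags, lifting) empty_iff mem_Collect_eq)
    then show "\<exists>U. zariski_open_GL3 U \<and> U \<noteq> {} \<and> (\<forall>g\<in>U. initial_ideal (act g ` I) = {p. keys p \<subseteq> L})"
      using zariski_open_GL3_polyfun[OF F(1)] init by (intro exI[of _ ?U]) auto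
    fix K assume "\<exists>U. zariski_open_GL3 U \<and> U \<noteq> {} \<and> (\<forall>g\<in>U. initial_ideal (act g ` I) = K)"
    then obtain U where U: "zariski_open_GL3 U" "U \<noteq> {}" "\<And>g. g \<in> U \<Longrightarrow> initial_ideal (act g ` I) = K" by blast
    then obtain g0 where "g0 \<in> U" by blast
    then obtain G where G: "polyfun G" "G (entries_of g0) \<noteq> 0"
      "\<And>h. invertible h \<Longrightarrow> G (entries_of h) \<noteq> 0 \<Longrightarrow> h \<in> U"
      using zariski_open_GL3_basic[OF U(1)] by metis
    obtain x where x: "F x \<noteq> 0" "G x \<noteq> 0" using polyfun_common_nonzero F(1,2) G(1,2) by metis
    obtain g where "invertible g" "F (entries_of g) * G (entries_of g) \<noteq> 0"
      using polyfun_invertible[OF polyfun_mult[OF F(1) G(1)], of x] x by auto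
    then show "K = {p. keys p \<subseteq> L}" using init U(3) G(3) by (metis mult_zero_left mult_zero_right)
  qed
  moreover have "rk_generic I N0 g" if "F (entries_of g) \<noteq> 0" for g
    using F(3)[OF that] unfolding rk_generic_def N_def by simp
  ultimately show ?thesis using F(1,2) leads by (intro exI[of _ F]) auto
qed

lemma gin_generic_obtain:
  fixes I :: "'a::field_char_0 poly3 set"
  assumes "homogeneous_artinian_ideal I"
  obtains g where "invertible g" "rk_generic I N g" "gin I = {p. keys p \<subseteq> leads (act g ` I)}"
proof -
  obtain F where F: "polyfun F" "\<exists>x. F x \<noteq> 0" "\<And>g. invertible g \<Longrightarrow> F (entries_of g) \<noteq> 0 \<Longrightarrow>
     rk_generic I N g \<and> gin I = {p. keys p \<subseteq> leads (act g ` I)}"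
    using gin_generic[OF assms, of N] by blast
  then show ?thesis using that polyfun_invertible[OF F(1)] by metis
qed

definition gin_monomials :: "'a::field poly3 set \<Rightarrow> mon set" where
  "gin_monomials I = {T. monom T \<in> gin I}"

lemma gin_eq_supported:
  fixes I :: "'a::field_char_0 poly3 set"
  assumes "homogeneous_artinian_ideal I"
  shows "gin I = {p. keys p \<subseteq> gin_monomials I}"
proof -
  obtain g where "gin I = {p. keys p \<subseteq> leads (act g ` I)}"
    using gin_generic_obtain[OF assms] by blast
  moreover from this have "gin_monomials I = leads (act g ` I)"
    by (simp add: gin_monomials_def Defs.monom_def)
  ultimately show ?thesis by simp
qed

lemma gin_monomials_leads:
  fixes I :: "'a::field_char_0 poly3 set"
  assumes "gin I = {p. keys p \<subseteq> leads (act g ` I)}"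
  shows "gin_monomials I = leads (act g ` I)"
  using assms by (simp add: gin_monomials_def Defs.monom_def)

lemma gin_monomials_add:
  fixes I :: "'a::field_char_0 poly3 set"
  assumes I: "homogeneous_artinian_ideal I" and T: "T \<in> gin_monomials I"
  shows "S + T \<in> gin_monomials I"
proof -
  obtain g where g: "invertible g" "gin I = {p. keys p \<subseteq> leads (act g ` I)}"
    using gin_generic_obtain[OF I] by blast
  have "ideal.subspace (act g ` I)"
    using I g by (auto simp: homogeneous_artinian_ideal_def intro: subspace_act homogeneous_ideal_subspace)
  then show ?thesis using leads_add T gin_monomials_leads[OF g(2)] by simp
qed

lemma gin_monomials_iff_rank:
  fixes I :: "'a::field_char_0 poly3 set"
  assumes I: "homogeneous_artinian_ideal I"
  shows "T \<in> gin_monomials I \<longleftrightarrow>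
    generic_rk I (mdeg T) (insert T (above T)) \<noteq> generic_rk I (mdeg T) (above T)"
proof -
  obtain g where g: "invertible g" "rk_generic I (Suc (mdeg T)) g" "gin I = {p. keys p \<subseteq> leads (act g ` I)}"
    using gin_generic_obtain[OF I] by blast
  have "T \<in> gin_monomials I \<longleftrightarrow> T \<in> leads (act g ` I)" using gin_monomials_leads[OF g(3)] by simp
  also have "\<dots> \<longleftrightarrow> rk I g (mdeg T) (insert T (above T)) \<noteq> rk I g (mdeg T) (above T)"
    using leads_act_iff_rank[OF g(1)] I by (simp add: homogeneous_artinian_ideal_def)
  also have "\<dots> \<longleftrightarrow> generic_rk I (mdeg T) (insert T (above T)) \<noteq> generic_rk I (mdeg T) (above T)"
  proof -
    have "insert T (above T) \<subseteq> {S. mdeg S = mdeg T}" "above T \<subseteq> {S. mdeg S = mdeg T}"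
      by (auto simp: above_def)
    then show ?thesis using g(2) unfolding rk_generic_def by auto
  qed
  finally show ?thesis .
qed

section \<open>Monomials in the first two variables\<close>

definition plane_mons :: "nat \<Rightarrow> nat \<Rightarrow> mon set" where
  "plane_mons d b = {T. mdeg T = d \<and> lookup T 3 = 0 \<and> lookup T 2 < b}"

definition plane_mon :: "nat \<Rightarrow> nat \<Rightarrow> mon" where
  "plane_mon d j = single 1 (d - j) + single 2 j"

lemma lookup_plane_mon [simp]:
  "lookup (plane_mon d j) 1 = d - j"
  "lookup (plane_mon d j) 2 = j"
  "lookup (plane_mon d j) 3 = 0"
  by (simp_all add: plane_mon_def lookup_add lookup_single when_def)

lemma mdeg_plane_mon [simp]: "j \<le> d \<Longrightarrow> mdeg (plane_mon d j) = d"
  by (simp add: mdeg_alt)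

lemma plane_mon_inj [simp]: "plane_mon d i = plane_mon d j \<longleftrightarrow> i = j"
  by (metis lookup_plane_mon(2))

lemma plane_monsD: "T \<in> plane_mons d b \<Longrightarrow> T = plane_mon d (lookup T 2)"
  by (rule mon_eqI) (auto simp: plane_mons_def mdeg_alt)

lemma plane_mon_mem: "j \<le> d \<Longrightarrow> plane_mon d j \<in> plane_mons d b \<longleftrightarrow> j < b"
  by (simp add: plane_mons_def)

lemma plane_mons_image: "plane_mons d b = plane_mon d ` {j. j < b \<and> j \<le> d}"
proof (intro equalityI subsetI)
  fix T assume T: "T \<in> plane_mons d b"
  then have "T = plane_mon d (lookup T 2)" by (rule plane_monsD)
  moreover have "lookup T 2 < b \<and> lookup T 2 \<le> d"
    using T by (auto simp: plane_mons_def mdeg_alt)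
  ultimately show "T \<in> plane_mon d ` {j. j < b \<and> j \<le> d}" by blast
qed (auto simp: plane_mon_mem)

lemma finite_plane_mons [simp]: "finite (plane_mons d b)"
  by (simp add: plane_mons_image)

lemma card_plane_mons: "b \<le> Suc d \<Longrightarrow> card (plane_mons d b) = b"
proof -
  assume "b \<le> Suc d"
  then have "{j. j < b \<and> j \<le> d} = {..<b}" by auto
  then show ?thesis by (simp add: plane_mons_image card_image inj_on_def)
qed

text \<open>Monomials free of $x_3$ precede all others of their degree, and among them the exponent of $x_2$
  decides.\<close>

lemma above_plane_mon:
  assumes "j \<le> d"
  shows "above (plane_mon d j) = plane_mons d j"
    and "insert (plane_mon d j) (above (plane_mon d j)) = plane_mons d (Suc j)"
proof -
  show a: "above (plane_mon d j) = plane_mons d j"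
    using assms by (auto simp: above_def plane_mons_def revlex_less_iff)
  show "insert (plane_mon d j) (above (plane_mon d j)) = plane_mons d (Suc j)"
    unfolding a plane_mons_image using assms by (auto simp: less_Suc_eq)
qed

section \<open>Generic ranks on the first two variables\<close>

lemma binomial_absorb:
  "e * (e choose j) = Suc j * (e choose Suc j) + j * (e choose j)"
proof (cases "j \<le> e")
  case True
  have "(e - j) * (e choose j) = Suc j * (e choose Suc j)"
    by (simp only: binomial_absorb_comp binomial_absorption)
  moreover have "e * (e choose j) = (e - j) * (e choose j) + j * (e choose j)"
    using True by (simp add: distrib_right[symmetric])
  ultimately show ?thesis by simp
qed (simp add: binomial_eq_0)

text \<open>The $\binom{e}{j}$ with $j < n$ span the polynomials in $e$ of degree less than $n$, and a nontrivial
  combination of evaluations at $n$ distinct points does not vanish on all of these; characteristic 0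
  keeps the $e_i$ distinct in the field. In the induction from $n$ to $n+1$, multiplying the $i$-th
  coefficient by $e_i - e_n$ removes the last term at the cost of one relation, by
  \<open>binomial_absorb\<close>.\<close>

lemma binomials_independent:
  fixes l :: "nat \<Rightarrow> 'a::field_char_0"
  assumes "inj_on e {..<n}" "\<And>j. j < n \<Longrightarrow> (\<Sum>i<n. l i * of_nat (e i choose j)) = 0" "i < n"
  shows "l i = 0"
  using assms
proof (induction n arbitrary: l i)
  case (Suc n)
  define u where "u = (\<lambda>i. l i * (of_nat (e i) - of_nat (e n)))"
  have "(\<Sum>i<n. u i * of_nat (e i choose j)) = 0" if j: "j < n" for j
  proof -
    have "l i * of_nat (e i) * of_nat (e i choose j) =
      of_nat (Suc j) * (l i * of_nat (e i choose Suc j)) + of_nat j * (l i * of_nat (e i choose j))" for i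
      using arg_cong[OF binomial_absorb[of "e i" j], of "of_nat :: nat \<Rightarrow> 'a"]
      by (simp only: of_nat_mult of_nat_add) (simp add: algebra_simps)
    then have "(\<Sum>i<Suc n. l i * of_nat (e i) * of_nat (e i choose j)) =
      of_nat (Suc j) * (\<Sum>i<Suc n. l i * of_nat (e i choose Suc j)) + of_nat j * (\<Sum>i<Suc n. l i * of_nat (e i choose j))"
      by (simp only: sum.distrib sum_distrib_left)
    also have "\<dots> = 0" using Suc.prems(2)[of j] Suc.prems(2)[of "Suc j"] j by (simp del: sum.lessThan_Suc)
    finally have e1: "(\<Sum>i<Suc n. l i * of_nat (e i) * of_nat (e i choose j)) = 0" .
    have "(\<Sum>i<Suc n. u i * of_nat (e i choose j)) =
       (\<Sum>i<Suc n. l i * of_nat (e i) * of_nat (e i choose j)) - of_nat (e n) * (\<Sum>i<Suc n. l i * of_nat (e i choose j))"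
      by (simp only: u_def sum_distrib_left sum_subtractf[symmetric]) (rule sum.cong, simp_all add: algebra_simps)
    also have "\<dots> = 0" using e1 Suc.prems(2)[of j] j by (simp del: sum.lessThan_Suc)
    finally show ?thesis by (simp add: u_def)
  qed
  moreover have "inj_on e {..<n}" using Suc.prems(1) by (rule inj_on_subset) auto
  ultimately have u0: "u i = 0" if "i < n" for i using Suc.IH[of u i] that by blast
  have l0: "l i = 0" if "i < n" for i
  proof -
    have "e i \<noteq> e n" using Suc.prems(1) that by (auto simp: inj_on_def)
    then show ?thesis using u0[OF that] by (simp add: u_def)
  qed
  have "(\<Sum>i<Suc n. l i * of_nat (e i choose 0)) = 0" by (rule Suc.prems(2)) simp
  then have "l n = 0" using l0 by simp
  then show ?case using l0 Suc.prems(3) less_Suc_eq by blast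
qed simp

lemma pconst_of_nat: "pconst (of_nat n) = (of_nat n :: 'a::comm_ring_1 poly3)"
  by (induction n) (simp_all add: pconst_add)

lemma sheared_power:
  fixes e d :: nat
  assumes "e \<le> d"
  shows "xvar 1 ^ (d - e) * (xvar 2 + xvar 1) ^ e =
    (\<Sum>k\<le>e. pscale (of_nat (e choose k)) (monom (plane_mon d k)) :: 'a::comm_ring_1 poly3)"
proof -
  have "xvar 1 ^ (d - e) * (of_nat (e choose k) * xvar 2 ^ k * xvar 1 ^ (e - k)) =
    pscale (of_nat (e choose k)) (monom (plane_mon d k) :: 'a poly3)" if "k \<le> e" for k
  proof -
    have "(xvar 1 ^ (d - e) * xvar 1 ^ (e - k) :: 'a poly3) = xvar 1 ^ (d - k)"
      using that assms by (simp add: power_add[symmetric])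
    moreover have "xvar 1 ^ (d - e) * (of_nat (e choose k) * xvar 2 ^ k * xvar 1 ^ (e - k)) =
      of_nat (e choose k) * xvar 2 ^ k * (xvar 1 ^ (d - e) * xvar 1 ^ (e - k) :: 'a poly3)"
      by (simp only: mult_ac)
    ultimately show ?thesis
      by (simp add: plane_mon_def monom_add xvar_power[symmetric] pscale_def pconst_of_nat mult_ac)
  qed
  then show ?thesis by (simp add: binomial_ring sum_distrib_left)
qed

lemma lookup_sheared_power:
  assumes "e \<le> d" "j \<le> d"
  shows "lookup (xvar 1 ^ (d - e) * (xvar 2 + xvar 1) ^ e :: 'a::comm_ring_1 poly3) (plane_mon d j)
    = of_nat (e choose j)"
  using assms by (auto simp: sheared_power lookup_sum Defs.monom_def lookup_single when_def if_distrib not_le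
      binomial_eq_0 cong: if_cong)

text \<open>An echelon form: picking one element for every occurring highest exponent of $x_2$ gives a spanning
  set of \<open>W\<close>, so at least \<open>dim W\<close> exponents occur.\<close>

lemma exists_distinct_orders:
  fixes W :: "'a::field poly3 set"
  assumes W: "pv.vs.subspace W" and supp: "\<And>w T. w \<in> W \<Longrightarrow> lookup w T \<noteq> 0 \<Longrightarrow> T \<in> plane_mons d (Suc d)"
    and n: "n \<le> pv.vs.dim W"
  obtains e w where "inj_on e {..<n}" "\<And>i. i < n \<Longrightarrow> e i \<le> d" "\<And>i. i < n \<Longrightarrow> w i \<in> W"
    "\<And>i. i < n \<Longrightarrow> lookup (w i) (plane_mon d (e i)) \<noteq> 0"
    "\<And>i j. i < n \<Longrightarrow> e i < j \<Longrightarrow> lookup (w i) (plane_mon d j) = 0"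
proof -
  define E where "E = {k. \<exists>w\<in>W. lookup w (plane_mon d k) \<noteq> 0 \<and>
     (\<forall>j>k. lookup w (plane_mon d j) = 0)}"
  obtain y where y: "\<And>k. k \<in> E \<Longrightarrow> y k \<in> W \<and> lookup (y k) (plane_mon d k) \<noteq> 0 \<and>
     (\<forall>j>k. lookup (y k) (plane_mon d j) = 0)"
  proof -
    have "\<forall>k\<in>E. \<exists>w. w \<in> W \<and> lookup w (plane_mon d k) \<noteq> 0 \<and>
      (\<forall>j>k. lookup w (plane_mon d j) = 0)" unfolding E_def by blast
    then show ?thesis using that by (auto dest!: bchoice)
  qed
  have Ed: "k \<le> d" if "k \<in> E" for k
  proof -
    have "plane_mon d k \<in> plane_mons d (Suc d)" using y[OF that] supp by blast
    then show ?thesis by (auto simp: plane_mons_image)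
  qed
  then have finE: "finite E" by (meson finite_nat_set_iff_bounded_le)
  have span: "w \<in> pv.vs.span (y ` E)" if "w \<in> W" "\<And>j. k \<le> j \<Longrightarrow> lookup w (plane_mon d j) = 0" for w k
    using that
  proof (induction k arbitrary: w)
    case 0
    have "w = 0"
    proof (rule poly_mapping_eqI, rule ccontr)
      fix T assume "lookup w T \<noteq> lookup 0 T"
      then have nz: "lookup w T \<noteq> 0" by simp
      then have "T = plane_mon d (lookup T 2)" using supp 0 plane_monsD by blast
      then show False using 0(2)[of "lookup T 2"] nz by simp
    qed
    then show ?case by (simp add: pv.vs.span_zero)
  next
    case (Suc k)
    show ?case
    proof (cases "lookup w (plane_mon d k) = 0")
      case True
      then have "lookup w (plane_mon d j) = 0" if "k \<le> j" for j
        using Suc.prems(2)[of j] that by (cases "j = k") auto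
      then show ?thesis using Suc.IH Suc.prems(1) by blast
    next
      case False
      have k: "k \<in> E" unfolding E_def using False Suc.prems by auto
      define c where "c = lookup w (plane_mon d k) / lookup (y k) (plane_mon d k)"
      have "w - pscale c (y k) \<in> W"
        using W Suc.prems(1) y[OF k] by (intro pv.vs.subspace_diff pv.vs.subspace_scale) auto
      moreover have "lookup (w - pscale c (y k)) (plane_mon d j) = 0" if "k \<le> j" for j
        using that y[OF k] Suc.prems(2)[of j] by (cases "j = k") (auto simp: lookup_minus c_def)
      ultimately have "w - pscale c (y k) \<in> pv.vs.span (y ` E)" by (rule Suc.IH)
      moreover have "pscale c (y k) \<in> pv.vs.span (y ` E)"
        using k by (intro pv.vs.span_scale pv.vs.span_base) auto
      ultimately have "(w - pscale c (y k)) + pscale c (y k) \<in> pv.vs.span (y ` E)" by (rule pv.vs.span_add)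
      then show ?thesis by simp
    qed
  qed
  have "W \<subseteq> pv.vs.span (y ` E)"
  proof
    fix w assume w: "w \<in> W"
    have "lookup w (plane_mon d j) = 0" if "Suc d \<le> j" for j
    proof (rule ccontr)
      assume "lookup w (plane_mon d j) \<noteq> 0"
      then have "plane_mon d j \<in> plane_mons d (Suc d)" using supp w by blast
      then show False using that by (auto simp: plane_mons_image)
    qed
    then show "w \<in> pv.vs.span (y ` E)" using span[OF w] by blast
  qed
  then have "pv.vs.dim W \<le> card (y ` E)" using finE by (intro pv.vs.dim_le_card) auto
  also have "\<dots> \<le> card E" using finE by (rule card_image_le)
  finally obtain A where A: "A \<subseteq> E" "card A = n" "finite A"
    using n obtain_subset_with_card_n by (metis le_trans)
  obtain e where e: "bij_betw e {..<n} A"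
    using A by (metis ex_bij_betw_nat_finite atLeast0LessThan)
  have eE: "e i \<in> E" if "i < n" for i using bij_betw_apply[OF e] that A by blast
  show ?thesis
    by (rule that[of e "\<lambda>i. y (e i)"]) (use e eE Ed y in \<open>auto simp: bij_betw_def\<close>)
qed

text \<open>The substitution $x_1 \mapsto s x_1$, $x_2 \mapsto x_1 + x_2$. Up to a power of $s$ it sends a binary
  form of degree $e$ in $x_2$ to a family that tends to a multiple of $x_1^{d-e} (x_1+x_2)^e$ as $s$ goes
  to 0.\<close>

definition shear :: "'a::field \<Rightarrow> 'a ^ 3 ^ 3" where
  "shear s = (\<chi> i j. if i = 1 \<and> j = 1 then s else if i = 1 \<and> j = 2 \<or> i = j then 1 else 0)"

lemma act_shear_xvar:
  "act (shear s) (xvar 1) = pscale s (xvar 1)"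
  "act (shear s) (xvar 2) = xvar 2 + xvar 1"
  "act (shear s) (xvar 3) = xvar 3"
  by (simp_all add: act_xvar linear_form_def shear_def sum_3 pscale_def)

lemma pscale_power: "pscale c p ^ n = pscale (c ^ n) (p ^ n)"
  by (induction n) (simp_all add: pscale_def pconst_mult mult_ac)

lemma act_shear_plane_mon:
  "act (shear s) (monom (plane_mon d j)) = pscale (s ^ (d - j)) (xvar 1 ^ (d - j) * (xvar 2 + xvar 1) ^ j)"
  by (simp add: plane_mon_def monom_add xvar_power[symmetric] act_mult act_power act_shear_xvar pscale_power)
     (simp add: pscale_def mult.assoc)

lemma lookup_xvar_mult:
  "lookup (xvar i * p :: 'a::comm_ring_1 poly3) (single i 1 + T) = lookup p T"
  unfolding xvar_def Defs.monom_def by (simp only: lookup_single_times_add mult_1_left)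

lemma lookup_xvar_mult_eq_0:
  assumes "lookup T i = 0"
  shows "lookup (xvar i * p :: 'a::comm_ring_1 poly3) T = 0"
  unfolding xvar_def Defs.monom_def
proof (rule lookup_single_times_eq_0)
  fix S show "T \<noteq> single i 1 + S" using assms by (auto simp: lookup_add)
qed

lemma restr_xvar_mult:
  assumes "\<And>T. T \<in> B \<Longrightarrow> lookup T i = 0"
  shows "restr B (xvar i * p :: 'a::comm_ring_1 poly3) = 0"
  by (rule poly_mapping_eqI) (simp add: lookup_restr lookup_xvar_mult_eq_0 assms)

lemma xvar_mult_eq_0:
  assumes "xvar i * p = (0 :: 'a::comm_ring_1 poly3)"
  shows "p = 0"
  by (rule poly_mapping_eqI) (simp add: lookup_xvar_mult[of i p, symmetric] assms del: One_nat_def)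

lemma xvar_dvd:
  fixes p :: "'a::comm_ring_1 poly3"
  assumes "\<And>T. lookup T i = 0 \<Longrightarrow> lookup p T = 0"
  obtains q where "p = xvar i * q"
proof -
  have "single T (lookup p T) =
    xvar i * single (T - single i 1) (lookup p T)"
    if "T \<in> keys p" for T
  proof -
    have "lookup T i \<noteq> 0" using that assms by (auto simp: in_keys_iff)
    then have "single i 1 + (T - single i 1) = T"
      by (intro poly_mapping_eqI) (auto simp: lookup_add lookup_minus lookup_single when_def)
    then show ?thesis by (simp add: xvar_def Defs.monom_def mult_single)
  qed
  then have "p = xvar i * (\<Sum>T\<in>keys p. single (T - single i 1) (lookup p T))"
    by (subst poly_mapping_sum_singles[of p, symmetric]) (simp add: sum_distrib_left)
  then show ?thesis by (rule that)
qed

text \<open>The shear fixes $x_3$, so monomials divisible by $x_3$ stay divisible by it.\<close>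

lemma restr_act_shear:
  assumes B: "B \<subseteq> plane_mons d (Suc d)" and p: "homogeneous d p"
  shows "restr B (act (shear s) p) = restr B (act (shear s) (restr (plane_mons d (Suc d)) p))"
proof -
  let ?q = "p - restr (plane_mons d (Suc d)) p"
  have "lookup ?q T = 0" if "lookup T 3 = 0" for T
    using that p by (auto simp: lookup_minus lookup_restr plane_mons_def homogeneous_iff mdeg_alt)
  then obtain r where r: "?q = xvar 3 * r" using xvar_dvd[of 3 ?q] by metis
  have "p = restr (plane_mons d (Suc d)) p + xvar 3 * r" using r by (simp add: algebra_simps)
  then have "restr B (act (shear s) p) =
     restr B (act (shear s) (restr (plane_mons d (Suc d)) p)) + restr B (xvar 3 * act (shear s) r)"
    by (metis act_add act_mult act_shear_xvar(3) restr_add)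
  moreover have "restr B (xvar 3 * act (shear s) r) = 0"
    by (rule restr_xvar_mult) (use B in \<open>auto simp: plane_mons_def\<close>)
  ultimately show ?thesis by simp
qed

lemma plane_supported_sum:
  fixes w :: "'a::field poly3"
  assumes supp: "\<And>T. lookup w T \<noteq> 0 \<Longrightarrow> T \<in> plane_mons d (Suc d)"
    and e: "e \<le> d" "\<And>j. e < j \<Longrightarrow> lookup w (plane_mon d j) = 0"
  shows "w = (\<Sum>j\<le>e. pscale (lookup w (plane_mon d j)) (monom (plane_mon d j)))"
proof (rule poly_mapping_eqI)
  fix T
  show "lookup w T =
    lookup (\<Sum>j\<le>e. pscale (lookup w (plane_mon d j)) (monom (plane_mon d j))) T"
  proof (cases "\<exists>j. T = plane_mon d j")
    case True
    then show ?thesis using e(2)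
      by (auto simp: lookup_sum Defs.monom_def lookup_single when_def if_distrib not_le cong: if_cong)
  next
    case False
    then have "lookup w T = 0" using supp plane_monsD by blast
    moreover have "plane_mon d j \<noteq> T" for j using False by blast
    ultimately show ?thesis by (simp add: lookup_sum Defs.monom_def lookup_single when_def)
  qed
qed

lemma restr_sum: "restr B (sum f K) = (\<Sum>k\<in>K. restr B (f k :: 'a::comm_ring_1 poly3))"
  by (induction K rule: infinite_finite_induct) (auto simp: restr_add)

lemma restr_pscale: "restr B (pscale c p) = pscale c (restr B p)"
  by (rule poly_mapping_eqI) (simp add: lookup_restr)

text \<open>Take elements with distinct $x_2$-degrees $e_i$. After rescaling, their images under \<open>shear s\<close> tend
  for $s \to 0$ to multiples of $x_1^{d-e_i} (x_1+x_2)^{e_i}$, whose coefficients are the binomials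
  $\binom{e_i}{j}$. These limits are independent on the first \<open>n\<close> coordinates, and independence is an
  open condition, so it holds for some $s \ne 0$, where the rescaling can be undone.\<close>

lemma rk_plane_mons_shear:
  fixes I :: "'a::field_char_0 poly3 set"
  assumes I: "ideal.subspace I" and n: "n \<le> rk I g d (plane_mons d (Suc d))"
  shows "\<exists>h. n \<le> rk I h d (plane_mons d n)"
proof -
  let ?P = "plane_mons d (Suc d)"
  let ?m = "\<lambda>j. xvar 1 ^ (d - j) * (xvar 2 + xvar 1) ^ j :: 'a poly3"
  let ?W = "restr ?P ` act g ` degree_part I d"
  interpret r: Vector_Spaces.linear pscale pscale "restr ?P :: 'a poly3 \<Rightarrow> _" by (rule linear_restr)
  interpret a: Vector_Spaces.linear pscale pscale "act g" by (rule linear_act)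
  have W: "pv.vs.subspace ?W" by (intro r.subspace_image a.subspace_image subspace_degree_part I)
  have supp: "T \<in> ?P" if "w \<in> ?W" "lookup w T \<noteq> 0" for w T
    using that coordinate_image_degree[of w ?P g I d T] by blast
  have "\<exists>e w. inj_on e {..<n} \<and> (\<forall>i<n. e i \<le> d \<and> w i \<in> ?W \<and> lookup (w i) (plane_mon d (e i)) \<noteq> 0 \<and>
     (\<forall>j>e i. lookup (w i) (plane_mon d j) = 0))"
    by (rule exists_distinct_orders[OF W supp n[unfolded rk_def]]) blast+
  then obtain e w where e: "inj_on e {..<n}" "\<And>i. i < n \<Longrightarrow> e i \<le> d"
    and w: "\<And>i. i < n \<Longrightarrow> w i \<in> ?W"
    "\<And>i. i < n \<Longrightarrow> lookup (w i) (plane_mon d (e i)) \<noteq> 0"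
    "\<And>i j. i < n \<Longrightarrow> e i < j \<Longrightarrow> lookup (w i) (plane_mon d j) = 0"
    by blast
  have "\<forall>i<n. \<exists>f. f \<in> degree_part I d \<and> w i = restr ?P (act g f)" using w(1) by blast
  then obtain f where f: "\<And>i. i < n \<Longrightarrow> f i \<in> degree_part I d \<and> w i = restr ?P (act g (f i))" by metis
  have nd: "n \<le> Suc d"
    using n rk_le_card[of ?P I g d] card_plane_mons[of "Suc d" d] by simp
  define a where "a = (\<lambda>i j. lookup (w i) (plane_mon d j))"
  define B where "B = plane_mons d n"
  have B: "B \<subseteq> ?P" unfolding B_def plane_mons_def using nd by auto
  \<comment> \<open>The rescaled images; the parameter space is a line, with $s$ as its only coordinate.\<close>
  define v where "v = (\<lambda>i (x :: unit \<Rightarrow> 'a). restr B (\<Sum>j\<le>e i. pscale (a i j * x () ^ (e i - j)) (?m j)))"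
  have scaled: "restr B (act (shear s ** g) (f i)) = pscale (s ^ (d - e i)) (v i (\<lambda>_. s))" if i: "i < n" for i s
  proof -
    have "homogeneous d (act g (f i))" using f[OF i] by (auto simp: degree_part_def homogeneous_act)
    then have "restr B (act (shear s) (act g (f i))) = restr B (act (shear s) (w i))"
      using restr_act_shear[OF B] f[OF i] by simp
    also have "w i = (\<Sum>j\<le>e i. pscale (a i j) (monom (plane_mon d j)))"
      unfolding a_def using supp[OF w(1)[OF i]] e(2)[OF i] w(3)[OF i] by (intro plane_supported_sum)
    also have "act (shear s) \<dots> = (\<Sum>j\<le>e i. pscale (a i j) (pscale (s ^ (d - j)) (?m j)))"
      by (simp only: act_sum act_pscale act_shear_plane_mon)
    also have "\<dots> = (\<Sum>j\<le>e i. pscale (s ^ (d - e i)) (pscale (a i j * s ^ (e i - j)) (?m j)))"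
    proof (rule sum.cong)
      fix j assume "j \<in> {..e i}"
      then have "s ^ (d - j) = s ^ (d - e i) * s ^ (e i - j)" using e(2)[OF i] by (simp add: power_add[symmetric])
      then show "pscale (a i j) (pscale (s ^ (d - j)) (?m j)) =
        pscale (s ^ (d - e i)) (pscale (a i j * s ^ (e i - j)) (?m j))"
        by (simp add: mult_ac)
    qed simp
    finally show ?thesis by (simp only: act_compose v_def pv.vs.scale_sum_right[symmetric] restr_pscale)
  qed
  have "polyfun (\<lambda>x. lookup (v i x) T)" for i T
  proof -
    have "polyfun (\<lambda>x. lookup (\<Sum>j\<le>e i. pscale (a i j * x () ^ (e i - j)) (?m j)) T)"
      unfolding lookup_sum lookup_pscale by (intro polyfun_sum polyfun_mult polyfun_const polyfun_power polyfun_coord)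
    then show ?thesis by (cases "T \<in> B") (simp_all add: v_def lookup_restr polyfun_const)
  qed
  moreover have "pv.indep_family n (\<lambda>i. v i (\<lambda>_. 0))" unfolding pv.indep_family_def
  proof (intro allI impI)
    fix c i assume s: "(\<Sum>i<n. pscale (c i) (v i (\<lambda>_. 0))) = 0" and i: "i < n"
    have v0: "v i (\<lambda>_. 0) = restr B (pscale (a i (e i)) (?m (e i)))" for i
    proof -
      have "(\<Sum>j\<le>e i. pscale (a i j * 0 ^ (e i - j)) (?m j)) =
        (\<Sum>j\<in>{e i}. pscale (a i j * 0 ^ (e i - j)) (?m j))"
        by (rule sum.mono_neutral_right) (auto simp: power_0_left)
      then show ?thesis by (simp add: v_def)
    qed
    have "(\<Sum>i<n. c i * a i (e i) * of_nat (e i choose j)) = 0" if j: "j < n" for j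
    proof -
      have jd: "j \<le> d" using j nd by simp
      have "lookup (\<Sum>i<n. pscale (c i) (v i (\<lambda>_. 0))) (plane_mon d j) = 0" using s by simp
      moreover have "plane_mon d j \<in> B" unfolding B_def using jd j by (simp add: plane_mon_mem)
      ultimately have "(\<Sum>i<n. c i * (a i (e i) * lookup (?m (e i)) (plane_mon d j))) = 0"
        by (simp add: v0 lookup_sum lookup_restr)
      moreover have "(\<Sum>i<n. c i * (a i (e i) * lookup (?m (e i)) (plane_mon d j)))
        = (\<Sum>i<n. c i * a i (e i) * of_nat (e i choose j))"
        by (rule sum.cong) (use lookup_sheared_power e(2) jd in auto)
      ultimately show ?thesis by simp
    qed
    then have "c i * a i (e i) = 0" using binomials_independent[OF e(1), of "\<lambda>i. c i * a i (e i)"] i by blast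
    then show "c i = 0" using w(2)[OF i] by (simp add: a_def)
  qed
  ultimately obtain F where F: "polyfun F" "F (\<lambda>_. 0) \<noteq> 0" "\<And>x. F x \<noteq> 0 \<Longrightarrow> pv.indep_family n (\<lambda>i. v i x)"
    using indep_family_zariski_open[of n v "\<lambda>_. 0"] by blast
  obtain x where x: "F x \<noteq> 0" "x () \<noteq> 0"
    using polyfun_common_nonzero[OF F(1) polyfun_coord[of "()"] F(2), of "\<lambda>_. 1"] by auto
  define s where "s = x ()"
  have xs: "x = (\<lambda>_. s)" by (auto simp: s_def)
  have "pv.indep_family n (\<lambda>i. pscale (s ^ (d - e i)) (v i (\<lambda>_. s)))" unfolding pv.indep_family_def
  proof (intro allI impI)
    fix c i assume z: "(\<Sum>i<n. pscale (c i) (pscale (s ^ (d - e i)) (v i (\<lambda>_. s)))) = 0" and i: "i < n"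
    have "(\<Sum>i<n. pscale (c i * s ^ (d - e i)) (v i (\<lambda>_. s))) = 0" using z by simp
    then have "c i * s ^ (d - e i) = 0"
      using F(3)[OF x(1)] i unfolding xs pv.indep_family_def by (elim allE[of _ "\<lambda>i. c i * s ^ (d - e i)"]) simp
    then show "c i = 0" using x(2) by (simp add: s_def)
  qed
  then have "n \<le> rk I (shear s ** g) d B" unfolding rk_def
    by (rule pv.indep_family_card_le_dim[OF _ _ findim_coordinate_image])
       (use f scaled[symmetric] in auto)
  then show ?thesis unfolding B_def by blast
qed

lemma rk_mono:
  assumes "ideal.subspace I" "B \<subseteq> C"
  shows "rk I g d B \<le> rk I g d C"
proof -
  interpret r: Vector_Spaces.linear pscale pscale "restr C :: 'a poly3 \<Rightarrow> _" by (rule linear_restr)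
  interpret a: Vector_Spaces.linear pscale pscale "act g" by (rule linear_act)
  have W: "pv.vs.subspace (restr C ` act g ` degree_part I d)"
    by (intro r.subspace_image a.subspace_image subspace_degree_part assms)
  have "restr B ` restr C ` act g ` degree_part I d = restr B ` act g ` degree_part I d"
    using assms(2) by (simp add: image_image restr_restr Int_absorb2)
  then show ?thesis
    using pvp.rank_nullity[OF linear_restr[of B] W findim_coordinate_image] by (simp add: rk_def)
qed

definition plane_rank :: "'a::field poly3 set \<Rightarrow> nat \<Rightarrow> nat" where
  "plane_rank I d = generic_rk I d (plane_mons d (Suc d))"

lemma plane_rank_le: "plane_rank I d \<le> Suc d"
  using generic_rk_attained[of I d "plane_mons d (Suc d)"] rk_le_card[of "plane_mons d (Suc d)" I _ d]
    card_plane_mons[of "Suc d" d] unfolding plane_rank_def by (metis finite_plane_mons order_refl)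

text \<open>The bounds by \<open>b\<close> and by the rank on all plane monomials are obvious; the preceding degeneration
  shows that they are attained.\<close>

lemma generic_rk_plane_mons:
  fixes I :: "'a::field_char_0 poly3 set"
  assumes I: "ideal.subspace I" and b: "b \<le> Suc d"
  shows "generic_rk I d (plane_mons d b) = min b (plane_rank I d)"
proof (rule antisym)
  obtain g where g: "rk I g d (plane_mons d b) = generic_rk I d (plane_mons d b)" using generic_rk_attained by blast
  have "rk I g d (plane_mons d b) \<le> b" using rk_le_card[of "plane_mons d b" I g d] card_plane_mons[OF b] by simp
  moreover have "rk I g d (plane_mons d b) \<le> rk I g d (plane_mons d (Suc d))"
    using b by (intro rk_mono I) (auto simp: plane_mons_def)
  moreover have "\<dots> \<le> plane_rank I d" unfolding plane_rank_def by (rule rk_le_generic)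
  ultimately show "generic_rk I d (plane_mons d b) \<le> min b (plane_rank I d)" using g by simp
next
  obtain g where g: "rk I g d (plane_mons d (Suc d)) = plane_rank I d"
    using generic_rk_attained[of I d "plane_mons d (Suc d)"] unfolding plane_rank_def by blast
  obtain h where h: "min b (plane_rank I d) \<le> rk I h d (plane_mons d (min b (plane_rank I d)))"
    using rk_plane_mons_shear[OF I, of "min b (plane_rank I d)" g d] g by auto
  also have "\<dots> \<le> rk I h d (plane_mons d b)" by (intro rk_mono I) (auto simp: plane_mons_def)
  also have "\<dots> \<le> generic_rk I d (plane_mons d b)" by (rule rk_le_generic)
  finally show "min b (plane_rank I d) \<le> generic_rk I d (plane_mons d b)" .
qed

text \<open>With \<open>m\<close> the plane rank, initial segments of length \<open>b\<close> have rank \<open>min b m\<close>, so the first \<open>m\<close>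
  steps are the jumps.\<close>

lemma plane_mon_in_gin_iff:
  fixes I :: "'a::field_char_0 poly3 set"
  assumes I: "homogeneous_artinian_ideal I" and j: "j \<le> d"
  shows "plane_mon d j \<in> gin_monomials I \<longleftrightarrow> j < plane_rank I d"
proof -
  have "ideal.subspace I" using I by (simp add: homogeneous_artinian_ideal_def homogeneous_ideal_subspace)
  then show ?thesis
    using gin_monomials_iff_rank[OF I, of "plane_mon d j", unfolded above_plane_mon(2)[OF j], unfolded above_plane_mon(1)[OF j]] j
    by (simp add: generic_rk_plane_mons) (auto simp: min_def)
qed

definition hilb :: "'a::field poly3 set \<Rightarrow> nat \<Rightarrow> nat" where
  "hilb K d = pv.vs.dim (degree_part K d)"

section \<open>The Koszul complex\<close>

lemma xvar_mult_cancel: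
  assumes "xvar i * p = xvar i * (q :: 'a::comm_ring_1 poly3)"
  shows "p = q"
proof -
  have "xvar i * (p - q) = 0" using assms by (simp add: right_diff_distrib)
  then show ?thesis using xvar_mult_eq_0 by fastforce
qed

text \<open>The variable $x_i$ divides $x_j q$, and as $i \ne j$ each monomial of $q$ already contains it.\<close>

lemma xvar_mult_eq_xvar_mult:
  fixes p q :: "'a::comm_ring_1 poly3"
  assumes e: "xvar i * p = xvar j * q" and ij: "i \<noteq> j"
  obtains r where "p = xvar j * r" "q = xvar i * r"
proof -
  have "lookup q T = 0" if T: "lookup T i = 0" for T
  proof -
    have "lookup q T = lookup (xvar i * p) (single j 1 + T)"
      unfolding e by (rule lookup_xvar_mult[symmetric])
    also have "\<dots> = 0"
      by (rule lookup_xvar_mult_eq_0) (use T ij in \<open>simp add: lookup_add lookup_single when_def\<close>)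
    finally show ?thesis .
  qed
  then obtain r where r: "q = xvar i * r" using xvar_dvd[of i q] by metis
  then have "xvar i * p = xvar i * (xvar j * r)" using e by (simp add: mult_ac)
  then have "p = xvar j * r" by (rule xvar_mult_cancel)
  then show ?thesis using r by (rule that)
qed

lemma xvar_division:
  fixes p :: "'a::comm_ring_1 poly3"
  obtains a where "p = xvar i * a + restr {T. lookup T i = 0} p"
proof -
  let ?r = "restr {T. lookup T i = 0} p"
  have "lookup (p - ?r) T = 0" if "lookup T i = 0" for T
    using that by (simp add: lookup_minus lookup_restr)
  then obtain a where "p - ?r = xvar i * a" using xvar_dvd[of i "p - ?r"] by metis
  then have "p = xvar i * a + ?r" by (simp add: algebra_simps)
  then show ?thesis by (rule that)
qed

lemma restr_xvar_mult_free:
  assumes "i \<noteq> j"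
  shows "restr {T. lookup T i = 0} (xvar j * p :: 'a::comm_ring_1 poly3) =
    xvar j * restr {T. lookup T i = 0} p"
proof (rule poly_mapping_eqI)
  fix T :: mon
  show "lookup (restr {T. lookup T i = 0} (xvar j * p)) T =
    lookup (xvar j * restr {T. lookup T i = 0} p) T"
  proof (cases "lookup T j = 0")
    case True
    then show ?thesis by (simp add: lookup_restr lookup_xvar_mult_eq_0)
  next
    case False
    define S where "S = T - single j 1"
    have T: "T = single j 1 + S" unfolding S_def using False
      by (intro poly_mapping_eqI) (auto simp: lookup_add lookup_minus lookup_single when_def)
    have "lookup T i = lookup S i"
      using assms by (simp add: T lookup_add lookup_single when_def)
    then show ?thesis unfolding T lookup_restr lookup_xvar_mult by (simp add: T[symmetric])
  qed
qed

text \<open>Reducing modulo $x_3$ leaves a relation between $x_1$ and $x_2$ alone, which is a multiple of the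
  trivial one; dividing the difference by $x_3$ expresses the third entry.\<close>

lemma koszul_syzygy:
  fixes p q :: "'a::comm_ring_1 poly3"
  assumes e: "xvar 1 * p + xvar 2 * q + xvar 3 * r = 0"
  obtains a b c where "p = xvar 2 * c - xvar 3 * b" "q = xvar 3 * a - xvar 1 * c" "r = xvar 1 * b - xvar 2 * a"
proof -
  let ?R = "restr {T. lookup T 3 = 0}"
  obtain a0 where a0: "p = xvar 3 * a0 + ?R p" by (rule xvar_division)
  obtain a1 where a1: "q = xvar 3 * a1 + ?R q" by (rule xvar_division)
  have R3: "?R (xvar 3 * r) = 0" by (rule restr_xvar_mult[of _ 3]) simp
  have "?R (xvar 1 * p + xvar 2 * q + xvar 3 * r) = xvar 1 * ?R p + xvar 2 * ?R q"
    by (simp add: restr_add restr_xvar_mult_free R3)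
  then have z: "xvar 1 * ?R p + xvar 2 * ?R q = 0" using e by simp
  then have "xvar 1 * ?R p = xvar 2 * (- ?R q)" by (simp add: eq_neg_iff_add_eq_0)
  then obtain c where c: "?R p = xvar 2 * c" "- ?R q = xvar 1 * c"
    by (rule xvar_mult_eq_xvar_mult) simp
  have "xvar 3 * (xvar 1 * a0 + xvar 2 * a1 + r) = xvar 1 * (xvar 3 * a0 + ?R p) + xvar 2 * (xvar 3 * a1 + ?R q) + xvar 3 * r - (xvar 1 * ?R p + xvar 2 * ?R q)"
    by (simp add: algebra_simps)
  also have "\<dots> = 0" using a0 a1 e z by simp
  finally have "xvar 1 * a0 + xvar 2 * a1 + r = 0" by (rule xvar_mult_eq_0)
  then have r: "r = xvar 1 * (- a0) - xvar 2 * a1" by (simp add: algebra_simps eq_neg_iff_add_eq_0)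
  have q: "?R q = - (xvar 1 * c)" using c(2) by (metis minus_minus)
  show ?thesis
    by (rule that[of c "- a0" a1]) (use a0 a1 c(1) q r in \<open>simp_all add: algebra_simps\<close>)
qed

text \<open>With the basis of the second module ordered so that the second differential is the cross product with
  $(x_1,x_2,x_3)$, the three differentials are the algebraic divergence, curl and gradient.\<close>

definition koszul :: "'a::comm_ring_1 free_complex" where
  "koszul = \<lparr> free_rank = (\<lambda>q. if q = 0 then 1 else if q = 1 then 3 else if q = 2 then 3 else if q = 3 then 1 else 0),
     gdeg = (\<lambda>q a. q),
     bdry = (\<lambda>q a b. if q = 0 then xvar (of_nat (Suc b))
        else if q = 1 then
          (if (a, b) = (0, 2) then xvar 2 else if (a, b) = (0, 1) then - xvar 3
           else if (a, b) = (1, 0) then xvar 3 else if (a, b) = (1, 2) then - xvar 1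
           else if (a, b) = (2, 1) then xvar 1 else if (a, b) = (2, 0) then - xvar 2 else 0)
        else if q = 2 then xvar (of_nat (Suc a)) else 0),
     aug = (\<lambda>a. 1) \<rparr>"

lemma lookup_bdry_map:
  "lookup (bdry_map P q f) a =
    (if a < free_rank P q then \<Sum>b<free_rank P (Suc q). bdry P q a b * lookup f b else 0)"
proof -
  have "lookup (bdry_map P q f) a =
    (\<Sum>c<free_rank P q. if c = a then \<Sum>b<free_rank P (Suc q). bdry P q a b * lookup f b else 0)"
    unfolding bdry_map_def lookup_sum by (rule sum.cong) (auto simp: lookup_single when_def)
  then show ?thesis by simp
qed

lemma lessThan_3: "{..<3::nat} = {0, 1, 2}"
  by auto

definition vec3 :: "'a::comm_ring_1 poly3 \<Rightarrow> 'a poly3 \<Rightarrow> 'a poly3 \<Rightarrow> (nat \<Rightarrow>\<^sub>0 'a poly3)" where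
  "vec3 p q r = single 0 p + single 1 q + single 2 r"

lemma lookup_vec3 [simp]:
  "lookup (vec3 p q r) 0 = p" "lookup (vec3 p q r) 1 = q"
  "lookup (vec3 p q r) (Suc 0) = q" "lookup (vec3 p q r) 2 = r"
  "2 < n \<Longrightarrow> lookup (vec3 p q r) n = 0"
  by (simp_all add: vec3_def lookup_add lookup_single when_def)

lemma free_mod_iff: "f \<in> free_mod P q \<longleftrightarrow> (\<forall>a\<ge>free_rank P q. lookup f a = 0)"
  by (auto simp: free_mod_def in_keys_iff not_less[symmetric] subset_iff)

lemma koszul_free_mod:
  "f \<in> free_mod (koszul :: 'a::comm_ring_1 free_complex) 0 \<longleftrightarrow> (\<forall>a\<ge>1. lookup f a = 0)"
  "f \<in> free_mod (koszul :: 'a::comm_ring_1 free_complex) (Suc 0) \<longleftrightarrow> (\<forall>a\<ge>3. lookup f a = 0)"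
  "f \<in> free_mod (koszul :: 'a::comm_ring_1 free_complex) 2 \<longleftrightarrow> (\<forall>a\<ge>3. lookup f a = 0)"
  "f \<in> free_mod (koszul :: 'a::comm_ring_1 free_complex) 3 \<longleftrightarrow> (\<forall>a\<ge>1. lookup f a = 0)"
  "3 < q \<Longrightarrow> f \<in> free_mod (koszul :: 'a::comm_ring_1 free_complex) q \<longleftrightarrow> f = 0"
  by (auto simp: free_mod_iff koszul_def intro: poly_mapping_eqI)

lemma koszul_bdry0:
  "bdry_map (koszul :: 'a::comm_ring_1 free_complex) 0 f = single 0
    (xvar 1 * lookup f 0 + xvar 2 * lookup f 1 + xvar 3 * lookup f 2)"
  by (rule poly_mapping_eqI) (auto simp: lookup_bdry_map koszul_def lookup_single when_def lessThan_3 add.assoc)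

lemma koszul_bdry1:
  "bdry_map (koszul :: 'a::comm_ring_1 free_complex) (Suc 0) f = vec3
    (xvar 2 * lookup f 2 - xvar 3 * lookup f 1)
    (xvar 3 * lookup f 0 - xvar 1 * lookup f 2)
    (xvar 1 * lookup f 1 - xvar 2 * lookup f 0)" (is "?l = ?r")
proof (rule poly_mapping_eqI)
  fix a :: nat
  consider "a = 0" | "a = 1" | "a = 2" | "a > 2" by linarith
  then show "lookup ?l a = lookup ?r a"
    by cases (simp_all add: lookup_bdry_map koszul_def lessThan_3)
qed

lemma koszul_bdry2:
  "bdry_map (koszul :: 'a::comm_ring_1 free_complex) 2 f = vec3
    (xvar 1 * lookup f 0) (xvar 2 * lookup f 0) (xvar 3 * lookup f 0)" (is "?l = ?r")
proof (rule poly_mapping_eqI)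
  fix a :: nat
  consider "a = 0" | "a = 1" | "a = 2" | "a > 2" by linarith
  then show "lookup ?l a = lookup ?r a"
    by cases (simp_all add: lookup_bdry_map koszul_def)
qed

lemma koszul_bdry_high: "2 < q \<Longrightarrow> bdry_map (koszul :: 'a::comm_ring_1 free_complex) q f = 0"
  by (rule poly_mapping_eqI) (auto simp: lookup_bdry_map koszul_def)

lemma free_mod3_eq_vec3:
  assumes "\<forall>a\<ge>3. lookup f a = 0"
  shows "f = vec3 (lookup f 0) (lookup f 1) (lookup f 2)"
proof (rule poly_mapping_eqI)
  fix a :: nat
  consider "a = 0" | "a = 1" | "a = 2" | "a > 2" by linarith
  then show "lookup f a = lookup (vec3 (lookup f 0) (lookup f 1) (lookup f 2)) a"
    by cases (use assms in simp_all)
qed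

lemma vec3_eq_0: "vec3 p q r = 0 \<longleftrightarrow> p = 0 \<and> q = 0 \<and> r = 0"
  by (metis lookup_vec3(1,2,4) lookup_zero free_mod3_eq_vec3 poly_mapping_eqI vec3_def single_zero add_0)

lemma constant_term_0_decomp:
  fixes p :: "'a::comm_ring_1 poly3"
  assumes "lookup p 0 = 0"
  obtains a b c where "p = xvar 1 * a + xvar 2 * b + xvar 3 * c"
proof -
  let ?R = "\<lambda>i. restr {T. lookup T i = 0}"
  obtain c where c: "p = xvar 3 * c + ?R 3 p" by (rule xvar_division)
  obtain b where b: "?R 3 p = xvar 2 * b + ?R 2 (?R 3 p)" by (rule xvar_division)
  obtain a where a: "?R 2 (?R 3 p) = xvar 1 * a + ?R 1 (?R 2 (?R 3 p))" by (rule xvar_division)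
  have "?R 1 (?R 2 (?R 3 p)) = 0"
  proof (rule poly_mapping_eqI)
    fix T :: mon
    have "T = 0" if "lookup T 1 = 0" "lookup T 2 = 0" "lookup T 3 = 0"
      using that by (intro mon_eqI) simp_all
    then show "lookup (?R 1 (?R 2 (?R 3 p))) T = lookup 0 T"
      using assms by (auto simp: lookup_restr)
  qed
  then have "p = xvar 1 * a + xvar 2 * b + xvar 3 * c" using a b c by (simp add: algebra_simps)
  then show ?thesis by (rule that)
qed

lemma keys_pm_xvar: "T \<in> keys (xvar i :: 'a::comm_ring_1 poly3) \<Longrightarrow> mdeg T = 1"
  "T \<in> keys (- xvar i :: 'a::comm_ring_1 poly3) \<Longrightarrow> mdeg T = 1"
  by (auto simp: in_keys_iff xvar_def Defs.monom_def lookup_single when_def split: if_splits)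

text \<open>Exactness comes down to divisibility by variables: constant terms in position 0, the syzygies of the
  three variables in position 1, a common quotient by the variables in position 2, and cancellation of a
  variable in position 3.\<close>

lemma koszul_resolves_k: "resolves_k (koszul :: 'a::comm_ring_1 free_complex)"
proof -
  let ?K = "koszul :: 'a free_complex"
  have aug: "aug_map ?K f = lookup (lookup f 0) 0" for f
    by (simp add: aug_map_def koszul_def)
  have deg: "mdeg T + gdeg ?K q a = gdeg ?K (Suc q) b"
    if "T \<in> keys (bdry ?K q a b)" for q a b T
    using that keys_pm_xvar[of T] by (auto simp: koszul_def split: if_splits)
  have surj: "aug_map ?K ` free_mod ?K 0 = UNIV"
  proof -
    have "c \<in> aug_map ?K ` free_mod ?K 0" for c
      by (rule image_eqI[of _ _ "single 0 (pconst c)"])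
         (simp_all add: aug koszul_free_mod pconst_def lookup_single when_def)
    then show ?thesis by blast
  qed
  have exact0: "{f \<in> free_mod ?K 0. aug_map ?K f = 0} = bdry_map ?K 0 ` free_mod ?K 1"
  proof (intro equalityI subsetI)
    fix f assume f: "f \<in> {f \<in> free_mod ?K 0. aug_map ?K f = 0}"
    then have "lookup (lookup f 0) 0 = 0" by (simp add: aug)
    then obtain a b c where "lookup f 0 = xvar 1 * a + xvar 2 * b + xvar 3 * c"
      using constant_term_0_decomp by blast
    then have "f = bdry_map ?K 0 (vec3 a b c)" using f
      unfolding koszul_bdry0 by (intro poly_mapping_eqI) (auto simp: koszul_free_mod lookup_single when_def)
    moreover have "vec3 a b c \<in> free_mod ?K 1" by (simp add: koszul_free_mod)
    ultimately show "f \<in> bdry_map ?K 0 ` free_mod ?K 1" by blast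
  next
    fix f assume "f \<in> bdry_map ?K 0 ` free_mod ?K 1"
    then show "f \<in> {f \<in> free_mod ?K 0. aug_map ?K f = 0}"
      by (auto simp: koszul_bdry0 koszul_free_mod aug lookup_add lookup_single lookup_xvar_mult_eq_0)
  qed
  have exact: "{f \<in> free_mod ?K (Suc q). bdry_map ?K q f = 0} = bdry_map ?K (Suc q) ` free_mod ?K (Suc (Suc q))" for q
  proof -
    consider "q = 0" | "q = 1" | "q = 2" | "q > 2" by linarith
    then show ?thesis
    proof cases
      case 1
      have "f \<in> bdry_map ?K (Suc 0) ` free_mod ?K 2" if f: "f \<in> free_mod ?K (Suc 0)" "bdry_map ?K 0 f = 0" for f
      proof -
        have "xvar 1 * lookup f 0 + xvar 2 * lookup f 1 + xvar 3 * lookup f 2 = 0"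
          using f(2) unfolding koszul_bdry0 by (metis lookup_single_eq lookup_zero)
        then obtain a b c where abc: "lookup f 0 = xvar 2 * c - xvar 3 * b"
          "lookup f 1 = xvar 3 * a - xvar 1 * c" "lookup f 2 = xvar 1 * b - xvar 2 * a"
          by (rule koszul_syzygy)
        have "f = vec3 (lookup f 0) (lookup f 1) (lookup f 2)"
          using f(1) by (intro free_mod3_eq_vec3) (simp add: koszul_free_mod)
        then have "f = bdry_map ?K (Suc 0) (vec3 a b c)" unfolding koszul_bdry1 abc by simp
        moreover have "vec3 a b c \<in> free_mod ?K 2" by (simp add: koszul_free_mod)
        ultimately show ?thesis by blast
      qed
      moreover have "bdry_map ?K (Suc 0) f \<in> free_mod ?K (Suc 0) \<and> bdry_map ?K 0 (bdry_map ?K (Suc 0) f) = 0" for f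
        by (simp add: koszul_bdry0 koszul_bdry1 koszul_free_mod algebra_simps)
      ultimately have "{f \<in> free_mod ?K (Suc 0). bdry_map ?K 0 f = 0} = bdry_map ?K (Suc 0) ` free_mod ?K 2" by blast
      then show ?thesis by (simp only: 1 numeral_2_eq_2)
    next
      case 2
      have "f \<in> bdry_map ?K 2 ` free_mod ?K 3" if f: "f \<in> free_mod ?K 2" "bdry_map ?K (Suc 0) f = 0" for f
      proof -
        have z: "xvar 2 * lookup f 2 = xvar 3 * lookup f 1"
          "xvar 3 * lookup f 0 = xvar 1 * lookup f 2"
          using f(2) unfolding koszul_bdry1 vec3_eq_0 by simp_all
        obtain r where r: "lookup f 2 = xvar 3 * r" "lookup f 1 = xvar 2 * r"
          using z(1) by (rule xvar_mult_eq_xvar_mult) simp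
        have "xvar 3 * lookup f 0 = xvar 3 * (xvar 1 * r)" using z(2) r(1) by (simp add: mult_ac)
        then have r0: "lookup f 0 = xvar 1 * r" by (rule xvar_mult_cancel)
        have "f = vec3 (lookup f 0) (lookup f 1) (lookup f 2)"
          using f(1) by (intro free_mod3_eq_vec3) (simp add: koszul_free_mod)
        then have "f = bdry_map ?K 2 (single 0 r)" unfolding koszul_bdry2 r r0 by simp
        moreover have "single 0 r \<in> free_mod ?K 3" by (simp add: koszul_free_mod lookup_single when_def)
        ultimately show ?thesis by blast
      qed
      moreover have "bdry_map ?K 2 f \<in> free_mod ?K 2 \<and> bdry_map ?K (Suc 0) (bdry_map ?K 2 f) = 0" for f
        by (simp add: koszul_bdry1 koszul_bdry2 koszul_free_mod vec3_eq_0 algebra_simps)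
      ultimately have "{f \<in> free_mod ?K 2. bdry_map ?K (Suc 0) f = 0} = bdry_map ?K 2 ` free_mod ?K 3" by blast
      then show ?thesis by (simp only: 2 One_nat_def numeral_2_eq_2 numeral_3_eq_3)
    next
      case 3
      have "f = 0" if f: "f \<in> free_mod ?K 3" "bdry_map ?K 2 f = 0" for f
      proof -
        have "xvar 1 * lookup f 0 = 0" using f(2) unfolding koszul_bdry2 vec3_eq_0 by simp
        then have "lookup f 0 = 0" by (rule xvar_mult_eq_0)
        then have "lookup f a = 0" for a using f(1) by (cases "a = 0") (simp_all add: koszul_free_mod)
        then show ?thesis by (intro poly_mapping_eqI) simp
      qed
      moreover have "0 \<in> free_mod ?K 3 \<and> bdry_map ?K 2 0 = 0"
        by (simp add: koszul_bdry2 koszul_free_mod vec3_eq_0)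
      ultimately have A: "{f \<in> free_mod ?K 3. bdry_map ?K 2 f = 0} = {0}" by blast
      have "free_mod ?K (Suc 3) = {0}" using koszul_free_mod(5)[of "Suc 3"] by auto
      then have B: "bdry_map ?K 3 ` free_mod ?K (Suc 3) = {0}" by (simp add: koszul_bdry_high)
      have s: "Suc 2 = 3" by simp
      show ?thesis unfolding 3 s by (simp only: A B)
    next
      case 4
      have "free_mod ?K r = {0}" if "q < r" for r
      proof -
        have "3 < r" using 4 that by linarith
        then show ?thesis using koszul_free_mod(5) by (intro set_eqI) (simp only: singleton_iff)
      qed
      from this[of "Suc q"] this[of "Suc (Suc q)"]
      have F: "free_mod ?K (Suc q) = {0}" "free_mod ?K (Suc (Suc q)) = {0}" by (simp_all only: lessI less_SucI)
      show ?thesis unfolding F koszul_bdry_high[OF 4] koszul_bdry_high[OF less_SucI[OF 4]] by auto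
    qed
  qed
  have "free_rank ?K q = 0" if "4 \<le> q" for q using that by (simp add: koszul_def)
  then have fin: "\<exists>n. \<forall>q\<ge>n. free_rank ?K q = 0" by blast
  have g0: "gdeg ?K 0 a = 0" for a by (simp add: koszul_def)
  show ?thesis unfolding resolves_k_def
    by (intro conjI allI impI ballI deg surj exact0 exact fin g0)
qed

section \<open>Betti numbers determine the Hilbert function\<close>

interpretation kv: vspace "kscale :: 'a::field \<Rightarrow> (nat \<Rightarrow>\<^sub>0 'a poly3) \<Rightarrow> _" ..

interpretation kvp: vspace_pair "kscale :: 'a::field \<Rightarrow> (nat \<Rightarrow>\<^sub>0 'a poly3) \<Rightarrow> _" "kscale :: 'a::field \<Rightarrow> (nat \<Rightarrow>\<^sub>0 'a poly3) \<Rightarrow> _" ..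

interpretation kpp: vspace_pair "kscale :: 'a::field \<Rightarrow> (nat \<Rightarrow>\<^sub>0 'a poly3) \<Rightarrow> _" "pscale :: 'a::field \<Rightarrow> 'a poly3 \<Rightarrow> 'a poly3" ..

lemma lookup_kscale [simp]: "lookup (kscale c f) a = pscale c (lookup f a)"
  unfolding kscale_def pscale_def by (simp add: Poly_Mapping.map.rep_eq when_def)

lemma linear_bdry_map: "Vector_Spaces.linear kscale kscale (bdry_map (P :: 'a::field free_complex) q)"
proof (unfold_locales)
  show "bdry_map P q (f + g) = bdry_map P q f + bdry_map P q g" for f g
    by (rule poly_mapping_eqI) (simp add: lookup_bdry_map lookup_add distrib_left sum.distrib)
  show "bdry_map P q (kscale c f) = kscale c (bdry_map P q f)" for c f
    by (rule poly_mapping_eqI) (simp add: lookup_bdry_map pscale_def sum_distrib_left mult_ac)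
qed

lemma linear_lookup: "Vector_Spaces.linear kscale pscale (\<lambda>f :: nat \<Rightarrow>\<^sub>0 'a::field poly3. lookup f a)"
  by unfold_locales (simp_all add: lookup_add)

text \<open>The degree $i$ part of $K(-g)$; for $g > i$ it is zero.\<close>

definition shifted_part :: "'a::field poly3 set \<Rightarrow> nat \<Rightarrow> nat \<Rightarrow> 'a poly3 set" where
  "shifted_part K g i = {p \<in> K. \<forall>T\<in>keys p. mdeg T + g = i}"

lemma shifted_part_eq:
  assumes "ideal.subspace K"
  shows "shifted_part K g i = (if g \<le> i then degree_part K (i - g) else {0})"
proof (cases "g \<le> i")
  case True
  then have "mdeg T + g = i \<longleftrightarrow> mdeg T = i - g" for T by linarith
  then show ?thesis using True by (auto simp: shifted_part_def degree_part_def homogeneous_def)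
next
  case False
  then have "mdeg T + g \<noteq> i" for T by linarith
  then show ?thesis using False ideal.subspace_0[OF assms] by (auto simp: shifted_part_def)
qed

lemma subspace_shifted_part:
  assumes "ideal.subspace K"
  shows "pv.vs.subspace (shifted_part K g i)"
  using subspace_degree_part[OF assms] by (simp add: shifted_part_eq[OF assms] pv.vs.subspace_single_0)

lemma dim_shifted_part:
  assumes "ideal.subspace K"
  shows "pv.vs.dim (shifted_part K g i) = (if g \<le> i then hilb K (i - g) else 0)"
proof -
  have "pv.vs.dim {0 :: 'a poly3} \<le> card ({} :: mon set)" by (rule findim_supported(2)) auto
  then show ?thesis by (simp add: shifted_part_eq[OF assms] hilb_def)
qed

definition shifted_sum :: "'a::field poly3 set \<Rightarrow> (nat \<Rightarrow> nat) \<Rightarrow> nat \<Rightarrow> nat \<Rightarrow> (nat \<Rightarrow>\<^sub>0 'a poly3) set" where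
  "shifted_sum K g i n = {f. (\<forall>a\<ge>n. lookup f a = 0) \<and> (\<forall>a<n. lookup f a \<in> shifted_part K (g a) i)}"

lemma tensor_part_eq: "tensor_part K P q i = shifted_sum K (gdeg P q) i (free_rank P q)"
  by (auto simp: tensor_part_def shifted_sum_def shifted_part_def free_mod_iff)

lemma subspace_shifted_sum:
  assumes "ideal.subspace K"
  shows "kspace.subspace (shifted_sum K g i n)"
  using pv.vs.subspace_0[OF subspace_shifted_part[OF assms]] pv.vs.subspace_add[OF subspace_shifted_part[OF assms]]
    pv.vs.subspace_scale[OF subspace_shifted_part[OF assms]]
  by (intro kspace.subspaceI) (auto simp: shifted_sum_def lookup_add)

lemma linear_single: "Vector_Spaces.linear pscale kscale (single a :: 'a::field poly3 \<Rightarrow> nat \<Rightarrow>\<^sub>0 'a poly3)"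
  by unfold_locales (auto simp: single_add intro!: poly_mapping_eqI simp: lookup_single when_def)

lemma findim_shifted_sum:
  fixes K :: "'a::field poly3 set"
  shows "kv.findim (shifted_sum K g i n)"
proof -
  let ?M = "monom ` {T. mdeg T \<le> i} :: 'a poly3 set"
  let ?B = "\<Union>a<n. (single a :: 'a poly3 \<Rightarrow> _) ` ?M"
  have "finite {T. mdeg T \<le> i}"
  proof -
    have "{T. mdeg T \<le> i} = (\<Union>d\<le>i. {T. mdeg T = d})" by auto
    then show ?thesis by simp
  qed
  then have fin: "finite ?B" and fM: "finite {T. mdeg T \<le> i}" by auto
  have "f \<in> kspace.span ?B" if f: "f \<in> shifted_sum K g i n" for f
  proof -
    have "single a (lookup f a) \<in> kspace.span ?B" if a: "a \<in> keys f" for a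
    proof -
      interpret s: Vector_Spaces.linear pscale kscale "single a :: 'a poly3 \<Rightarrow> nat \<Rightarrow>\<^sub>0 'a poly3" by (rule linear_single)
      have an: "a < n" using a f by (auto simp: shifted_sum_def in_keys_iff not_le[symmetric])
      then have fa: "lookup f a \<in> shifted_part K (g a) i" using f by (simp add: shifted_sum_def)
      have "mdeg T \<le> i" if "lookup (lookup f a) T \<noteq> 0" for T
      proof -
        have "mdeg T + g a = i" using that fa by (simp add: shifted_part_def in_keys_iff)
        then show ?thesis by simp
      qed
      then have "lookup f a \<in> pv.vs.span ?M"
        by (intro span_of_support[OF fM]) simp
      then have "single a (lookup f a) \<in> kspace.span (single a ` ?M)"
        using s.span_image[of ?M] by blast
      also have "\<dots> \<subseteq> kspace.span ?B" by (rule kspace.span_mono) (use an in blast)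
      finally show ?thesis .
    qed
    then have "(\<Sum>a\<in>keys f. single a (lookup f a)) \<in> kspace.span ?B"
      by (intro kspace.span_sum)
    then show ?thesis by (simp only: poly_mapping_sum_singles)
  qed
  then show ?thesis unfolding kv.findim_def using fin by blast
qed

text \<open>Projection to the last coordinate splits off one summand at a time.\<close>

lemma dim_shifted_sum:
  fixes K :: "'a::field poly3 set"
  assumes K: "ideal.subspace K"
  shows "kspace.dim (shifted_sum K g i n) = (\<Sum>a<n. if g a \<le> i then hilb K (i - g a) else 0)"
proof (induction n)
  case 0
  have "shifted_sum K g i 0 = {0}" by (auto simp: shifted_sum_def intro: poly_mapping_eqI)
  then show ?case
    using kv.dim_eq_0_iff_findim[OF findim_shifted_sum subspace_shifted_sum[OF K], of g i 0] by simp
next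
  case (Suc n)
  have ker: "{f \<in> shifted_sum K g i (Suc n). lookup f n = 0} = shifted_sum K g i n"
  proof (intro equalityI subsetI)
    fix f assume f: "f \<in> {f \<in> shifted_sum K g i (Suc n). lookup f n = 0}"
    then have "lookup f a = 0" if "n \<le> a" for a
      using that by (cases "a = n") (simp_all add: shifted_sum_def)
    then show "f \<in> shifted_sum K g i n" using f by (simp add: shifted_sum_def)
  next
    fix f assume f: "f \<in> shifted_sum K g i n"
    then have "lookup f a \<in> shifted_part K (g a) i" if "a < Suc n" for a
      using that pv.vs.subspace_0[OF subspace_shifted_part[OF K, of "g n" i]]
      by (cases "a = n") (simp_all add: shifted_sum_def)
    then show "f \<in> {f \<in> shifted_sum K g i (Suc n). lookup f n = 0}"
      using f by (simp add: shifted_sum_def)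
  qed
  have im: "(\<lambda>f. lookup f n) ` shifted_sum K g i (Suc n) = shifted_part K (g n) i"
  proof (intro equalityI subsetI)
    fix p assume p: "p \<in> shifted_part K (g n) i"
    have "single n p \<in> shifted_sum K g i (Suc n)"
      using p pv.vs.subspace_0[OF subspace_shifted_part[OF K]] by (auto simp: shifted_sum_def lookup_single when_def)
    then show "p \<in> (\<lambda>f. lookup f n) ` shifted_sum K g i (Suc n)"
      by (rule rev_image_eqI) simp
  qed (auto simp: shifted_sum_def)
  show ?case
    using kpp.rank_nullity[OF linear_lookup[of n] subspace_shifted_sum[OF K] findim_shifted_sum, of g i "Suc n"]
    unfolding ker im by (simp add: Suc.IH dim_shifted_part[OF K])
qed

lemma restr_graded_mult:
  fixes p q :: "'a::comm_ring_1 poly3"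
  assumes "\<And>T. T \<in> keys p \<Longrightarrow> mdeg T + g = e"
  shows "restr {T. mdeg T + g = i} (p * q) = p * restr {T. mdeg T + e = i} q"
proof -
  have 1: "restr {T. mdeg T + g = i} (single S c * q) = single S c * restr {T. mdeg T + e = i} q"
    if S: "mdeg S + g = e" for S c
  proof (induction q rule: poly_mapping_additive_induct)
    case (single U b)
    have "restr B (single V a) = (if V \<in> B then single V a else 0)" for B V and a :: 'a
      by (rule poly_mapping_eqI) (auto simp: lookup_restr lookup_single when_def)
    then show ?case using S by (auto simp: mult_single mdeg_add)
  qed (simp_all add: distrib_left restr_add)
  have "restr {T. mdeg T + g = i} (p * q) =
    (\<Sum>S\<in>keys p. restr {T. mdeg T + g = i} (single S (lookup p S) * q))"
    by (subst poly_mapping_sum_singles[of p, symmetric]) (simp only: sum_distrib_right restr_sum)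
  also have "\<dots> = (\<Sum>S\<in>keys p. single S (lookup p S) * restr {T. mdeg T + e = i} q)"
    by (rule sum.cong) (use assms 1 in auto)
  also have "\<dots> = p * restr {T. mdeg T + e = i} q"
    by (simp only: sum_distrib_right[symmetric] poly_mapping_sum_singles)
  finally show ?thesis .
qed

text \<open>The component of internal degree $i$. Differentials preserve it, which allows preimages under a
  differential to be replaced by homogeneous ones.\<close>

definition graded_comp :: "'a::comm_ring_1 free_complex \<Rightarrow> nat \<Rightarrow> nat \<Rightarrow> (nat \<Rightarrow>\<^sub>0 'a poly3) \<Rightarrow> (nat \<Rightarrow>\<^sub>0 'a poly3)" where
  "graded_comp P q i f = (\<Sum>a<free_rank P q. single a (restr {T. mdeg T + gdeg P q a = i} (lookup f a)))"

lemma lookup_graded_comp: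
  "lookup (graded_comp P q i f) a =
    (if a < free_rank P q then restr {T. mdeg T + gdeg P q a = i} (lookup f a) else 0)"
proof -
  have "lookup (graded_comp P q i f) a =
    (\<Sum>c<free_rank P q. if c = a then restr {T. mdeg T + gdeg P q a = i} (lookup f a) else 0)"
    unfolding graded_comp_def lookup_sum by (rule sum.cong) (auto simp: lookup_single when_def)
  then show ?thesis by simp
qed

lemma bdry_graded_comp:
  assumes "resolves_k P"
  shows "bdry_map P q (graded_comp P (Suc q) i f) = graded_comp P q i (bdry_map P q f)"
proof (rule poly_mapping_eqI)
  fix a
  have "bdry P q a b * restr {T. mdeg T + gdeg P (Suc q) b = i} (lookup f b)
      = restr {T. mdeg T + gdeg P q a = i} (bdry P q a b * lookup f b)"
    if "a < free_rank P q" "b < free_rank P (Suc q)" for b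
    by (rule restr_graded_mult[symmetric]) (use assms that in \<open>auto simp: resolves_k_def\<close>)
  then show "lookup (bdry_map P q (graded_comp P (Suc q) i f)) a =
    lookup (graded_comp P q i (bdry_map P q f)) a"
    by (simp add: lookup_bdry_map lookup_graded_comp restr_sum)
qed

lemma graded_comp_tensor_part: "graded_comp P q i f \<in> tensor_part UNIV P q i"
  by (auto simp: tensor_part_def free_mod_iff lookup_graded_comp in_keys_iff lookup_restr split: if_splits)

lemma graded_comp_id: "f \<in> tensor_part K P q i \<Longrightarrow> graded_comp P q i f = f"
proof (rule poly_mapping_eqI)
  fix a assume f: "f \<in> tensor_part K P q i"
  show "lookup (graded_comp P q i f) a = lookup f a"
  proof (cases "a < free_rank P q")
    case True
    then have "mdeg T + gdeg P q a = i" if "lookup (lookup f a) T \<noteq> 0" for T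
      using f that by (simp add: tensor_part_def in_keys_iff)
    then have "restr {T. mdeg T + gdeg P q a = i} (lookup f a) = lookup f a"
      by (intro poly_mapping_eqI) (auto simp: lookup_restr)
    then show ?thesis using True by (simp add: lookup_graded_comp)
  next
    case False
    then show ?thesis using f by (simp add: lookup_graded_comp tensor_part_def free_mod_iff)
  qed
qed

text \<open>The entries of the differential are homogeneous of the right degrees, and \<open>K\<close> is an ideal.\<close>

lemma bdry_map_tensor_part:
  fixes K :: "'a::field poly3 set"
  assumes P: "resolves_k P" and K: "ideal.subspace K" and f: "f \<in> tensor_part K P (Suc q) i"
  shows "bdry_map P q f \<in> tensor_part K P q i"
proof -
  have "bdry_map P q f = graded_comp P q i (bdry_map P q f)"
    using bdry_graded_comp[OF P, of q i f] graded_comp_id[OF f] by simp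
  then have "bdry_map P q f \<in> tensor_part UNIV P q i" using graded_comp_tensor_part by metis
  moreover have "lookup (bdry_map P q f) a \<in> K" if "a < free_rank P q" for a
    using f that unfolding lookup_bdry_map
    by (auto simp: tensor_part_def intro!: ideal.subspace_sum[OF K] ideal.subspace_scale[OF K])
  ultimately show ?thesis by (simp add: tensor_part_def)
qed

lemma boundaries_subset_cycles:
  fixes K :: "'a::field poly3 set"
  assumes P: "resolves_k P" and K: "ideal.subspace K"
  shows "boundaries K P q i \<subseteq> cycles K P q i"
proof
  fix x assume "x \<in> boundaries K P q i"
  then obtain f where f: "f \<in> tensor_part K P (Suc q) i" "x = bdry_map P q f" unfolding boundaries_def by blast
  have x: "x \<in> tensor_part K P q i" using bdry_map_tensor_part[OF P K f(1)] f by simp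
  show "x \<in> cycles K P q i"
  proof (cases q)
    case 0
    then show ?thesis using x by (simp add: cycles_def)
  next
    case (Suc r)
    have "bdry_map P (Suc r) ` free_mod P (Suc (Suc r)) = {f \<in> free_mod P (Suc r). bdry_map P r f = 0}"
      using P unfolding resolves_k_def by blast
    moreover have "f \<in> free_mod P (Suc (Suc r))" using f Suc by (simp add: tensor_part_def)
    ultimately have "bdry_map P r (bdry_map P (Suc r) f) = 0" by blast
    then show ?thesis using x f Suc by (simp add: cycles_def)
  qed
qed

lemma findim_tensor_part: "kv.findim (tensor_part K P q i)"
  unfolding tensor_part_eq by (rule findim_shifted_sum)

lemma subspace_tensor_part: "ideal.subspace K \<Longrightarrow> kspace.subspace (tensor_part K P q i)"
  unfolding tensor_part_eq by (rule subspace_shifted_sum)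

lemma findim_cycles: "kv.findim (cycles K P q i)"
  by (rule kv.findim_subset[OF findim_tensor_part]) (auto simp: cycles_def)

lemma dim_tensor_part_Suc:
  fixes K :: "'a::field poly3 set"
  assumes "ideal.subspace K"
  shows "kspace.dim (tensor_part K P (Suc q) i) = kspace.dim (cycles K P (Suc q) i) + kspace.dim (boundaries K P q i)"
  using kvp.rank_nullity[OF linear_bdry_map[of P q] subspace_tensor_part[OF assms] findim_tensor_part, of P "Suc q" i]
  by (simp add: cycles_def boundaries_def)

definition homology_dim :: "'a::field poly3 set \<Rightarrow> 'a free_complex \<Rightarrow> nat \<Rightarrow> nat \<Rightarrow> nat" where
  "homology_dim K P q i = kspace.dim (cycles K P q i) - kspace.dim (boundaries K P q i)"

text \<open>The sums stop at position \<open>n\<close>, while the boundaries there come from the module in position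
  \<open>n + 1\<close>; this leaves the last term.\<close>

lemma euler_partial:
  fixes K :: "'a::field poly3 set"
  assumes P: "resolves_k P" and K: "ideal.subspace K"
  shows "(\<Sum>q<Suc n. (-1) ^ q * int (kspace.dim (tensor_part K P q i))) =
    (\<Sum>q<Suc n. (-1) ^ q * int (homology_dim K P q i)) + (-1) ^ n * int (kspace.dim (boundaries K P n i))"
proof -
  have h: "int (homology_dim K P q i) = int (kspace.dim (cycles K P q i)) - int (kspace.dim (boundaries K P q i))" for q
    using kv.dim_mono_findim[OF findim_cycles boundaries_subset_cycles[OF P K], of q i]
    by (simp add: homology_dim_def of_nat_diff)
  show ?thesis
  proof (induction n)
    case 0
    have "cycles K P 0 i = tensor_part K P 0 i" by (simp add: cycles_def)
    then show ?case by (simp add: h)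
  next
    case (Suc n)
    then show ?case by (simp add: h dim_tensor_part_Suc[OF K] algebra_simps)
  qed
qed

lemma euler_characteristic:
  fixes K :: "'a::field poly3 set"
  assumes P: "resolves_k P" and K: "ideal.subspace K" and n: "\<And>q. n \<le> q \<Longrightarrow> free_rank P q = 0"
  shows "(\<Sum>q<Suc n. (-1) ^ q * int (kspace.dim (tensor_part K P q i))) =
    (\<Sum>q<Suc n. (-1) ^ q * int (homology_dim K P q i))"
proof -
  have "boundaries K P n i \<subseteq> {0}"
    using n[of n] by (auto simp: boundaries_def lookup_bdry_map intro!: poly_mapping_eqI)
  then have "kspace.dim (boundaries K P n i) \<le> card ({} :: (nat \<Rightarrow>\<^sub>0 'a poly3) set)"
    by (intro kspace.dim_le_card) auto
  then show ?thesis using euler_partial[OF P K, where n = n and i = i] by simp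
qed

text \<open>The alternating sum of the generating functions of the degrees of the basis elements. Multiplied by
  the Hilbert series of \<open>K\<close> it gives the Euler characteristics of the graded parts of the tensor product.\<close>

definition euler_series :: "'a::field free_complex \<Rightarrow> nat \<Rightarrow> int fps" where
  "euler_series P n = (\<Sum>q<Suc n. \<Sum>a<free_rank P q. fps_const ((-1) ^ q) * fps_X ^ gdeg P q a)"

definition hilb_series :: "'a::field poly3 set \<Rightarrow> int fps" where
  "hilb_series K = Abs_fps (\<lambda>d. int (hilb K d))"

text \<open>The degree $i$ part of the tensor product with a free module is a sum of graded pieces of \<open>K\<close>, one
  for each basis element.\<close>

lemma euler_series_times_hilb:
  fixes K :: "'a::field poly3 set"
  assumes P: "resolves_k P" and K: "ideal.subspace K" and n: "\<And>q. n \<le> q \<Longrightarrow> free_rank P q = 0"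
  shows "euler_series P n * hilb_series K = Abs_fps (\<lambda>i. \<Sum>q<Suc n. (-1) ^ q * int (homology_dim K P q i))"
proof (rule fps_ext)
  fix i
  have "fps_nth (euler_series P n * hilb_series K) i =
    (\<Sum>q<Suc n. \<Sum>a<free_rank P q. (-1) ^ q * (if gdeg P q a \<le> i then int (hilb K (i - gdeg P q a)) else 0))"
    unfolding euler_series_def hilb_series_def sum_distrib_right fps_sum_nth
    by (intro sum.cong refl) (auto simp: mult.assoc fps_X_power_mult_nth)
  also have "\<dots> = (\<Sum>q<Suc n. (-1) ^ q * int (kspace.dim (tensor_part K P q i)))"
    unfolding tensor_part_eq dim_shifted_sum[OF K]
    by (intro sum.cong refl) (simp add: sum_distrib_left if_distrib[of int] cong: if_cong)
  also have "\<dots> = (\<Sum>q<Suc n. (-1) ^ q * int (homology_dim K P q i))" by (rule euler_characteristic[OF P K n])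
  finally show "fps_nth (euler_series P n * hilb_series K) i =
    fps_nth (Abs_fps (\<lambda>i. \<Sum>q<Suc n. (-1) ^ q * int (homology_dim K P q i))) i" by simp
qed

text \<open>Tensoring with the ring itself leaves the resolution, which is exact, also in each degree.\<close>

lemma homology_ring_Suc:
  assumes P: "resolves_k (P :: 'a::field free_complex)"
  shows "homology_dim UNIV P (Suc q) i = 0"
proof -
  have "cycles UNIV P (Suc q) i \<subseteq> boundaries UNIV P (Suc q) i"
  proof
    fix f assume "f \<in> cycles UNIV P (Suc q) i"
    then have f: "f \<in> tensor_part UNIV P (Suc q) i" "bdry_map P q f = 0" by (simp_all add: cycles_def)
    then have "f \<in> {f \<in> free_mod P (Suc q). bdry_map P q f = 0}" by (simp add: tensor_part_def)
    also have "\<dots> = bdry_map P (Suc q) ` free_mod P (Suc (Suc q))"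
      using P unfolding resolves_k_def by blast
    finally obtain h where h: "f = bdry_map P (Suc q) h" by blast
    have "f = graded_comp P (Suc q) i f" by (rule graded_comp_id[OF f(1), symmetric])
    also have "\<dots> = bdry_map P (Suc q) (graded_comp P (Suc (Suc q)) i h)"
      unfolding h by (rule bdry_graded_comp[OF P, symmetric])
    finally show "f \<in> boundaries UNIV P (Suc q) i"
      unfolding boundaries_def using graded_comp_tensor_part by blast
  qed
  moreover have "kv.findim (boundaries UNIV P (Suc q) i)"
    by (rule kv.findim_subset[OF findim_cycles boundaries_subset_cycles[OF P]]) simp
  ultimately show ?thesis unfolding homology_dim_def using kv.dim_mono_findim by fastforce
qed

text \<open>The augmentation vanishes on boundaries, but not on the degree 0 component of a preimage of 1.\<close>

lemma homology_ring_0: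
  assumes P: "resolves_k (P :: 'a::field free_complex)"
  shows "homology_dim UNIV P 0 0 \<noteq> 0"
proof
  assume z: "homology_dim UNIV P 0 0 = 0"
  interpret b: Vector_Spaces.linear kscale kscale "bdry_map P 0" by (rule linear_bdry_map)
  have sub: "kspace.subspace (boundaries UNIV P 0 0)" unfolding boundaries_def
    by (intro b.subspace_image subspace_tensor_part) simp
  have "boundaries UNIV P 0 0 = cycles UNIV P 0 0"
    using z by (intro kv.subspace_eq_of_dim_le[OF findim_cycles sub boundaries_subset_cycles[OF P]])
      (simp_all add: homology_dim_def)
  moreover have "1 \<in> aug_map P ` free_mod P 0" using P unfolding resolves_k_def by blast
  then obtain f where f: "f \<in> free_mod P 0" "aug_map P f = 1" by auto
  let ?f = "graded_comp P 0 0 f"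
  have "aug P a * lookup (lookup ?f a) 0 = aug P a * lookup (lookup f a) 0"
    if "a < free_rank P 0" for a
  proof (cases "aug P a = 0")
    case False
    then have "gdeg P 0 a = 0" using P that unfolding resolves_k_def by blast
    then show ?thesis using that by (simp add: lookup_graded_comp lookup_restr)
  qed simp
  then have "aug_map P ?f = aug_map P f" unfolding aug_map_def by (intro sum.cong) simp_all
  then have "aug_map P ?f = 1" using f(2) by simp
  moreover have "?f \<in> cycles UNIV P 0 0" using graded_comp_tensor_part by (simp add: cycles_def)
  ultimately have "?f \<in> bdry_map P 0 ` tensor_part UNIV P (Suc 0) 0" "aug_map P ?f = 1"
    unfolding boundaries_def by simp_all
  then obtain h where h: "h \<in> free_mod P (Suc 0)" "aug_map P (bdry_map P 0 h) = 1"
    unfolding tensor_part_def by auto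
  have "bdry_map P 0 h \<in> {f \<in> free_mod P 0. aug_map P f = 0}"
    using P h(1) unfolding resolves_k_def by auto
  then show False using h(2) by simp
qed

text \<open>Both families of Betti numbers are computed with the same resolution, so the Euler series times the
  difference of the two Hilbert series vanishes. The Euler series is nonzero since its product with the
  Hilbert series of the ring has a nonzero constant term.\<close>

lemma graded_betti_determines_hilb:
  fixes I J :: "'a::field poly3 set"
  assumes I: "ideal.subspace I" and J: "ideal.subspace J"
    and b: "\<forall>q i. graded_betti I q i = graded_betti J q i"
  shows "hilb I = hilb J"
proof -
  define P :: "'a free_complex" where "P = (SOME P. resolves_k P)"
  have P: "resolves_k P" unfolding P_def by (rule someI[of resolves_k, OF koszul_resolves_k])
  then have "\<exists>n. \<forall>q\<ge>n. free_rank P q = 0" unfolding resolves_k_def by (elim conjE)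
  then obtain n where "\<forall>q\<ge>n. free_rank P q = 0" ..
  then have n: "free_rank P q = 0" if "n \<le> q" for q using that by simp
  have "homology_dim K P q i = graded_betti K q i" for K q i
    by (simp add: homology_dim_def graded_betti_def Let_def P_def)
  then have e: "euler_series P n * hilb_series I = euler_series P n * hilb_series J"
    using euler_series_times_hilb[OF P I n] euler_series_times_hilb[OF P J n] b by simp
  have "euler_series P n * hilb_series (UNIV :: 'a poly3 set) = Abs_fps (\<lambda>i. \<Sum>q<Suc n. (-1) ^ q * int (homology_dim UNIV P q i))"
  proof (rule euler_series_times_hilb[OF P])
    show "ideal.subspace (UNIV :: 'a poly3 set)" by simp
    show "free_rank P q = 0" if "n \<le> q" for q by (rule n[OF that])
  qed
  then have "fps_nth (euler_series P n * hilb_series (UNIV :: 'a poly3 set)) 0 = (\<Sum>q<Suc n. (-1) ^ q * int (homology_dim UNIV P q 0))"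
    by (simp only: fps_nth_Abs_fps)
  also have "\<dots> = (\<Sum>q\<in>{0}. (-1) ^ q * int (homology_dim UNIV P q 0))"
  proof (rule sum.mono_neutral_right)
    have "homology_dim UNIV P q 0 = 0" if "q \<noteq> 0" for q
      using homology_ring_Suc[OF P] that by (cases q) simp_all
    then show "\<forall>q\<in>{..<Suc n} - {0}. (-1) ^ q * int (homology_dim UNIV P q 0) = 0" by simp
  qed simp_all
  finally have "euler_series P n \<noteq> 0" using homology_ring_0[OF P] by auto
  then have "hilb_series I = hilb_series J" using e by simp
  then have "fps_nth (hilb_series I) d = fps_nth (hilb_series J) d" for d by simp
  then show ?thesis by (simp add: hilb_series_def fun_eq_iff)
qed

section \<open>The weak Lefschetz property and the generic rank\<close>

text \<open>The degree $d$ part of the colon ideal $(I : L)$.\<close>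

definition colon_part :: "'a::field poly3 set \<Rightarrow> 'a poly3 \<Rightarrow> nat \<Rightarrow> 'a poly3 set" where
  "colon_part I L d = {p \<in> degree_part UNIV d. L * p \<in> I}"

lemma findim_colon_part: "pv.findim (colon_part I L d)"
  by (rule pv.findim_subset[OF findim_degree_part[of UNIV d]]) (auto simp: colon_part_def)

lemma subspace_colon_part:
  assumes "ideal.subspace I"
  shows "pv.vs.subspace (colon_part I L d)"
proof -
  have "ideal.subspace {p. L * p \<in> I}"
  proof (rule ideal.subspaceI)
    show "c * x \<in> {p. L * p \<in> I}" if "x \<in> {p. L * p \<in> I}" for c x
      using that ideal.subspace_scale[OF assms, of "L * x" c] by (simp add: mult_ac)
  qed (use ideal.subspace_0[OF assms] ideal.subspace_add[OF assms] in \<open>auto simp: distrib_left\<close>)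
  moreover have "colon_part I L d = degree_part {p. L * p \<in> I} d"
    by (auto simp: colon_part_def degree_part_def)
  ultimately show ?thesis using subspace_degree_part by metis
qed

lemma degree_part_subset_colon_part:
  assumes "ideal.subspace I"
  shows "degree_part I d \<subseteq> colon_part I L d"
  using ideal.subspace_scale[OF assms] by (auto simp: colon_part_def degree_part_def)

lemma mult_inj_iff: "mult_inj I L d \<longleftrightarrow> colon_part I L d \<subseteq> degree_part I d"
  by (auto simp: mult_inj_def colon_part_def degree_part_def)

lemma mult_inj_iff_dim:
  assumes "ideal.subspace I"
  shows "mult_inj I L d \<longleftrightarrow> pv.vs.dim (colon_part I L d) = hilb I d"
proof
  assume "mult_inj I L d"
  then have "colon_part I L d = degree_part I d"
    using degree_part_subset_colon_part[OF assms] by (auto simp: mult_inj_iff)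
  then show "pv.vs.dim (colon_part I L d) = hilb I d" by (simp add: hilb_def)
next
  assume "pv.vs.dim (colon_part I L d) = hilb I d"
  then have "degree_part I d = colon_part I L d"
    unfolding hilb_def
    by (intro pv.subspace_eq_of_dim_le[OF findim_colon_part subspace_degree_part[OF assms] degree_part_subset_colon_part[OF assms]]) simp
  then show "mult_inj I L d" by (simp add: mult_inj_iff)
qed

lemma xvar3_dvd_homogeneous:
  fixes p :: "'a::comm_ring_1 poly3"
  assumes "homogeneous (Suc d) p" "\<And>T. lookup T 3 = 0 \<Longrightarrow> lookup p T = 0"
  obtains q where "p = xvar 3 * q" "homogeneous d q"
proof -
  obtain q where q: "p = xvar 3 * q" using xvar_dvd[of 3] assms(2) by metis
  have x: "homogeneous 1 (xvar 3 :: 'a poly3)" by (simp add: xvar_def Defs.monom_def homogeneous_single)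
  have "p = hcomp (Suc d) p" using hcomp_homogeneous[OF assms(1), of "Suc d"] by simp
  also have "\<dots> = xvar 3 * hcomp d q" unfolding q using hcomp_homogeneous_mult[OF x, of "Suc d" q] by simp
  finally show ?thesis by (rule that) simp
qed

text \<open>For $L = g^{-1} x_3$ the forms in $I_{d+1}$ whose image under $g$ vanishes modulo $x_3$ are exactly
  the products of $L$ with elements of $(I:L)_d$.\<close>

lemma hilb_Suc_eq:
  fixes I :: "'a::field poly3 set"
  assumes I: "ideal.subspace I" and h: "\<And>p. act g (act h p) = p" "\<And>p. act h (act g p) = p"
  shows "hilb I (Suc d) = pv.vs.dim (colon_part I (act h (xvar 3)) d) + rk I g (Suc d) (plane_mons (Suc d) (Suc (Suc d)))"
proof -
  let ?P = "plane_mons (Suc d) (Suc (Suc d))"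
  let ?L = "act h (xvar 3)"
  let ?f = "\<lambda>p. restr ?P (act g p)"
  have lin: "Vector_Spaces.linear pscale pscale ?f"
    by (rule linear_pscaleI) (simp_all add: act_add restr_add act_pscale restr_pscale)
  have im: "?f ` degree_part I (Suc d) = restr ?P ` act g ` degree_part I (Suc d)" by (simp add: image_image)
  have "hilb I (Suc d) = pv.vs.dim {x \<in> degree_part I (Suc d). ?f x = 0} + rk I g (Suc d) ?P"
    unfolding hilb_def rk_def im[symmetric]
    by (rule pvp.rank_nullity[OF lin subspace_degree_part[OF I] findim_degree_part])
  also have "{x \<in> degree_part I (Suc d). ?f x = 0} = (*) ?L ` colon_part I ?L d"
  proof (intro equalityI subsetI)
    fix x assume x: "x \<in> {x \<in> degree_part I (Suc d). ?f x = 0}"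
    have hx: "homogeneous (Suc d) (act g x)" using x by (auto simp: degree_part_def homogeneous_act)
    have "lookup (act g x) T = 0" if "lookup T 3 = 0" for T
    proof (cases "T \<in> ?P")
      case True
      have "lookup (?f x) T = 0" using x by simp
      then show ?thesis using True by (simp add: lookup_restr)
    next
      case False
      then have "mdeg T \<noteq> Suc d" using that by (auto simp: plane_mons_def mdeg_alt)
      then show ?thesis using hx by (auto simp: homogeneous_iff)
    qed
    then obtain q where q: "act g x = xvar 3 * q" "homogeneous d q" using xvar3_dvd_homogeneous[OF hx] by blast
    have "x = act h (act g x)" by (simp add: h)
    also have "\<dots> = ?L * act h q" by (simp add: q act_mult)
    finally have e: "x = ?L * act h q" .
    then have "act h q \<in> colon_part I ?L d"
      using x q by (auto simp: colon_part_def degree_part_def homogeneous_act)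
    then show "x \<in> (*) ?L ` colon_part I ?L d" using e by blast
  next
    fix x assume "x \<in> (*) ?L ` colon_part I ?L d"
    then obtain p where p: "p \<in> colon_part I ?L d" "x = ?L * p" by blast
    have hL: "homogeneous 1 ?L" by (rule homogeneous_act) (simp add: xvar_def Defs.monom_def homogeneous_single)
    have "x \<in> degree_part I (Suc d)"
      using p homogeneous_mult[OF hL, of d p] by (auto simp: colon_part_def degree_part_def)
    moreover have "?f x = 0" unfolding p(2) act_mult h(1)
      by (rule restr_xvar_mult) (simp add: plane_mons_def)
    ultimately show "x \<in> {x \<in> degree_part I (Suc d). ?f x = 0}" by simp
  qed
  also have "pv.vs.dim \<dots> = pv.vs.dim (colon_part I ?L d)"
  proof (rule pvp.dim_image_injective[OF linear_times subspace_colon_part[OF I] findim_colon_part])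
    fix p assume "?L * p = 0"
    then have "act g (?L * p) = act g 0" by (rule arg_cong)
    then have "xvar 3 * act g p = 0" by (simp only: act_mult h act_0)
    then have "act g p = 0" by (rule xvar_mult_eq_0)
    then show "p = 0" using h(2)[of p] by simp
  qed
  finally show ?thesis .
qed

lemma hilb_le_colon:
  assumes "ideal.subspace I"
  shows "hilb I d \<le> pv.vs.dim (colon_part I L d)"
  unfolding hilb_def by (rule pv.dim_mono_findim[OF findim_colon_part degree_part_subset_colon_part[OF assms]])

text \<open>Surjectivity writes each form as an element of $I$ plus a multiple of $L$; applying $g$ and setting
  $x_3 = 0$, every monomial in $x_1,x_2$ lies in the image of $gI$.\<close>

lemma rk_of_mult_surj:
  fixes I :: "'a::field poly3 set"
  assumes I: "homogeneous_ideal I" and h: "\<And>p. act g (act h p) = p"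
    and s: "mult_surj I (act h (xvar 3)) d"
  shows "Suc (Suc d) \<le> rk I g (Suc d) (plane_mons (Suc d) (Suc (Suc d)))"
proof -
  let ?P = "plane_mons (Suc d) (Suc (Suc d))"
  have mem: "monom (plane_mon (Suc d) j) \<in> restr ?P ` act g ` degree_part I (Suc d)" if j: "j \<le> Suc d" for j
  proof -
    let ?m = "monom (plane_mon (Suc d) j) :: 'a poly3"
    have hm: "homogeneous (Suc d) ?m" using j by (simp add: Defs.monom_def homogeneous_single)
    then have "act h ?m \<in> degree_part UNIV (Suc d)" by (simp add: degree_part_def homogeneous_act)
    then obtain p where p: "act h ?m - act h (xvar 3) * p \<in> I"
      using s unfolding mult_surj_def by blast
    define a where "a = hcomp (Suc d) (act h ?m - act h (xvar 3) * p)"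
    have a: "a \<in> degree_part I (Suc d)"
      using hcomp_mem_homogeneous_ideal[OF I p] by (simp add: a_def degree_part_def)
    have "act g a = hcomp (Suc d) (act g (act h ?m - act h (xvar 3) * p))" by (simp add: a_def act_hcomp)
    moreover have e: "act g (act h ?m) = act g (act h ?m - act h (xvar 3) * p) + act g (act h (xvar 3) * p)"
      by (simp add: act_add[symmetric])
    have "hcomp (Suc d) ?m = hcomp (Suc d) (act g (act h ?m - act h (xvar 3) * p)) + hcomp (Suc d) (xvar 3 * act g p)"
      using arg_cong[OF e, of "hcomp (Suc d)"] by (simp only: h act_mult hcomp_add)
    ultimately have "restr ?P (hcomp (Suc d) ?m) = restr ?P (act g a) + restr ?P (hcomp (Suc d) (xvar 3 * act g p))"
      by (simp add: restr_add)
    moreover have "restr ?P (hcomp (Suc d) (xvar 3 * act g p)) = 0"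
      unfolding hcomp_def restr_restr by (rule restr_xvar_mult) (auto simp: plane_mons_def)
    moreover have "restr ?P (hcomp (Suc d) ?m) = ?m"
      by (rule poly_mapping_eqI) (use j in \<open>auto simp: lookup_restr lookup_hcomp Defs.monom_def lookup_single when_def plane_mon_mem\<close>)
    ultimately have "?m = restr ?P (act g a)" by simp
    then show ?thesis using a by blast
  qed
  have "pv.indep_family (Suc (Suc d)) (\<lambda>j. monom (plane_mon (Suc d) j) :: 'a poly3)" unfolding pv.indep_family_def
  proof (intro allI impI)
    fix c i assume s: "(\<Sum>j<Suc (Suc d). pscale (c j) (monom (plane_mon (Suc d) j) :: 'a poly3)) = 0" and i: "i < Suc (Suc d)"
    have "lookup (\<Sum>j<Suc (Suc d). pscale (c j) (monom (plane_mon (Suc d) j) :: 'a poly3)) (plane_mon (Suc d) i) = 0"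
      by (simp only: s lookup_zero)
    then show "c i = 0" using i
      by (simp add: lookup_sum Defs.monom_def lookup_single when_def if_distrib cong: if_cong del: sum.lessThan_Suc)
  qed
  then show ?thesis unfolding rk_def
    by (rule pv.indep_family_card_le_dim[OF _ _ findim_coordinate_image]) (use mem in auto)
qed

lemma linear_form_of_homogeneous:
  fixes p :: "'a::comm_ring_1 poly3"
  assumes "homogeneous 1 p"
  shows "p = linear_form (\<lambda>i. lookup p (single i 1))"
proof (rule poly_mapping_eqI)
  fix T :: mon
  have l: "lookup (linear_form c) T = (\<Sum>i\<in>UNIV. c i * (if T = single i 1 then 1 else 0))" for c :: "3 \<Rightarrow> 'a"
    unfolding linear_form_def pscale_def[symmetric]
    by (simp add: lookup_sum xvar_def Defs.monom_def lookup_single when_def eq_commute[of T])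
  show "lookup p T = lookup (linear_form (\<lambda>i. lookup p (single i 1))) T"
  proof (cases "\<exists>i. T = single i 1")
    case True
    then obtain i where i: "T = single i 1" by blast
    have si: "single i (1::nat) = single j 1 \<longleftrightarrow> i = j" for i j :: 3
      by (metis lookup_single_eq lookup_single_not_eq zero_neq_one)
    show ?thesis unfolding l by (simp add: i si[simplified] if_distrib cong: if_cong)
  next
    case False
    have "mdeg T \<noteq> 1"
    proof
      assume d: "mdeg T = 1"
      then have "T = single 1 1 \<or> T = single 2 1 \<or> T = single 3 1"
      proof -
        consider "lookup T 1 = 1" "lookup T 2 = 0" "lookup T 3 = 0"
          | "lookup T 1 = 0" "lookup T 2 = 1" "lookup T 3 = 0"
          | "lookup T 1 = 0" "lookup T 2 = 0" "lookup T 3 = 1"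
          using d by (auto simp: mdeg_alt add_eq_if split: if_splits)
        then show ?thesis
        proof cases
          case 1
          then have "T = single 1 1" by (intro mon_eqI) (simp_all add: lookup_single when_def)
          then show ?thesis by simp
        next
          case 2
          then have "T = single 2 1" by (intro mon_eqI) (simp_all add: lookup_single when_def)
          then show ?thesis by simp
        next
          case 3
          then have "T = single 3 1" by (intro mon_eqI) (simp_all add: lookup_single when_def)
          then show ?thesis by simp
        qed
      qed
      then show False using False by blast
    qed
    then have "lookup p T = 0" using assms by (auto simp: homogeneous_iff)
    then show ?thesis using False unfolding l by simp
  qed
qed

lemma invertible_with_third_column:
  fixes c :: "3 \<Rightarrow> 'a::field"
  assumes "c k \<noteq> 0"
  obtains h :: "'a ^ 3 ^ 3" where "invertible h" "\<And>i. h $ i $ 3 = c i"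
proof -
  define h :: "3 \<Rightarrow> 3 \<Rightarrow> 'a ^ 3 ^ 3" where
    "h = (\<lambda>a b. \<chi> i j. if j = 3 then c i else if j = 1 then (if i = a then 1 else 0) else (if i = b then 1 else 0))"
  have col: "h a b $ i $ 3 = c i" for a b i by (simp add: h_def)
  have "det (h 1 2) = c 3" "det (h 1 3) = - c 2" "det (h 2 3) = c 1"
    by (simp_all add: det_3 h_def)
  moreover have "c 1 \<noteq> 0 \<or> c 2 \<noteq> 0 \<or> c 3 \<noteq> 0" using assms exhaust_3[of k] by auto
  ultimately have "invertible (h 1 2) \<or> invertible (h 1 3) \<or> invertible (h 2 3)"
    by (auto simp: invertible_det_nz)
  then show ?thesis using that col by blast
qed

text \<open>A nonzero Lefschetz form becomes the third column of an invertible matrix. If the zero form has the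
  property, then in each degree the source or the target of the multiplication is zero, so every linear
  form has it.\<close>

lemma weak_Lefschetz_coordinate:
  fixes I :: "'a::field poly3 set"
  assumes I: "ideal.subspace I" and "weak_Lefschetz I"
  obtains g h where "\<And>p. act g (act h p) = p" "\<And>p. act h (act g p) = p"
    "\<And>d. mult_inj I (act h (xvar 3)) d \<or> mult_surj I (act h (xvar 3)) d"
proof -
  obtain L where L: "homogeneous 1 L" "\<And>d. mult_inj I L d \<or> mult_surj I L d"
    using assms unfolding weak_Lefschetz_def degree_part_def by blast
  define c where "c = (\<lambda>i. lookup L (single i 1))"
  have Lc: "L = linear_form c" unfolding c_def by (rule linear_form_of_homogeneous[OF L(1)])
  have ex: "\<exists>h :: 'a ^ 3 ^ 3. invertible h \<and> (\<forall>d. mult_inj I (act h (xvar 3)) d \<or> mult_surj I (act h (xvar 3)) d)"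
  proof (cases "\<exists>k. c k \<noteq> 0")
    case True
    then obtain h :: "'a ^ 3 ^ 3" where "invertible h" "\<And>i. h $ i $ 3 = c i" using invertible_with_third_column by metis
    then show ?thesis using L(2) by (intro exI[of _ h]) (simp add: act_xvar Lc)
  next
    case False
    then have "L = 0" by (simp add: Lc linear_form_def)
    then have "mult_inj I L' d \<or> mult_surj I L' d" for L' d
    proof -
      have "mult_inj I 0 d \<or> mult_surj I 0 d" using L(2) \<open>L = 0\<close> by blast
      then show ?thesis
      proof
        assume "mult_inj I 0 d"
        then show ?thesis using ideal.subspace_0[OF I] by (simp add: mult_inj_def)
      next
        assume "mult_surj I 0 d"
        then have "q - L' * 0 \<in> I" if "q \<in> degree_part UNIV (Suc d)" for q
          using that by (simp add: mult_surj_def)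
        then show ?thesis unfolding mult_surj_def by (metis (no_types, lifting) CollectI UNIV_I degree_part_def homogeneous_0)
      qed
    qed
    moreover have "invertible (mat 1 :: 'a ^ 3 ^ 3)" by (simp add: invertible_det_nz)
    ultimately show ?thesis by blast
  qed
  then obtain h :: "'a ^ 3 ^ 3" where h: "invertible h" "\<And>d. mult_inj I (act h (xvar 3)) d \<or> mult_surj I (act h (xvar 3)) d" by blast
  obtain g where "invertible g" "\<And>p. act h (act g p) = p" "\<And>p. act g (act h p) = p"
    using invertible_act_inverse[OF h(1)] by metis
  then show ?thesis using that h(2) by blast
qed


lemma mult_surj_span:
  assumes "mult_surj I L d"
  shows "degree_part UNIV (Suc d) \<subseteq> ideal.span (insert L I)"
proof
  fix q :: "'a poly3" assume "q \<in> degree_part UNIV (Suc d)"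
  then obtain p where "q - L * p \<in> I" using assms unfolding mult_surj_def by blast
  then have "(q - L * p) + p * L \<in> ideal.span (insert L I)"
    by (intro ideal.span_add ideal.span_scale ideal.span_base) auto
  then show "q \<in> ideal.span (insert L I)" by (simp add: mult.commute)
qed

lemma degree_part_0_proper:
  fixes I :: "'a::field poly3 set"
  assumes "ideal.subspace I" "I \<noteq> UNIV"
  shows "degree_part I 0 = {0}"
proof (intro equalityI subsetI)
  fix p assume p: "p \<in> degree_part I 0"
  have pc: "p = pconst (lookup p 0)"
  proof (rule poly_mapping_eqI)
    fix T
    have "T = 0" if "lookup p T \<noteq> 0"
      using that p by (intro mon_eqI) (auto simp: degree_part_def homogeneous_iff mdeg_alt)
    then show "lookup p T = lookup (pconst (lookup p 0)) T"
      by (auto simp: pconst_def lookup_single when_def)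
  qed
  have "p = 0"
  proof (rule ccontr)
    assume "p \<noteq> 0"
    then have nz: "lookup p 0 \<noteq> 0" using pc by auto
    have "pconst (inverse (lookup p 0)) * p \<in> I"
      using p assms(1) by (intro ideal.subspace_scale) (auto simp: degree_part_def)
    also have "pconst (inverse (lookup p 0)) * p = 1"
      by (subst (2) pc) (simp add: pconst_mult[symmetric] nz)
    finally have "q \<in> I" for q using ideal.subspace_scale[OF assms(1), of 1 q] by simp
    then show False using assms(2) by blast
  qed
  then show "p \<in> {0}" by simp
qed (use ideal.subspace_0[OF assms(1)] in \<open>simp add: degree_part_def\<close>)

lemma plane_rank_0:
  fixes I :: "'a::field poly3 set"
  assumes "ideal.subspace I" "I \<noteq> UNIV"
  shows "plane_rank I 0 = 0"
proof -
  obtain g where "rk I g 0 (plane_mons 0 (Suc 0)) = plane_rank I 0"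
    using generic_rk_attained[of I 0 "plane_mons 0 (Suc 0)"] unfolding plane_rank_def by blast
  moreover have "rk I g 0 (plane_mons 0 (Suc 0)) \<le> card ({} :: mon set)"
    unfolding rk_def by (rule findim_supported(2)) (auto simp: degree_part_0_proper[OF assms])
  ultimately show ?thesis by simp
qed

lemma hilb_Suc_generic:
  fixes I :: "'a::field_char_0 poly3 set"
  assumes I: "homogeneous_artinian_ideal I"
  obtains g h where "\<And>p. act g (act h p) = p" "\<And>p. act h (act g p) = p"
    "gin_monomials I = leads (act g ` I)"
    "hilb I (Suc d) = pv.vs.dim (colon_part I (act h (xvar 3)) d) + plane_rank I (Suc d)"
proof -
  have sI: "ideal.subspace I" using I by (simp add: homogeneous_artinian_ideal_def homogeneous_ideal_subspace)
  obtain g where g: "invertible g" "rk_generic I (Suc (Suc d)) g" "gin I = {p. keys p \<subseteq> leads (act g ` I)}"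
    using gin_generic_obtain[OF I] by blast
  obtain h where h: "\<And>p. act g (act h p) = p" "\<And>p. act h (act g p) = p"
    using invertible_act_inverse[OF g(1)] by metis
  have "plane_mons (Suc d) (Suc (Suc d)) \<subseteq> {T. mdeg T = Suc d}" by (auto simp: plane_mons_def)
  then have "rk I g (Suc d) (plane_mons (Suc d) (Suc (Suc d))) = plane_rank I (Suc d)"
    using g(2) unfolding rk_generic_def plane_rank_def by blast
  then show ?thesis using that[OF h gin_monomials_leads[OF g(3)]] hilb_Suc_eq[OF sI h, of d] by simp
qed

text \<open>The upper bound holds for every invertible matrix. The Lefschetz form attains it in one of two ways,
  according to whether it acts injectively or surjectively.\<close>

lemma plane_rank_Suc:
  fixes I :: "'a::field_char_0 poly3 set"
  assumes I: "homogeneous_artinian_ideal I" and L: "weak_Lefschetz I"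
  shows "int (plane_rank I (Suc d)) = min (int d + 2) (int (hilb I (Suc d)) - int (hilb I d))"
proof (rule antisym)
  have hI: "homogeneous_ideal I" using I by (simp add: homogeneous_artinian_ideal_def)
  then have sI: "ideal.subspace I" by (rule homogeneous_ideal_subspace)
  obtain g h where "hilb I (Suc d) = pv.vs.dim (colon_part I (act h (xvar 3)) d) + plane_rank I (Suc d)"
    using hilb_Suc_generic[OF I] by metis
  then show "int (plane_rank I (Suc d)) \<le> min (int d + 2) (int (hilb I (Suc d)) - int (hilb I d))"
    using hilb_le_colon[OF sI, of d "act h (xvar 3)"] plane_rank_le[of I "Suc d"] by simp
  obtain g h where h: "\<And>p. act g (act h p) = p" "\<And>p. act h (act g p) = p"
    "\<And>d. mult_inj I (act h (xvar 3)) d \<or> mult_surj I (act h (xvar 3)) d"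
    by (fact weak_Lefschetz_coordinate[OF sI L])
  have le: "rk I g (Suc d) (plane_mons (Suc d) (Suc (Suc d))) \<le> plane_rank I (Suc d)"
    unfolding plane_rank_def by (rule rk_le_generic)
  show "min (int d + 2) (int (hilb I (Suc d)) - int (hilb I d)) \<le> int (plane_rank I (Suc d))"
  proof (cases "mult_inj I (act h (xvar 3)) d")
    case True
    then have "pv.vs.dim (colon_part I (act h (xvar 3)) d) = hilb I d" by (simp add: mult_inj_iff_dim[OF sI])
    then show ?thesis using hilb_Suc_eq[OF sI h(1,2), of d] le by simp
  next
    case False
    then have "mult_surj I (act h (xvar 3)) d" using h(3) by blast
    then show ?thesis using rk_of_mult_surj[OF hI h(1), of d] le by simp
  qed
qed

text \<open>The hypothesis says that $\dim (I:L)_d = \dim I_d$ for the generic form $L$, so $L$ acts injectively.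
  An element of $gI$ with initial monomial divisible by $x_3$ is a multiple of $x_3$, and the quotient
  lies in $gI$ again.\<close>

lemma gin_x3_cancel:
  fixes I :: "'a::field_char_0 poly3 set"
  assumes I: "homogeneous_artinian_ideal I"
    and r: "int (plane_rank I (Suc d)) = int (hilb I (Suc d)) - int (hilb I d)"
    and S: "mdeg S = d" "single 3 1 + S \<in> gin_monomials I"
  shows "S \<in> gin_monomials I"
proof -
  have hI: "homogeneous_ideal I" using I by (simp add: homogeneous_artinian_ideal_def)
  then have sI: "ideal.subspace I" by (rule homogeneous_ideal_subspace)
  obtain g h where h: "\<And>p. act g (act h p) = p" "\<And>p. act h (act g p) = p"
    and M: "gin_monomials I = leads (act g ` I)"
    and H: "hilb I (Suc d) = pv.vs.dim (colon_part I (act h (xvar 3)) d) + plane_rank I (Suc d)"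
    by (fact hilb_Suc_generic[OF I])
  have inj: "mult_inj I (act h (xvar 3)) d"
    unfolding mult_inj_iff_dim[OF sI] using H r by simp
  let ?T = "single 3 1 + S"
  have dT: "mdeg ?T = Suc d" using S by (simp add: mdeg_add)
  obtain f where f: "f \<in> I" "lookup (act g f) ?T \<noteq> 0"
    "\<And>U. revlex_less ?T U \<Longrightarrow> lookup (act g f) U = 0"
    using S(2) unfolding M leads_def by blast
  let ?k = "hcomp (Suc d) f"
  have k: "?k \<in> I" using hcomp_mem_homogeneous_ideal[OF hI f(1)] .
  have ak: "act g ?k = hcomp (Suc d) (act g f)" by (simp add: act_hcomp)
  have "lookup (act g ?k) U = 0" if "lookup U 3 = 0" for U
  proof (cases "mdeg U = Suc d")
    case True
    then have "revlex_less ?T U" using that dT by (simp add: revlex_less_iff lookup_add)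
    then show ?thesis using f(3) by (simp add: ak lookup_hcomp)
  qed (simp add: ak lookup_hcomp)
  then obtain q where q: "act g ?k = xvar 3 * q" "homogeneous d q"
    using xvar3_dvd_homogeneous[of d "act g ?k"] ak by (metis homogeneous_hcomp)
  have "act h (xvar 3) * act h q = ?k" using q(1) h(2)[of ?k] by (simp add: act_mult)
  then have "act h q \<in> I"
    using inj k q(2) unfolding mult_inj_def degree_part_def by (simp add: homogeneous_act)
  then have "q \<in> act g ` I" using h(1)[of q] by (metis imageI)
  moreover have lq: "lookup q U = lookup (act g ?k) (single 3 1 + U)" for U
    unfolding q(1) xvar_def Defs.monom_def by (simp only: lookup_single_times_add mult_1_left)
  have "lookup q S \<noteq> 0" using f(2) dT unfolding lq ak by (simp add: lookup_hcomp)
  moreover have "lookup q U = 0" if "revlex_less S U" for U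
    using f(3)[of "single 3 1 + U"] that unfolding lq ak by (simp add: lookup_hcomp revlex_less_add)
  ultimately show ?thesis unfolding M leads_def by blast
qed

section \<open>The first reduction number\<close>

text \<open>Write every monomial of degree \<open>t + 1\<close> as an element of $I$ plus a multiple of the form with
  coefficients \<open>c0\<close>. Replacing \<open>c0\<close> by \<open>c\<close> in these expressions gives vectors that stay independent
  on an open set, and independence of that many vectors means that they span.\<close>

lemma reduction_condition_open:
  fixes I :: "'a::field_char_0 poly3 set"
  assumes I: "homogeneous_ideal I" and c0: "degree_part UNIV (Suc t) \<subseteq> ideal.span (insert (linear_form c0) I)"
  obtains F where "polyfun F" "F c0 \<noteq> 0"
    "\<And>c. F c \<noteq> 0 \<Longrightarrow> degree_part UNIV (Suc t) \<subseteq> ideal.span (insert (linear_form c) I)"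
proof -
  have sI: "ideal.subspace I" using I by (rule homogeneous_ideal_subspace)
  define n where "n = card {T::mon. mdeg T = Suc t}"
  obtain m where m: "bij_betw m {..<n} {T. mdeg T = Suc t}"
    unfolding n_def by (metis ex_bij_betw_nat_finite atLeast0LessThan finite_mons_of_degree)
  have "\<exists>q a. homogeneous t q \<and> a \<in> degree_part I (Suc t) \<and> monom (m i) = a + q * linear_form c0" if i: "i < n" for i
  proof -
    have mi: "mdeg (m i) = Suc t" using bij_betw_apply[OF m, of i] i by auto
    then have hm: "homogeneous (Suc t) (monom (m i) :: 'a poly3)" by (simp add: Defs.monom_def homogeneous_single)
    then have "monom (m i) \<in> ideal.span (insert (linear_form c0) I)" using c0 by (auto simp: degree_part_def)
    then obtain q where "monom (m i) - q * linear_form c0 \<in> ideal.span I"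
      unfolding ideal.span_insert by blast
    then have q: "monom (m i) - q * linear_form c0 \<in> I" by (simp add: ideal.span_eq_iff[THEN iffD2, OF sI])
    let ?b = "monom (m i) - q * linear_form c0"
    have e: "monom (m i) = ?b + linear_form c0 * q" by (simp add: mult.commute)
    have "monom (m i) = hcomp (Suc t) (monom (m i) :: 'a poly3)" using hcomp_homogeneous[OF hm, of "Suc t"] by simp
    also have "\<dots> = hcomp (Suc t) ?b + hcomp (Suc t) (linear_form c0 * q)" by (subst e) (rule hcomp_add)
    also have "hcomp (Suc t) (linear_form c0 * q) = hcomp t q * linear_form c0"
      using hcomp_homogeneous_mult[OF homogeneous_linear_form, of "Suc t" c0 q] by (simp add: mult.commute)
    finally show ?thesis using hcomp_mem_homogeneous_ideal[OF I q]
      by (intro exI[of _ "hcomp t q"] exI[of _ "hcomp (Suc t) ?b"]) (simp add: degree_part_def)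
  qed
  then obtain q a where qa: "\<And>i. i < n \<Longrightarrow> homogeneous t (q i) \<and> a i \<in> degree_part I (Suc t) \<and>
     monom (m i) = a i + q i * linear_form c0" by metis
  define v where "v = (\<lambda>i c. a i + q i * linear_form c)"
  have "polyfun (\<lambda>c. lookup (v i c) T)" for i T
    unfolding v_def by (intro polyfun_lookup_polyfam polyfam_add polyfam_mult polyfam_const polyfam_linear_form)
  moreover have "pv.indep_family n (\<lambda>i. v i c0)" unfolding pv.indep_family_def
  proof (intro allI impI)
    fix c i assume s: "(\<Sum>i<n. pscale (c i) (v i c0)) = 0" and i: "i < n"
    have "(\<Sum>i<n. pscale (c i) (v i c0)) = (\<Sum>i<n. pscale (c i) (monom (m i)))"
      by (rule sum.cong) (use qa in \<open>auto simp: v_def\<close>)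
    then have "lookup (\<Sum>j<n. pscale (c j) (monom (m j))) (m i) = 0" using s by simp
    moreover have "lookup (\<Sum>j<n. pscale (c j) (monom (m j))) (m i) = (\<Sum>j<n. if j = i then c j else 0)"
      unfolding lookup_sum
    proof (rule sum.cong)
      fix j assume "j \<in> {..<n}"
      then have "m j = m i \<longleftrightarrow> j = i" using m i by (auto simp: bij_betw_def inj_on_def)
      then show "lookup (pscale (c j) (monom (m j))) (m i) = (if j = i then c j else 0)"
        by (simp add: Defs.monom_def lookup_single when_def)
    qed simp
    ultimately show "c i = 0" using i by simp
  qed
  ultimately obtain F where F: "polyfun F" "F c0 \<noteq> 0" "\<And>c. F c \<noteq> 0 \<Longrightarrow> pv.indep_family n (\<lambda>i. v i c)"
    using indep_family_zariski_open[of n v c0] by blast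
  have "degree_part UNIV (Suc t) \<subseteq> ideal.span (insert (linear_form c) I)" if c: "F c \<noteq> 0" for c
  proof -
    let ?V = "degree_part (ideal.span (insert (linear_form c) I)) (Suc t)"
    have "v i c \<in> ?V" if "i < n" for i
    proof -
      have "v i c \<in> ideal.span (insert (linear_form c) I)" unfolding v_def
        using qa[OF that] by (intro ideal.span_add ideal.span_scale ideal.span_base) (auto simp: degree_part_def)
      moreover have "homogeneous (Suc t) (v i c)" unfolding v_def
        using qa[OF that] homogeneous_mult[of t "q i" 1 "linear_form c"] homogeneous_linear_form
        by (intro homogeneous_add) (auto simp: degree_part_def)
      ultimately show ?thesis by (simp add: degree_part_def)
    qed
    then have "n \<le> pv.vs.dim ?V" using pv.indep_family_card_le_dim[OF F(3)[OF c] _ findim_degree_part] by blast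
    moreover have "pv.vs.dim (degree_part UNIV (Suc t) :: 'a poly3 set) \<le> n"
      unfolding n_def by (rule findim_supported(2)) (auto simp: degree_part_def homogeneous_iff)
    moreover have "?V \<subseteq> degree_part UNIV (Suc t)" by (auto simp: degree_part_def)
    ultimately have "?V = degree_part UNIV (Suc t)"
      using pv.subspace_eq_of_dim_le[OF findim_degree_part subspace_degree_part[OF ideal.subspace_span], of "insert (linear_form c) I" "Suc t" UNIV "Suc t"]
      by simp
    then show ?thesis by (auto simp: degree_part_def)
  qed
  then show ?thesis using that F by blast
qed

text \<open>The generic value is the least \<open>t\<close> for which some form works: below it no form works, and at it the
  condition is open and satisfiable.\<close>

lemma reduction_number1_lower:
  fixes I :: "'a::field_char_0 poly3 set"
  assumes I: "homogeneous_artinian_ideal I" and t: "t < reduction_number1 I"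
  shows "\<not> degree_part UNIV (Suc t) \<subseteq> ideal.span (insert (linear_form c) I)"
proof -
  have hI: "homogeneous_ideal I" using I by (simp add: homogeneous_artinian_ideal_def)
  define Q where "Q = (\<lambda>c t. degree_part UNIV (Suc t) \<subseteq> ideal.span (insert (linear_form c) I))"
  obtain N where N: "\<And>d. N \<le> d \<Longrightarrow> degree_part UNIV d \<subseteq> I"
    using artinian_contains_high_degrees[OF I] by blast
  have "Q c N" for c
    using N[of "Suc N"] ideal.span_superset[of "insert (linear_form c) I"] unfolding Q_def by auto
  then have ex: "\<exists>t. \<exists>c. Q c t" by blast
  define r where "r = (LEAST t. \<exists>c. Q c t)"
  obtain c0 where c0: "Q c0 r" using LeastI_ex[OF ex] unfolding r_def by blast
  have below: "\<not> Q c t" if "t < r" for c t using not_less_Least[of t "\<lambda>t. \<exists>c. Q c t"] that unfolding r_def by blast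
  obtain F where F: "polyfun F" "F c0 \<noteq> 0" "\<And>c. F c \<noteq> 0 \<Longrightarrow> Q c r"
    using reduction_condition_open[OF hI, of r c0] c0 unfolding Q_def by blast
  have least: "(LEAST t. Q c t) = r" if "F c \<noteq> 0" for c
  proof (rule Least_equality)
    show "Q c r" by (rule F(3)[OF that])
    fix u assume "Q c u"
    then show "r \<le> u" using below by (meson not_le)
  qed
  have e: "reduction_number1 I = (THE r. \<exists>U. zariski_open U \<and> U \<noteq> {} \<and> (\<forall>c\<in>U. (LEAST t. Q c t) = r))"
    by (simp only: reduction_number1_def Q_def)
  have "reduction_number1 I = r" unfolding e
  proof (rule the_equality)
    show "\<exists>U. zariski_open U \<and> U \<noteq> {} \<and> (\<forall>c\<in>U. (LEAST t. Q c t) = r)"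
      using zariski_open_polyfun[OF F(1)] F(2) least by (intro exI[of _ "{c. F c \<noteq> 0}"]) auto
    fix r' assume "\<exists>U. zariski_open U \<and> U \<noteq> {} \<and> (\<forall>c\<in>U. (LEAST t. Q c t) = r')"
    then obtain U where U: "zariski_open U" "U \<noteq> {}" "\<forall>c\<in>U. (LEAST t. Q c t) = r'" by blast
    have "U \<inter> {c. F c \<noteq> 0} \<noteq> {}"
      using U zariski_open_polyfun[OF F(1)] F(2) by (intro zariski_open_Int_nonempty) auto
    then obtain c where "c \<in> U" "F c \<noteq> 0" by blast
    then show "r' = r" using U(3) least[of c] by simp
  qed
  then show ?thesis using below[of t c] t unfolding Q_def by simp
qed

text \<open>A Lefschetz form cannot act surjectively here, so it acts injectively, and the difference is the
  dimension of a space of binary forms of degree $d+1$.\<close>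

lemma hilb_growth_below_reduction_number:
  fixes I :: "'a::field_char_0 poly3 set"
  assumes I: "homogeneous_artinian_ideal I" and L: "weak_Lefschetz I" and d: "d < reduction_number1 I"
  shows "int (hilb I (Suc d)) - int (hilb I d) \<le> int d + 2"
proof -
  have hI: "homogeneous_ideal I" using I by (simp add: homogeneous_artinian_ideal_def)
  then have sI: "ideal.subspace I" by (rule homogeneous_ideal_subspace)
  obtain g h where h: "\<And>p. act g (act h p) = p" "\<And>p. act h (act g p) = p"
    "\<And>d. mult_inj I (act h (xvar 3)) d \<or> mult_surj I (act h (xvar 3)) d"
    by (fact weak_Lefschetz_coordinate[OF sI L])
  have "\<not> mult_surj I (act h (xvar 3)) d"
    using mult_surj_span[of I "act h (xvar 3)" d] reduction_number1_lower[OF I d] by (auto simp: act_xvar)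
  then have "pv.vs.dim (colon_part I (act h (xvar 3)) d) = hilb I d"
    using h(3) by (auto simp: mult_inj_iff_dim[OF sI])
  moreover have "rk I g (Suc d) (plane_mons (Suc d) (Suc (Suc d))) \<le> Suc (Suc d)"
    using rk_le_card[of "plane_mons (Suc d) (Suc (Suc d))" I g "Suc d"] card_plane_mons[of "Suc (Suc d)" "Suc d"] by simp
  ultimately show ?thesis using hilb_Suc_eq[OF sI h(1,2), of d] by simp
qed

section \<open>Minimal monomial generators\<close>

definition min_mons :: "mon set \<Rightarrow> mon set" where
  "min_mons M = {T \<in> M. \<forall>S\<in>M. \<forall>U. T = U + S \<longrightarrow> S = T}"

lemma span_monoms:
  "ideal.span (monom ` G :: 'a::comm_ring_1 poly3 set) = {p. keys p \<subseteq> {U + S | U S. S \<in> G}}"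
proof
  have up: "S' + T \<in> {U + S | U S. S \<in> G}" if "T \<in> {U + S | U S. S \<in> G}" for S' T
    using that by auto (metis add.assoc)
  show "ideal.span (monom ` G) \<subseteq> {p :: 'a poly3. keys p \<subseteq> {U + S | U S. S \<in> G}}"
  proof (rule ideal.span_minimal)
    show "monom ` G \<subseteq> {p :: 'a poly3. keys p \<subseteq> {U + S | U S. S \<in> G}}"
      by (auto simp: Defs.monom_def) (metis add_0)
  qed (rule subspace_supported[OF up])
  show "{p :: 'a poly3. keys p \<subseteq> {U + S | U S. S \<in> G}} \<subseteq> ideal.span (monom ` G)"
  proof
    fix p :: "'a poly3" assume p: "p \<in> {p. keys p \<subseteq> {U + S | U S. S \<in> G}}"
    show "p \<in> ideal.span (monom ` G)"
    proof (rule ideal_mem_of_monomials[OF ideal.subspace_span])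
      fix T assume "T \<in> keys p"
      then obtain U S where "T = U + S" "S \<in> G" using p by blast
      then show "monom T \<in> ideal.span (monom ` G :: 'a poly3 set)"
        by (simp add: monom_add ideal.span_scale ideal.span_base)
    qed
  qed
qed

lemma min_mons_generate:
  assumes "\<And>S T. T \<in> M \<Longrightarrow> S + T \<in> M"
  shows "{U + S | U S. S \<in> min_mons M} = M"
proof (intro equalityI subsetI)
  fix T assume "T \<in> M"
  then show "T \<in> {U + S | U S. S \<in> min_mons M}"
  proof (induction "mdeg T" arbitrary: T rule: less_induct)
    case less
    show ?case
    proof (cases "T \<in> min_mons M")
      case True
      have "T = 0 + T" by simp
      then show ?thesis using True by blast
    next
      case False
      then obtain S U where S: "S \<in> M" "T = U + S" "S \<noteq> T" using less.prems unfolding min_mons_def by blast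
      have "mdeg U \<noteq> 0"
      proof
        assume "mdeg U = 0"
        then have "U = 0" by (intro mon_eqI) (auto simp: mdeg_alt)
        then show False using S by simp
      qed
      then have "mdeg S < mdeg T" using S by (simp add: mdeg_add)
      then obtain V W where "S = V + W" "W \<in> min_mons M" using less.hyps S(1) by blast
      then have "T = (U + V) + W" using S by (simp add: add.assoc)
      then show ?thesis using \<open>W \<in> min_mons M\<close> by blast
    qed
  qed
qed (use assms in \<open>auto simp: min_mons_def\<close>)

text \<open>A set of monomials generates iff its multiples are all of \<open>M\<close>; every such set contains the
  monomials that are minimal for divisibility, and these generate by induction on the degree.\<close>

lemma minimal_monomial_generators_eq:
  assumes up: "\<And>S T. T \<in> M \<Longrightarrow> S + T \<in> M"
  shows "minimal_monomial_generators {p :: 'a::comm_ring_1 poly3. keys p \<subseteq> M} = min_mons M"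
proof -
  have gen: "ideal.span (monom ` G :: 'a poly3 set) = {p. keys p \<subseteq> M} \<longleftrightarrow> {U + S | U S. S \<in> G} = M" for G
    unfolding span_monoms supported_eq_iff ..
  have sub: "S \<in> {U + S | U S. S \<in> G}" if "S \<in> G" for S and G :: "mon set"
  proof -
    have "S = 0 + S" by simp
    then show ?thesis using that by blast
  qed
  have min: "min_mons M \<subseteq> G" if G: "{U + S | U S. S \<in> G} = M" for G
  proof
    fix T assume T: "T \<in> min_mons M"
    then have "T \<in> M" by (simp add: min_mons_def)
    then obtain U S where "T = U + S" "S \<in> G" using G by blast
    moreover from this have "S \<in> M" using sub G by blast
    moreover have "\<forall>S\<in>M. \<forall>U. T = U + S \<longrightarrow> S = T" using T by (simp add: min_mons_def)
    ultimately show "T \<in> G" by metis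
  qed
  show ?thesis unfolding minimal_monomial_generators_def gen
  proof (rule the_equality)
    show "{U + S | U S. S \<in> min_mons M} = M \<and> (\<forall>H\<subset>min_mons M. {U + S | U S. S \<in> H} \<noteq> M)"
      using min_mons_generate[OF up] min by blast
    fix G assume "{U + S | U S. S \<in> G} = M \<and> (\<forall>H\<subset>G. {U + S | U S. S \<in> H} \<noteq> M)"
    then show "G = min_mons M" using min[of G] min_mons_generate[OF up] by blast
  qed
qed

lemma max_var_le_2: "max_var T \<le> 2 \<longleftrightarrow> lookup T 3 = 0"
proof -
  have "max_var T \<le> 2 \<longleftrightarrow> (\<forall>i\<in>{1..3}. lookup T (of_nat i) \<noteq> 0 \<longrightarrow> i \<le> 2)"
    unfolding max_var_def by (subst Max_le_iff) auto
  also have "{1..3::nat} = {1,2,3}" by auto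
  finally show ?thesis by auto
qed

text \<open>Monomials in $x_1,x_2$ are settled by \<open>plane_mon_in_gin_iff\<close>, because \<open>plane_rank_Suc\<close> expresses the
  plane ranks by the common Hilbert function. In degrees up to the reduction number factors $x_3$ are
  cancelled one by one until such a monomial is left.\<close>

lemma gin_of_equal_hilb:
  fixes I J :: "'a::field_char_0 poly3 set"
  assumes I: "homogeneous_artinian_ideal I" and J: "homogeneous_artinian_ideal J"
    and LI: "weak_Lefschetz I" and LJ: "weak_Lefschetz J"
    and H: "\<And>d. hilb I d = hilb J d"
  shows "{T \<in> minimal_monomial_generators (gin I). max_var T \<le> 2}
           = {T \<in> minimal_monomial_generators (gin J). max_var T \<le> 2} \<and>
         (\<forall>d \<le> reduction_number1 I. degree_part (gin I) d = degree_part (gin J) d)"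
proof -
  have sIJ: "ideal.subspace I" "ideal.subspace J" "I \<noteq> UNIV" "J \<noteq> UNIV"
    using I J by (auto simp: homogeneous_artinian_ideal_def homogeneous_ideal_subspace)
  have pr: "plane_rank I d = plane_rank J d" for d
  proof (cases d)
    case 0
    then show ?thesis using plane_rank_0 sIJ by metis
  next
    case (Suc e)
    then have "int (plane_rank I d) = int (plane_rank J d)"
      using plane_rank_Suc[OF I LI, of e] plane_rank_Suc[OF J LJ, of e] H by simp
    then show ?thesis by simp
  qed
  have plane: "T \<in> gin_monomials I \<longleftrightarrow> T \<in> gin_monomials J" if "lookup T 3 = 0" for T
  proof -
    have "T = plane_mon (mdeg T) (lookup T 2)" "lookup T 2 \<le> mdeg T"
      using that by (auto intro!: mon_eqI simp: mdeg_alt)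
    then show ?thesis using plane_mon_in_gin_iff[OF I] plane_mon_in_gin_iff[OF J] pr by metis
  qed
  have gens: "minimal_monomial_generators (gin K) = min_mons (gin_monomials K)"
    if "homogeneous_artinian_ideal K" for K :: "'a poly3 set"
    unfolding gin_eq_supported[OF that]
    using minimal_monomial_generators_eq gin_monomials_add[OF that] gin_eq_supported[OF that] by metis
  have "T \<in> min_mons (gin_monomials I) \<longleftrightarrow> T \<in> min_mons (gin_monomials J)" if T: "lookup T 3 = 0" for T
  proof -
    have "lookup S 3 = 0" if "T = U + S" for U S using T that by (simp add: lookup_add)
    then show ?thesis using plane T unfolding min_mons_def by blast
  qed
  then have first: "{T \<in> minimal_monomial_generators (gin I). max_var T \<le> 2}
           = {T \<in> minimal_monomial_generators (gin J). max_var T \<le> 2}"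
    unfolding gens[OF I] gens[OF J] max_var_le_2 by blast
  have low: "T \<in> gin_monomials I \<longleftrightarrow> T \<in> gin_monomials J" if "mdeg T \<le> reduction_number1 I" for T
    using that
  proof (induction "lookup T 3" arbitrary: T)
    case 0
    then show ?case using plane by simp
  next
    case (Suc n)
    define S where "S = T - single 3 1"
    have T: "T = single 3 1 + S"
      using Suc.hyps(2) unfolding S_def by (intro mon_eqI) (simp_all add: lookup_add lookup_minus lookup_single when_def)
    have d: "mdeg T = Suc (mdeg S)" by (simp add: T mdeg_add)
    then have lt: "mdeg S < reduction_number1 I" using Suc.prems by simp
    have D: "int (hilb I (Suc (mdeg S))) - int (hilb I (mdeg S)) \<le> int (mdeg S) + 2"
      by (rule hilb_growth_below_reduction_number[OF I LI lt])
    have "T \<in> gin_monomials I \<longleftrightarrow> S \<in> gin_monomials I"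
    proof
      assume "T \<in> gin_monomials I"
      then show "S \<in> gin_monomials I" unfolding T
        by (rule gin_x3_cancel[OF I _ refl, rotated]) (use D plane_rank_Suc[OF I LI, of "mdeg S"] in simp)
    qed (auto simp: T intro: gin_monomials_add[OF I])
    moreover have "T \<in> gin_monomials J \<longleftrightarrow> S \<in> gin_monomials J"
    proof
      assume "T \<in> gin_monomials J"
      then show "S \<in> gin_monomials J" unfolding T
        by (rule gin_x3_cancel[OF J _ refl, rotated]) (use D H plane_rank_Suc[OF J LJ, of "mdeg S"] in simp)
    qed (auto simp: T intro: gin_monomials_add[OF J])
    moreover have "S \<in> gin_monomials I \<longleftrightarrow> S \<in> gin_monomials J"
      using Suc.hyps(2) lt by (intro Suc.hyps(1)) (simp_all add: T lookup_add)
    ultimately show ?case by simp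
  qed
  have "degree_part (gin I) d = degree_part (gin J) d" if "d \<le> reduction_number1 I" for d
  proof -
    have "keys p \<subseteq> gin_monomials I \<longleftrightarrow> keys p \<subseteq> gin_monomials J" if p: "homogeneous d p" for p :: "'a poly3"
    proof -
      have "T \<in> gin_monomials I \<longleftrightarrow> T \<in> gin_monomials J" if "T \<in> keys p" for T
        using low[of T] that p \<open>d \<le> reduction_number1 I\<close> by (simp add: homogeneous_def)
      then show ?thesis by blast
    qed
    then show ?thesis by (auto simp: degree_part_def gin_eq_supported[OF I] gin_eq_supported[OF J])
  qed
  then show ?thesis using first by blast
qed

theorem proposition4p5:
  fixes I J :: "'a::field_char_0 poly3 set"
  assumes "homogeneous_artinian_ideal I" and "homogeneous_artinian_ideal J"
    and "\<forall>q i. graded_betti I q i = graded_betti J q i"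
    and "weak_Lefschetz I" and "weak_Lefschetz J"
  shows "{T \<in> minimal_monomial_generators (gin I). max_var T \<le> 2}
           = {T \<in> minimal_monomial_generators (gin J). max_var T \<le> 2} \<and>
         (\<forall>d \<le> reduction_number1 I. degree_part (gin I) d = degree_part (gin J) d)"
proof -
  have "ideal.subspace I" "ideal.subspace J"
    using assms(1,2) by (simp_all add: homogeneous_artinian_ideal_def homogeneous_ideal_subspace)
  then have "hilb I = hilb J" using assms(3) by (rule graded_betti_determines_hilb)
  then show ?thesis using assms(1,2,4,5) by (intro gin_of_equal_hilb) simp_all
qed

end
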